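(* Let $d$ be an integer with $|d|\ge 2$, and let $T\colon\mathbb{T}\to\mathbb{T}$ be given by $T(x)=d\,x \pmod 1$. Then there exist rational numbers $c_k\in\mathbb{Q}$ ($k\ge 1$) and a function $\widetilde F\in C(\mathbb{T},\mathbb{R})$ of the form $$\widetilde F(x)=\sum_{k=1}^{+\infty}c_k\cos(2\pi kx),$$ such that the Fourier partial sums $\sum_{k=1}^{K}c_k\cos(2\pi kx)$ converge uniformly to $\widetilde F$ on $\mathbb{T}$ as $K\to+\infty$, and Lebesgue measure is the unique $T$-invariant maximizing measure for $\widetilde F$. Moreover, each coefficient $c_k$ is determined exactly by a finite procedure.
   Context: $\mathbb{T}=\mathbb{R}/\mathbb{Z}$. A $T$-invariant Borel probability measure $\mu$ is called maximizing for $f\in C(\mathbb{T},\mathbb{R})$ if $\int f\,\mathrm{d}\mu=\sup_{\nu}\int f\,\mathrm{d}\nu$, the supremum being over all $T$-invariant Borel probability measures $\nu$ on $\mathbb{T}$. "Each $c_k$ is determined exactly by a finite procedure" means: there is an algorithm which, given $k$, returns the exact value of the rational number $c_k$ (not merely an approximation) after finitely many arithmetic operations. *)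

theory Defs
  imports "HOL-Probability.Probability"
begin

quotient_type circle = real / "\<lambda>x y::real. x - y \<in> \<int>"
  morphisms rep_circle circle_of_real
proof (rule equivpI)
  show "reflp (\<lambda>x y::real. x - y \<in> \<int>)"
    by (simp add: reflp_def)
  show "symp (\<lambda>x y::real. x - y \<in> \<int>)"
    by (metis (no_types, lifting) Ints_minus minus_diff_eq sympI)
  show "transp (\<lambda>x y::real. x - y \<in> \<int>)"
  proof (rule transpI)
    fix x y z :: real
    assume "x - y \<in> \<int>" "y - z \<in> \<int>"
    then have "(x - y) + (y - z) \<in> \<int>"
      by (rule Ints_add)
    then show "x - z \<in> \<int>"
      by simp
  qed
qed

instantiation circle :: topological_space
begin

definition open_circle :: "circle set \<Rightarrow> bool" where
  "open_circle U \<longleftrightarrow> open (circle_of_real -` U)"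

instance
  by standard (simp_all add: open_circle_def open_Int vimage_Union open_UN)

end

lemma continuous_circle_of_real: "continuous_on UNIV circle_of_real"
  by (simp add: continuous_on_open_vimage open_circle_def)

lemma measurable_circle_of_real [measurable]: "circle_of_real \<in> borel_measurable borel"
  by (rule borel_measurable_continuous_onI[OF continuous_circle_of_real])

definition lebesgue_circle :: "circle measure" where
  "lebesgue_circle = distr (restrict_space lborel {0..<1}) borel circle_of_real"

lift_definition circle_times :: "int \<Rightarrow> circle \<Rightarrow> circle" is
  "\<lambda>d x. of_int d * x"
proof -
  fix d :: int and x y :: real
  assume "x - y \<in> \<int>"
  then have "of_int d * (x - y) \<in> \<int>"
    by (intro Ints_mult) simp_all
  then show "of_int d * x - of_int d * y \<in> \<int>"
    by (simp add: algebra_simps)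
qed

lemma continuous_circle_times: "continuous_on UNIV (circle_times d)"
proof -
  have "open (circle_of_real -` (circle_times d -` U))" if "open U" for U
  proof -
    have "circle_of_real -` (circle_times d -` U) = (\<lambda>x. of_int d * x) -` (circle_of_real -` U)"
      by (auto simp: circle_times.abs_eq)
    moreover have "open ((\<lambda>x::real. of_int d * x) -` (circle_of_real -` U))"
      by (rule open_vimage) (use that in \<open>auto simp: open_circle_def intro!: continuous_intros\<close>)
    ultimately show ?thesis
      by simp
  qed
  then show ?thesis
    by (simp add: continuous_on_open_vimage open_circle_def)
qed

lemma measurable_circle_times [measurable]: "circle_times d \<in> borel_measurable borel"
  by (rule borel_measurable_continuous_onI[OF continuous_circle_times])

lift_definition circle_cos :: "nat \<Rightarrow> circle \<Rightarrow> real" is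
  "\<lambda>k x. cos (2 * pi * of_nat k * x)"
proof -
  fix k :: nat and x y :: real
  assume "x - y \<in> \<int>"
  then obtain n :: int where "x - y = of_int n"
    by (auto elim: Ints_cases)
  then have x: "x = y + of_int n"
    by simp
  define m where "m = int k * n"
  have "2 * pi * of_nat k * x = 2 * pi * of_nat k * y + 2 * pi * of_int m"
    by (simp add: x m_def algebra_simps)
  then show "cos (2 * pi * of_nat k * x) = cos (2 * pi * of_nat k * y)"
    by (simp add: cos_add cos_int_2pin sin_int_2pin)
qed

definition invariant_measures :: "(circle \<Rightarrow> circle) \<Rightarrow> circle measure set" where
  "invariant_measures T = {\<mu>. prob_space \<mu> \<and> sets \<mu> = sets borel \<and> distr \<mu> borel T = \<mu>}"

text \<open>The supremum is a real one; it is meaningful for continuous \<open>f\<close> and \<open>T\<close>, the circle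
  being compact.\<close>

definition maximizing_measure ::
  "(circle \<Rightarrow> circle) \<Rightarrow> (circle \<Rightarrow> real) \<Rightarrow> circle measure \<Rightarrow> bool" where
  "maximizing_measure T f \<mu> \<longleftrightarrow> \<mu> \<in> invariant_measures T \<and>
     (\<integral>x. f x \<partial>\<mu>) = (SUP \<nu> \<in> invariant_measures T. \<integral>x. f x \<partial>\<nu>)"

text \<open>\<open>total_recursive n f\<close>: on lists of length \<open>n\<close>, the function \<open>f\<close> is a total recursive
  function of \<open>n\<close> arguments (values on lists of other lengths are irrelevant). Minimization
  is only applied to regular functions; by Kleene's normal form theorem this yields exactly
  the total computable functions.\<close>

inductive total_recursive :: "nat \<Rightarrow> (nat list \<Rightarrow> nat) \<Rightarrow> bool" where
  zero: "total_recursive n (\<lambda>xs. 0)"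
| succ: "total_recursive 1 (\<lambda>xs. Suc (xs ! 0))"
| proj: "i < n \<Longrightarrow> total_recursive n (\<lambda>xs. xs ! i)"
| comp: "total_recursive (length gs) f \<Longrightarrow> (\<forall>g\<in>set gs. total_recursive n g) \<Longrightarrow>
    total_recursive n (\<lambda>xs. f (map (\<lambda>g. g xs) gs))"
| prim_rec: "total_recursive n f \<Longrightarrow> total_recursive (Suc (Suc n)) g \<Longrightarrow>
    total_recursive (Suc n) (\<lambda>xs. rec_nat (f (tl xs)) (\<lambda>k r. g (k # r # tl xs)) (hd xs))"
| minimize: "total_recursive (Suc n) f \<Longrightarrow> (\<forall>xs. length xs = n \<longrightarrow> (\<exists>k. f (k # xs) = 0)) \<Longrightarrow>
    total_recursive n (\<lambda>xs. LEAST k. f (k # xs) = 0)"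

definition computable_nat_seq :: "(nat \<Rightarrow> nat) \<Rightarrow> bool" where
  "computable_nat_seq a \<longleftrightarrow> (\<exists>f. total_recursive 1 f \<and> (\<forall>k. a k = f [k]))"

definition computable_rat_seq :: "(nat \<Rightarrow> rat) \<Rightarrow> bool" where
  "computable_rat_seq c \<longleftrightarrow> (\<exists>s p q. computable_nat_seq s \<and> computable_nat_seq p \<and>
     computable_nat_seq q \<and> (\<forall>k. q k \<noteq> 0 \<and> c k = (- 1) ^ s k * of_nat (p k) / of_nat (q k)))"

end

theory Submission
  imports Defs
begin

text \<open>Write \<open>a\<^sub>k(\<mu>)\<close> for the integral of \<open>cos (2 \<pi> k x)\<close> against \<open>\<mu>\<close>. The function \<open>F\<close> has mean zero and satisfies
  \<open>\<integral> F d\<mu> \<le> - |a\<^sub>k(\<mu>)| / 4^k\<close> for every invariant \<open>\<mu>\<close> and every \<open>k \<ge> 1\<close>. So Lebesgue measure is maximizing, and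
  every maximizing measure has vanishing cosine coefficients. Its sine coefficients then vanish as well, because the
  square of an ergodic average of \<open>sin (2 \<pi> k x)\<close> is a cosine polynomial with small constant term; hence the
  measure is Lebesgue (\<open>invariant_eq_lebesgue\<close>).

  Multiplication by \<open>k\<close> commutes with \<open>T\<close>. It therefore suffices to construct a single mean zero function \<open>f\<close> with
  \<open>\<integral> f d\<mu> \<le> - |a\<^sub>1(\<mu>)|\<close>, and to put \<open>F(x) = \<Sum>k. f(k x) / 4^k\<close> (\<open>integral_full_fun\<close>).

  The function \<open>f\<close> is a uniform limit of cosine polynomials \<open>f\<^sub>j\<close> of mean zero, starting with \<open>f\<^sub>0 = 0\<close>. With
  \<open>u = cos (2 \<pi> x)\<close> and \<open>\<epsilon> = 2^(-j)\<close> they obey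
  \<open>(Birkhoff sum of f\<^sub>j over N steps) + |Birkhoff sum of u over N steps| \<le> N \<epsilon> + C\<^sub>j\<close>
  at every point and for all \<open>N\<close>, which after integration and \<open>N \<rightarrow> \<infinity>\<close> gives \<open>\<integral> f\<^sub>j d\<mu> + |a\<^sub>1(\<mu>)| \<le> \<epsilon>\<close>.
  To halve \<open>\<epsilon>\<close>, let \<open>v\<^sup>+\<close>, \<open>v\<^sup>-\<close> be long block averages of \<open>f\<^sub>j + u\<close>, \<open>f\<^sub>j - u\<close>, let \<open>P\<^sup>+\<close>, \<open>P\<^sup>-\<close> be the Riesz
  products of \<open>m\<close> factors \<open>1 + (4 / (\<epsilon> m)) v\<close> composed with well separated iterates of \<open>T\<close>, and subtract a cohomologous
  copy of \<open>\<theta> = (\<epsilon>/4) (P\<^sup>+ + P\<^sup>- - 2)\<close>. Three facts make this work.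

  \<^item> For large \<open>m\<close> the product \<open>P\<close> is nearly \<open>exp (4 s / \<epsilon>)\<close>, where \<open>s\<close> is an average of \<open>v\<close>. From
    \<open>exp t \<ge> 1 + t\<close>, an orbit along which \<open>f\<^sub>j + u\<close> or \<open>f\<^sub>j - u\<close> has average \<open>s\<close> is brought down to
    \<open>s - (\<epsilon>/4) (1 + 4 s / \<epsilon> - 2) = \<epsilon>/4\<close>, up to a further error \<open>\<epsilon>/4\<close> (\<open>birkhoff_sum_improve\<close>).
  \<^item> The blocks are so long that \<open>v \<le> 2 \<epsilon>\<close>, so \<open>P \<le> exp 8\<close>; hence \<open>\<theta>\<close> is \<open>O(\<epsilon>)\<close> and the \<open>f\<^sub>j\<close>
    converge uniformly (\<open>riesz_increment_bounds\<close>).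
  \<^item> The factors are dissociated, so \<open>P\<close> has mean exactly 1 and \<open>\<theta>\<close> mean exactly 0 (\<open>riesz_coeff_0\<close>).

  What is subtracted is the average of many dilated copies of \<open>\<theta>\<close> whose spectra are disjoint blocks beyond
  the spectrum of \<open>f\<^sub>j\<close>. Since a Fourier partial sum cuts at most one of the copies, the partial sums converge uniformly
  too (\<open>partial_sum_average_le\<close>), and every coefficient is final after finitely many stages.

  All parameters are explicit, and a stage is a finite computation with rational coefficient sequences. Computability of
  the coefficients is obtained by coding finitely supported rational sequences as natural numbers and running the same
  recursion on the codes (\<open>computable_rat_recursion\<close>).\<close>

section \<open>Recursive functions of natural and rational numbers\<close>

text \<open>\<open>total_recursive\<close> speaks of a function on all lists, of which only those of length \<open>n\<close> matter.
  Passing to functions that agree on these lists allows the defining term of a function to be rewritten.\<close>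

definition recf :: "nat \<Rightarrow> (nat list \<Rightarrow> nat) \<Rightarrow> bool" where
  "recf n f \<longleftrightarrow> (\<exists>g. total_recursive n g \<and> (\<forall>xs. length xs = n \<longrightarrow> f xs = g xs))"

lemma recf_proj: "i < n \<Longrightarrow> recf n (\<lambda>xs. xs ! i)"
  unfolding recf_def using total_recursive.proj by blast

lemma recf_zero: "recf n (\<lambda>xs. 0)"
  unfolding recf_def using total_recursive.zero by blast

lemma recf_comp:
  assumes f: "recf (length gs) f" and gs: "\<And>g. g \<in> set gs \<Longrightarrow> recf n g"
  shows "recf n (\<lambda>xs. f (map (\<lambda>g. g xs) gs))"
proof -
  obtain f' where f': "total_recursive (length gs) f'" "\<And>xs. length xs = length gs \<Longrightarrow> f xs = f' xs"
    using f unfolding recf_def by blast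
  obtain h where h: "\<And>g. g \<in> set gs \<Longrightarrow> total_recursive n (h g)"
      "\<And>g xs. g \<in> set gs \<Longrightarrow> length xs = n \<Longrightarrow> g xs = h g xs"
    using gs unfolding recf_def by metis
  have "total_recursive n (\<lambda>xs. f' (map (\<lambda>g. g xs) (map h gs)))"
    by (rule total_recursive.comp) (use f' h in auto)
  moreover have "f (map (\<lambda>g. g xs) gs) = f' (map (\<lambda>g. g xs) (map h gs))" if "length xs = n" for xs
  proof -
    have "map (\<lambda>g. g xs) gs = map (\<lambda>g. g xs) (map h gs)"
      using h that by simp
    then show ?thesis
      using f'(2)[of "map (\<lambda>g. g xs) gs"] by (simp only: length_map)
  qed
  ultimately show ?thesis
    unfolding recf_def by blast
qed

lemma recf_comp1:
  assumes "recf (Suc 0) (\<lambda>xs. f (xs ! 0))" "recf n g"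
  shows "recf n (\<lambda>xs. f (g xs))"
  using recf_comp[of "[g]" "\<lambda>xs. f (xs ! 0)" n] assms by simp

lemma recf_comp2:
  assumes "recf 2 (\<lambda>xs. f (xs ! 0) (xs ! 1))" "recf n g" "recf n h"
  shows "recf n (\<lambda>xs. f (g xs) (h xs))"
  using recf_comp[of "[g, h]" "\<lambda>xs. f (xs ! 0) (xs ! 1)" n] assms by (auto simp: numeral_2_eq_2)

lemma recf_Suc: "recf n f \<Longrightarrow> recf n (\<lambda>xs. Suc (f xs))"
  by (rule recf_comp1[where f=Suc]) (use total_recursive.succ in \<open>auto simp: recf_def\<close>)

lemma recf_const: "recf n (\<lambda>xs. c)"
  by (induction c) (auto intro: recf_zero recf_Suc)

lemma recf_rec:
  assumes f: "recf n f" and g: "recf (Suc (Suc n)) g"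
  shows "recf (Suc n) (\<lambda>xs. rec_nat (f (tl xs)) (\<lambda>k r. g (k # r # tl xs)) (hd xs))"
proof -
  obtain f' where f': "total_recursive n f'" "\<And>xs. length xs = n \<Longrightarrow> f xs = f' xs"
    using f unfolding recf_def by blast
  obtain g' where g': "total_recursive (Suc (Suc n)) g'" "\<And>xs. length xs = Suc (Suc n) \<Longrightarrow> g xs = g' xs"
    using g unfolding recf_def by blast
  have "rec_nat (f (tl xs)) (\<lambda>k r. g (k # r # tl xs)) m = rec_nat (f' (tl xs)) (\<lambda>k r. g' (k # r # tl xs)) m"
    if "length xs = Suc n" for xs m
    by (induction m) (use that f' g' in auto)
  then show ?thesis
    unfolding recf_def using total_recursive.prim_rec[OF f'(1) g'(1)] by blast
qed

lemma recf_minimize: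
  assumes f: "recf (Suc n) f" and ex: "\<And>xs. length xs = n \<Longrightarrow> \<exists>k. f (k # xs) = 0"
  shows "recf n (\<lambda>xs. LEAST k. f (k # xs) = 0)"
proof -
  obtain f' where f': "total_recursive (Suc n) f'" "\<And>xs. length xs = Suc n \<Longrightarrow> f xs = f' xs"
    using f unfolding recf_def by blast
  have eq: "f (k # xs) = f' (k # xs)" if "length xs = n" for k xs
    using f'(2) that by simp
  have "total_recursive n (\<lambda>xs. LEAST k. f' (k # xs) = 0)"
    by (rule total_recursive.minimize[OF f'(1)]) (use ex eq in auto)
  then show ?thesis
    unfolding recf_def using eq by (intro exI conjI) auto
qed

text \<open>Recursion on the first of two arguments; arithmetic and pairing are built from this instance.\<close>

lemma recf_binary_rec:
  assumes f: "recf (Suc 0) (\<lambda>xs. f (xs ! 0))" and g: "recf 3 (\<lambda>xs. g (xs ! 0) (xs ! 1) (xs ! 2))"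
    and h: "\<And>x. h 0 x = f x" "\<And>k x. h (Suc k) x = g k (h k x) x"
  shows "recf 2 (\<lambda>xs. h (xs ! 0) (xs ! 1))"
proof -
  have r: "rec_nat (f x) (\<lambda>k r. g k r x) m = h m x" for m x
    by (induction m) (auto simp: h)
  have "recf (Suc (Suc 0)) (\<lambda>xs. rec_nat (f (tl xs ! 0)) (\<lambda>k r. g ((k # r # tl xs) ! 0) ((k # r # tl xs) ! 1) ((k # r # tl xs) ! 2)) (hd xs))"
    by (rule recf_rec) (use f g in \<open>auto simp: numeral_3_eq_3\<close>)
  then have "recf 2 (\<lambda>xs. h (hd xs) (tl xs ! 0))"
    by (simp add: r numeral_2_eq_2)
  moreover have "h (hd xs) (tl xs ! 0) = h (xs ! 0) (xs ! 1)" if "length xs = 2" for xs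
    using that by (cases xs) auto
  ultimately show ?thesis
    unfolding recf_def by metis
qed

lemma recf_add: "recf n f \<Longrightarrow> recf n g \<Longrightarrow> recf n (\<lambda>xs. f xs + g xs)"
proof (rule recf_comp2[where f="(+)"])
  show "recf 2 (\<lambda>xs. xs ! 0 + xs ! 1)"
    by (rule recf_binary_rec[where f="\<lambda>x. x" and g="\<lambda>k r x. Suc r"])
      (auto intro!: recf_proj recf_Suc)
qed

lemma recf_pred: "recf n f \<Longrightarrow> recf n (\<lambda>xs. f xs - 1)"
proof (rule recf_comp1[where f="\<lambda>x. x - 1"])
  have "recf 2 (\<lambda>xs. (\<lambda>m x. m - 1) (xs ! 0) (xs ! 1))"
    by (rule recf_binary_rec[where f="\<lambda>x. 0" and g="\<lambda>k r x. k"])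
      (auto intro!: recf_proj recf_zero)
  from recf_comp2[OF this recf_proj recf_zero, of 0 "Suc 0"]
  show "recf (Suc 0) (\<lambda>xs. xs ! 0 - 1)" by simp
qed

lemma recf_diff: "recf n f \<Longrightarrow> recf n g \<Longrightarrow> recf n (\<lambda>xs. f xs - g xs)"
proof (rule recf_comp2[where f="\<lambda>x y. y - x"])
  show "recf 2 (\<lambda>xs. xs ! 1 - xs ! 0)"
  proof (rule recf_binary_rec[where f="\<lambda>x. x" and g="\<lambda>k r x. r - 1"])
    show "recf 3 (\<lambda>xs. xs ! 1 - 1)"
      by (rule recf_pred) (auto intro!: recf_proj)
  qed (auto intro!: recf_proj)
qed

lemma recf_triangle: "recf n f \<Longrightarrow> recf n (\<lambda>xs. triangle (f xs))"
proof (rule recf_comp1[where f=triangle])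
  have "recf 2 (\<lambda>xs. (\<lambda>m x. triangle m) (xs ! 0) (xs ! 1))"
  proof (rule recf_binary_rec[where f="\<lambda>x. 0" and g="\<lambda>k r x. r + Suc k"])
    show "recf 3 (\<lambda>xs. xs ! 1 + Suc (xs ! 0))"
      by (intro recf_add recf_Suc recf_proj) simp_all
  qed (auto intro: recf_zero)
  from recf_comp2[OF this recf_proj recf_zero, of 0 "Suc 0"]
  show "recf (Suc 0) (\<lambda>xs. triangle (xs ! 0))" by simp
qed

definition pr :: "nat \<Rightarrow> nat \<Rightarrow> nat" where "pr m n = prod_encode (m, n)"
definition p1 :: "nat \<Rightarrow> nat" where "p1 z = fst (prod_decode z)"
definition p2 :: "nat \<Rightarrow> nat" where "p2 z = snd (prod_decode z)"

lemma pr_simps [simp]: "p1 (pr m n) = m" "p2 (pr m n) = n"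
  by (auto simp: pr_def p1_def p2_def)

text \<open>\<open>prod_encode (m, n) = triangle (m + n) + m\<close>, so the sum \<open>m + n\<close> is recovered as the index of
  the last triangular number
  not exceeding the code, which an unbounded search finds.\<close>

lemma pr_sum_Least: "(LEAST w. Suc z - triangle (Suc w) = 0) = p1 z + p2 z"
proof -
  obtain m n where z: "z = prod_encode (m, n)"
    by (metis prod_decode_inverse surj_pair)
  have p: "p1 z = m" "p2 z = n" by (auto simp: z p1_def p2_def)
  have mono: "triangle a \<le> triangle b" if "a \<le> b" for a b
    using that by (induction rule: dec_induct) auto
  have "(LEAST w. Suc z \<le> triangle (Suc w)) = m + n"
  proof (rule Least_equality)
    show "Suc z \<le> triangle (Suc (m + n))" by (simp add: z prod_encode_def)
    fix w assume "Suc z \<le> triangle (Suc w)"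
    show "m + n \<le> w"
    proof (rule ccontr)
      assume "\<not> m + n \<le> w"
      then have "triangle (Suc w) \<le> triangle (m + n)" by (intro mono) auto
      then show False using \<open>Suc z \<le> triangle (Suc w)\<close> by (simp add: z prod_encode_def)
    qed
  qed
  then show ?thesis by (simp add: p)
qed

lemma recf_pr_sum: "recf n f \<Longrightarrow> recf n (\<lambda>xs. p1 (f xs) + p2 (f xs))"
proof (rule recf_comp1[where f="\<lambda>z. p1 z + p2 z"])
  have "recf (Suc 0) (\<lambda>xs. LEAST w. Suc ((w # xs) ! 1) - triangle (Suc ((w # xs) ! 0)) = 0)"
  proof (rule recf_minimize)
    show "recf (Suc (Suc 0)) (\<lambda>xs. Suc (xs ! 1) - triangle (Suc (xs ! 0)))"
      by (intro recf_diff recf_triangle recf_Suc recf_proj) auto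
    fix xs :: "nat list"
    have "x \<le> triangle x" for x by (induction x) auto
    then have "Suc (xs ! 0) - triangle (Suc (xs ! 0)) = 0" by (meson diff_is_0_eq le_SucI)
    then show "\<exists>k. Suc ((k # xs) ! 1) - triangle (Suc ((k # xs) ! 0)) = 0"
      by (intro exI[of _ "xs ! 0"]) simp
  qed
  then show "recf (Suc 0) (\<lambda>xs. p1 (xs ! 0) + p2 (xs ! 0))"
    by (simp only: nth_Cons_0 One_nat_def nth_Cons_Suc pr_sum_Least)
qed

lemma p1_eq: "p1 z = z - triangle (p1 z + p2 z)"
proof -
  have "z = prod_encode (p1 z, p2 z)" by (simp add: p1_def p2_def)
  then show ?thesis by (simp add: prod_encode_def)
qed

lemma recf_p1: "recf n f \<Longrightarrow> recf n (\<lambda>xs. p1 (f xs))"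
  by (subst p1_eq) (intro recf_diff recf_triangle recf_pr_sum)

lemma recf_p2: "recf n f \<Longrightarrow> recf n (\<lambda>xs. p2 (f xs))"
  using recf_diff[OF recf_pr_sum recf_p1, of n f f] by simp

lemma recf_pr: "recf n f \<Longrightarrow> recf n g \<Longrightarrow> recf n (\<lambda>xs. pr (f xs) (g xs))"
  by (simp add: pr_def prod_encode_def recf_add recf_triangle)

text \<open>From here on all arguments of a function are packed into one number, whose components are
  read off by \<open>p1\<close> and \<open>p2\<close>.\<close>

definition computable :: "(nat \<Rightarrow> nat) \<Rightarrow> bool" where
  "computable f \<longleftrightarrow> recf (Suc 0) (\<lambda>xs. f (xs ! 0))"

lemma computable_nat_seq_iff: "computable_nat_seq a \<longleftrightarrow> computable a"
proof
  assume "computable_nat_seq a"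
  then obtain f where f: "total_recursive 1 f" "\<And>k. a k = f [k]"
    unfolding computable_nat_seq_def by blast
  have "a (xs ! 0) = f xs" if "length xs = Suc 0" for xs
    using that f(2) by (metis length_0_conv length_Suc_conv nth_Cons_0)
  then show "computable a" using f(1) unfolding computable_def recf_def by auto
next
  assume "computable a"
  then obtain g where "total_recursive (Suc 0) g" "\<And>xs. length xs = Suc 0 \<Longrightarrow> a (xs ! 0) = g xs"
    unfolding computable_def recf_def by blast
  then show "computable_nat_seq a" unfolding computable_nat_seq_def
    by (intro exI[of _ g]) (metis One_nat_def length_Cons list.size(3) nth_Cons_0)
qed

lemma computable_comp: "computable f \<Longrightarrow> computable g \<Longrightarrow> computable (\<lambda>x. f (g x))"
  unfolding computable_def by (rule recf_comp1)

lemma computable_id: "computable (\<lambda>x. x)"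
  and computable_const: "computable (\<lambda>x. c)"
  and computable_Suc: "computable f \<Longrightarrow> computable (\<lambda>x. Suc (f x))"
  and computable_add: "computable f \<Longrightarrow> computable g \<Longrightarrow> computable (\<lambda>x. f x + g x)"
  and computable_diff: "computable f \<Longrightarrow> computable g \<Longrightarrow> computable (\<lambda>x. f x - g x)"
  and computable_p1: "computable f \<Longrightarrow> computable (\<lambda>x. p1 (f x))"
  and computable_p2: "computable f \<Longrightarrow> computable (\<lambda>x. p2 (f x))"
  and computable_pr: "computable f \<Longrightarrow> computable g \<Longrightarrow> computable (\<lambda>x. pr (f x) (g x))"
  unfolding computable_def
  by (simp_all add: recf_proj recf_const recf_Suc recf_add recf_diff recf_p1 recf_p2 recf_pr)

lemma computable_rec:
  assumes f: "computable f" and g: "computable (\<lambda>q. g (p1 q) (p1 (p2 q)) (p2 (p2 q)))" and n: "computable n"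
  shows "computable (\<lambda>x. rec_nat (f x) (\<lambda>i r. g x i r) (n x))"
proof -
  have "recf 2 (\<lambda>xs. (\<lambda>m x. rec_nat (f x) (\<lambda>i r. g x i r) m) (xs ! 0) (xs ! 1))"
  proof (rule recf_binary_rec[where f=f and g="\<lambda>i r x. g x i r"])
    have "recf 3 (\<lambda>xs. (\<lambda>q. g (p1 q) (p1 (p2 q)) (p2 (p2 q))) (pr (xs ! 2) (pr (xs ! 0) (xs ! 1))))"
      by (rule recf_comp1[OF g[unfolded computable_def]]) (intro recf_pr recf_proj; simp)
    then show "recf 3 (\<lambda>xs. g (xs ! 2) (xs ! 0) (xs ! 1))" by simp
  qed (use f in \<open>auto simp: computable_def\<close>)
  from recf_comp2[OF this n[unfolded computable_def] recf_proj, of 0]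
  show ?thesis unfolding computable_def by simp
qed

lemma computable_mult:
  assumes "computable f" "computable g" shows "computable (\<lambda>x. f x * g x)"
proof -
  have "rec_nat 0 (\<lambda>i r. r + a) b = b * a" for a b :: nat
    by (induction b) auto
  then show ?thesis
    using computable_rec[of "\<lambda>x. 0" "\<lambda>x i r. r + g x" f] assms
    by (simp add: computable_const computable_add computable_comp computable_p2 computable_p1 computable_id)
qed

lemma computable_power:
  assumes "computable f" "computable g" shows "computable (\<lambda>x. f x ^ g x)"
proof -
  have "rec_nat 1 (\<lambda>i r. r * a) b = a ^ b" for a b :: nat
    by (induction b) (auto simp: mult.commute)
  then show ?thesis
    using computable_rec[of "\<lambda>x. 1" "\<lambda>x i r. r * f x" g] assms
      computable_comp[OF assms(1) computable_p1[OF computable_id]]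
    by (simp add: computable_const computable_mult computable_p2 computable_id)
qed

lemma computable_funpow:
  assumes "computable f" "computable g" "computable h"
  shows "computable (\<lambda>x. (f ^^ g x) (h x))"
proof -
  have "rec_nat a (\<lambda>i r. f r) b = (f ^^ b) a" for a b
    by (induction b) auto
  moreover have "computable (\<lambda>q. f (p2 (p2 q)))"
    by (rule computable_comp[OF assms(1)]) (intro computable_p2 computable_id)
  ultimately show ?thesis
    using computable_rec[of h "\<lambda>x i r. f r" g] assms by simp
qed

definition decidable :: "(nat \<Rightarrow> bool) \<Rightarrow> bool" where
  "decidable P \<longleftrightarrow> computable (\<lambda>x. of_bool (P x))"

lemma computable_if:
  assumes "decidable P" "computable f" "computable g"
  shows "computable (\<lambda>x. if P x then f x else g x)"
proof -
  have "computable (\<lambda>x. of_bool (P x) * f x + (1 - of_bool (P x)) * g x)"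
    using assms unfolding decidable_def
    by (intro computable_add computable_mult computable_diff computable_const)
  moreover have "(\<lambda>x. of_bool (P x) * f x + (1 - of_bool (P x)) * g x) = (\<lambda>x. if P x then f x else g x)"
    by auto
  ultimately show ?thesis by simp
qed

lemma decidable_le: 
  assumes "computable f" "computable g" shows "decidable (\<lambda>x. f x \<le> g x)"
proof -
  have "(\<lambda>x. of_bool (f x \<le> g x)) = (\<lambda>x. 1 - (f x - g x))" by auto
  then show ?thesis using assms unfolding decidable_def
    by (simp add: computable_diff computable_const)
qed

lemma decidable_conj: "decidable P \<Longrightarrow> decidable Q \<Longrightarrow> decidable (\<lambda>x. P x \<and> Q x)"
  unfolding decidable_def by (simp add: of_bool_conj computable_mult)

lemma decidable_eq: 
  assumes "computable f" "computable g" shows "decidable (\<lambda>x. f x = g x)"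
  using decidable_conj[OF decidable_le[OF assms] decidable_le[OF assms(2,1)]]
  by (simp add: order_eq_iff)

lemma computable_div:
  assumes "computable f" "computable g" shows "computable (\<lambda>x. f x div g x)"
proof -
  have *: "rec_nat 0 (\<lambda>i r. if Suc r * b \<le> a then Suc r else r) n = min n (a div b)" if "b > 0" for a b n :: nat
  proof (induction n)
    case (Suc n)
    have "Suc r * b \<le> a \<longleftrightarrow> Suc r \<le> a div b" for r
      using that by (simp only: less_eq_div_iff_mult_less_eq)
    with Suc show ?case by (auto simp: min_def simp del: mult_Suc)
  qed simp
  have 1: "(if b = 0 then 0 else rec_nat 0 (\<lambda>i r. if Suc r * b \<le> a then Suc r else r) a) = a div b" for a b :: nat
    using *[of b a a] div_le_dividend[of a b] by (auto simp: min_def)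
  have "computable (\<lambda>x. if g x = 0 then 0 else rec_nat 0 (\<lambda>i r. if Suc r * g x \<le> f x then Suc r else r) (f x))"
    by (intro computable_if decidable_eq decidable_le computable_rec computable_mult computable_Suc
       computable_p1 computable_p2 computable_const computable_id assms
       computable_comp[OF assms(1)] computable_comp[OF assms(2)])
  then show ?thesis by (simp only: 1)
qed

lemma decidable_dvd:
  assumes "computable f" "computable g" shows "decidable (\<lambda>x. f x dvd g x)"
proof -
  have "decidable (\<lambda>x. (g x div f x) * f x = g x)"
    by (intro decidable_eq computable_mult computable_div assms)
  moreover have "b div a * a = b \<longleftrightarrow> a dvd b" for a b :: nat
    by (metis dvd_div_mult_self dvd_triv_right)
  ultimately show ?thesis by simp
qed

text \<open>The code \<open>pr (pr a b) c\<close> stands for the rational number \<open>(a - b) / (c + 1)\<close>; codes are not unique.\<close>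

definition rat_of_code :: "nat \<Rightarrow> rat" where
  "rat_of_code z = (of_nat (p1 (p1 z)) - of_nat (p2 (p1 z))) / of_nat (Suc (p2 z))"

definition computable_rat :: "(nat \<Rightarrow> rat) \<Rightarrow> bool" where
  "computable_rat f \<longleftrightarrow> (\<exists>g. computable g \<and> (\<forall>x. f x = rat_of_code (g x)))"

lemma computable_rat_comp: "computable_rat f \<Longrightarrow> computable g \<Longrightarrow> computable_rat (\<lambda>x. f (g x))"
  unfolding computable_rat_def using computable_comp by fastforce

lemma computable_ratI:
  assumes "computable a" "computable b" "computable c" "\<And>x. c x > 0"
    "\<And>x. f x = (of_nat (a x) - of_nat (b x)) / of_nat (c x)"
  shows "computable_rat f"
  unfolding computable_rat_def
  using assms(4)
  by (intro exI[of _ "\<lambda>x. pr (pr (a x) (b x)) (c x - 1)"])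
    (auto simp: rat_of_code_def assms intro!: computable_pr computable_diff computable_const assms)

lemma computable_ratE:
  assumes "computable_rat f"
  shows "\<exists>a b c. computable a \<and> computable b \<and> computable c \<and>
    (\<forall>x. c x > 0 \<and> f x = (of_nat (a x) - of_nat (b x)) / of_nat (c x))"
proof -
  obtain g where g: "computable g" "\<And>x. f x = rat_of_code (g x)"
    using assms unfolding computable_rat_def by blast
  show ?thesis
    by (rule exI[of _ "\<lambda>x. p1 (p1 (g x))"], rule exI[of _ "\<lambda>x. p2 (p1 (g x))"], rule exI[of _ "\<lambda>x. Suc (p2 (g x))"])
      (auto simp: g(2) rat_of_code_def intro!: computable_p1 computable_p2 computable_Suc g(1))
qed

lemma computable_rat_add:
  assumes "computable_rat f" "computable_rat g" shows "computable_rat (\<lambda>x. f x + g x)"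
proof -
  obtain a b c where 1: "computable a" "computable b" "computable c" "\<And>x. c x > 0"
    "\<And>x. f x = (of_nat (a x) - of_nat (b x)) / of_nat (c x)" using computable_ratE[OF assms(1)] by blast
  obtain a' b' c' where 2: "computable a'" "computable b'" "computable c'" "\<And>x. c' x > 0"
    "\<And>x. g x = (of_nat (a' x) - of_nat (b' x)) / of_nat (c' x)" using computable_ratE[OF assms(2)] by blast
  show ?thesis
  proof (rule computable_ratI)
    show "computable (\<lambda>x. a x * c' x + a' x * c x)" "computable (\<lambda>x. b x * c' x + b' x * c x)"
      "computable (\<lambda>x. c x * c' x)"
      using 1 2 by (auto intro!: computable_add computable_mult)
    fix x
    show "0 < c x * c' x" using 1 2 by simp
    show "f x + g x = (of_nat (a x * c' x + a' x * c x) - of_nat (b x * c' x + b' x * c x)) / of_nat (c x * c' x)"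
      using 1(4)[of x] 2(4)[of x] by (simp add: 1(5) 2(5) field_simps)
  qed
qed

lemma computable_rat_mult:
  assumes "computable_rat f" "computable_rat g" shows "computable_rat (\<lambda>x. f x * g x)"
proof -
  obtain a b c where 1: "computable a" "computable b" "computable c" "\<And>x. c x > 0"
    "\<And>x. f x = (of_nat (a x) - of_nat (b x)) / of_nat (c x)" using computable_ratE[OF assms(1)] by blast
  obtain a' b' c' where 2: "computable a'" "computable b'" "computable c'" "\<And>x. c' x > 0"
    "\<And>x. g x = (of_nat (a' x) - of_nat (b' x)) / of_nat (c' x)" using computable_ratE[OF assms(2)] by blast
  show ?thesis
  proof (rule computable_ratI)
    show "computable (\<lambda>x. a x * a' x + b x * b' x)" "computable (\<lambda>x. a x * b' x + b x * a' x)"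
      "computable (\<lambda>x. c x * c' x)"
      using 1 2 by (auto intro!: computable_add computable_mult)
    fix x
    show "0 < c x * c' x" using 1 2 by simp
    show "f x * g x = (of_nat (a x * a' x + b x * b' x) - of_nat (a x * b' x + b x * a' x)) / of_nat (c x * c' x)"
      using 1(4)[of x] 2(4)[of x] by (simp add: 1(5) 2(5) field_simps)
  qed
qed

lemma computable_rat_const: "computable_rat (\<lambda>x. q)"
proof -
  obtain a b where ab: "q = of_int a / of_int b" "b > 0"
    by (metis Fract_of_int_quotient Rat_cases)
  show ?thesis
    by (rule computable_ratI[of "\<lambda>x. nat a" "\<lambda>x. nat (- a)" "\<lambda>x. nat b"])
      (use ab in \<open>auto intro: computable_const simp: of_nat_nat\<close>)
qed

lemma computable_rat_diff:
  assumes "computable_rat f" "computable_rat g" shows "computable_rat (\<lambda>x. f x - g x)"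
  using computable_rat_add[OF assms(1) computable_rat_mult[OF computable_rat_const[of "-1"] assms(2)]]
  by simp

lemma computable_rat_divide_nat:
  assumes "computable_rat f" "computable n" shows "computable_rat (\<lambda>x. f x / of_nat (n x))"
proof -
  have "computable_rat (\<lambda>x. 1 / of_nat (n x))"
  proof (rule computable_ratI)
    show "computable (\<lambda>x. if n x = 0 then 0 else 1)" "computable (\<lambda>x. 0)" "computable (\<lambda>x. if n x = 0 then 1 else n x)"
      by (intro computable_if decidable_eq assms computable_const)+
  qed auto
  then show ?thesis using computable_rat_mult[OF assms(1)] by fastforce
qed

lemma computable_rat_if:
  assumes "decidable P" "computable_rat f" "computable_rat g"
  shows "computable_rat (\<lambda>x. if P x then f x else g x)"
proof -
  obtain f' g' where "computable f'" "\<And>x. f x = rat_of_code (f' x)" "computable g'" "\<And>x. g x = rat_of_code (g' x)"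
    using assms unfolding computable_rat_def by blast
  then show ?thesis unfolding computable_rat_def
    using computable_if[OF assms(1), of f' g'] by (intro exI[of _ "\<lambda>x. if P x then f' x else g' x"]) auto
qed

lemma computable_rat_sum:
  assumes f: "computable_rat (\<lambda>q. f (p1 q) (p2 q))" and n: "computable n"
  shows "computable_rat (\<lambda>x. \<Sum>i<n x. f x i)"
proof -
  obtain h where h: "computable h" "\<And>q. f (p1 q) (p2 q) = rat_of_code (h q)"
    using f unfolding computable_rat_def by blast
  have "computable_rat (\<lambda>q. rat_of_code (p1 q) + rat_of_code (p2 q))"
    by (rule computable_rat_add)
     (use computable_p1[OF computable_id] computable_p2[OF computable_id] in \<open>auto simp: computable_rat_def\<close>)
  then obtain plus where plus: "computable plus" "\<And>q. rat_of_code (p1 q) + rat_of_code (p2 q) = rat_of_code (plus q)"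
    unfolding computable_rat_def by blast
  obtain z where z: "rat_of_code z = 0"
    by (rule that[of "pr (pr 0 0) 0"]) (simp add: rat_of_code_def)
  have "computable (\<lambda>x. rec_nat z (\<lambda>i r. plus (pr r (h (pr x i)))) (n x))"
    by (intro computable_rec computable_const n computable_comp[OF plus(1)] computable_comp[OF h(1)] computable_pr
        computable_p1 computable_p2 computable_id)
  moreover have "(\<Sum>i<k. f x i) = rat_of_code (rec_nat z (\<lambda>i r. plus (pr r (h (pr x i)))) k)" for x k
    by (induction k) (simp_all add: z plus(2)[symmetric] h(2)[symmetric])
  ultimately show ?thesis unfolding computable_rat_def by (intro exI conjI) auto
qed

lemma computable_rat_sum_atMost:
  assumes f: "computable_rat (\<lambda>q. f (p1 q) (p2 q))" and n: "computable n"
  shows "computable_rat (\<lambda>x. \<Sum>i\<le>n x. f x i)"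
  using computable_rat_sum[OF f computable_Suc[OF n]] by (simp add: lessThan_Suc_atMost)

text \<open>A finitely supported rational sequence is coded by the pair of a length \<open>n\<close> and an iterated
  pairing of the codes of its first \<open>n\<close> members, the last one outermost.\<close>

definition seq_of_code :: "nat \<Rightarrow> nat \<Rightarrow> rat" where
  "seq_of_code s k = (if Suc k \<le> p1 s then rat_of_code (p1 ((p2 ^^ (p1 s - Suc k)) (p2 s))) else 0)"

definition seq_code :: "(nat \<Rightarrow> nat) \<Rightarrow> nat \<Rightarrow> nat" where
  "seq_code h n = pr n (rec_nat 0 (\<lambda>i r. pr (h i) r) n)"

lemma seq_of_code_seq_code: "seq_of_code (seq_code h n) k = (if k < n then rat_of_code (h k) else 0)"
proof -
  have "p1 ((p2 ^^ (n - Suc k)) (rec_nat 0 (\<lambda>i r. pr (h i) r) n)) = h k" if "k < n" for n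
    using that
  proof (induction n)
    case (Suc n)
    show ?case
    proof (cases "k = n")
      case False
      then have "k < n" "Suc n - Suc k = Suc (n - Suc k)" using Suc.prems by auto
      then show ?thesis using Suc.IH by (simp add: funpow_swap1 del: funpow.simps add: funpow_Suc_right)
    qed simp
  qed simp
  then show ?thesis by (auto simp: seq_of_code_def seq_code_def)
qed

lemma computable_rat_seq_of_code:
  assumes "computable f" "computable g" shows "computable_rat (\<lambda>x. seq_of_code (f x) (g x))"
proof -
  have "computable_rat (\<lambda>x. rat_of_code (p1 ((p2 ^^ (p1 (f x) - Suc (g x))) (p2 (f x)))))"
    unfolding computable_rat_def
    by (rule exI[of _ "\<lambda>x. p1 ((p2 ^^ (p1 (f x) - Suc (g x))) (p2 (f x)))"])
      (simp add: computable_p1 computable_funpow computable_diff computable_Suc computable_p2 computable_id assms)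
  then show ?thesis unfolding seq_of_code_def
    by (intro computable_rat_if decidable_le computable_Suc computable_p1 assms computable_rat_const)
qed

text \<open>A recursion whose states are finitely supported rational sequences can be carried out on
  the codes of the states.\<close>

lemma computable_rat_recursion:
  fixes a :: "nat \<Rightarrow> nat \<Rightarrow> nat \<Rightarrow> rat"
  assumes init: "\<And>x. a x 0 = init x" and step: "\<And>x j. a x (Suc j) = step x j (a x j)"
    and supp: "\<And>x j k. a x j k \<noteq> 0 \<Longrightarrow> k \<le> G x j"
    and G: "computable (\<lambda>q. G (p1 q) (p2 q))"
    and c_init: "computable_rat (\<lambda>q. init (p1 q) (p2 q))"
    and c_step: "computable_rat (\<lambda>q. step (p1 q) (p1 (p2 q)) (seq_of_code (p1 (p2 (p2 q)))) (p2 (p2 (p2 q))))"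
    and f: "computable f" and g: "computable g" and h: "computable h"
  shows "computable_rat (\<lambda>x. a (f x) (g x) (h x))"
proof -
  obtain h0 where h0: "computable h0" "\<And>q. init (p1 q) (p2 q) = rat_of_code (h0 q)"
    using c_init unfolding computable_rat_def by blast
  obtain h1 where h1: "computable h1" "\<And>q. step (p1 q) (p1 (p2 q)) (seq_of_code (p1 (p2 (p2 q)))) (p2 (p2 (p2 q))) = rat_of_code (h1 q)"
    using c_step unfolding computable_rat_def by blast
  define s0 where "s0 = (\<lambda>x. seq_code (\<lambda>k. h0 (pr x k)) (Suc (G x 0)))"
  define s1 where "s1 = (\<lambda>x j s. seq_code (\<lambda>k. h1 (pr x (pr j (pr s k)))) (Suc (G x (Suc j))))"
  have dec0: "seq_of_code (s0 x) = a x 0" for x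
    unfolding s0_def seq_of_code_seq_code using h0(2)[of "pr x _"] supp[of x 0]
    by (auto simp: init fun_eq_iff less_Suc_eq_le)
  have dec1: "seq_of_code (s1 x j s) = a x (Suc j)" if "seq_of_code s = a x j" for x j s
    unfolding s1_def seq_of_code_seq_code using h1(2)[of "pr x (pr j (pr s _))"] supp[of x "Suc j"] that
    by (auto simp: step fun_eq_iff less_Suc_eq_le)
  have dec: "seq_of_code (rec_nat (s0 x) (\<lambda>j s. s1 x j s) j) = a x j" for x j
    by (induction j) (auto simp: dec0 dec1)
  have G': "computable (\<lambda>x. G (u x) (v x))" if "computable u" "computable v" for u v
    using computable_comp[OF G computable_pr[OF that]] by simp
  note ci = computable_rec computable_const computable_comp[OF h0(1)] computable_comp[OF h1(1)] computable_pr
      computable_p1 computable_p2 computable_id computable_Suc G' computable_comp[OF f] computable_comp[OF g]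
  have "computable (\<lambda>x. rec_nat (s0 (f x)) (\<lambda>j s. s1 (f x) j s) (g x))"
    unfolding s0_def s1_def seq_code_def by (intro ci f g)
  then have "computable_rat (\<lambda>x. seq_of_code (rec_nat (s0 (f x)) (\<lambda>j s. s1 (f x) j s) (g x)) (h x))"
    by (rule computable_rat_seq_of_code[OF _ h])
  then show ?thesis by (simp add: dec)
qed

lemma computable_rat_seqI:
  assumes "computable_rat c" shows "computable_rat_seq c"
proof -
  obtain a b n where 1: "computable a" "computable b" "computable n" "\<And>x. n x > 0"
    "\<And>x. c x = (of_nat (a x) - of_nat (b x)) / of_nat (n x)" using computable_ratE[OF assms] by blast
  show ?thesis unfolding computable_rat_seq_def computable_nat_seq_iff
  proof (intro exI conjI allI)
    show "computable (\<lambda>k. if a k \<le> b k then 1 else 0)"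
      by (intro computable_if decidable_le 1 computable_const)
    show "computable (\<lambda>k. (a k - b k) + (b k - a k))" by (intro computable_add computable_diff 1)
    show "computable n" by fact
    fix k
    show "n k \<noteq> 0" using 1(4)[of k] by simp
    show "c k = (- 1) ^ (if a k \<le> b k then 1 else 0) * of_nat (a k - b k + (b k - a k)) / of_nat (n k)"
      using 1(5)[of k] by (auto simp: of_nat_diff minus_divide_left)
  qed
qed

section \<open>The circle, its characters and invariant measures\<close>

lift_definition circle_sin :: "int \<Rightarrow> circle \<Rightarrow> real" is
  "\<lambda>k x. sin (2 * pi * of_int k * x)"
proof -
  fix k :: int and x y :: real
  assume "x - y \<in> \<int>"
  then obtain n :: int where "x = y + of_int n"
    by (metis Ints_cases add.commute diff_add_cancel)
  then have "2 * pi * of_int k * x = 2 * pi * of_int k * y + 2 * pi * of_int (k * n)"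
    by (simp add: algebra_simps)
  then show "sin (2 * pi * of_int k * x) = sin (2 * pi * of_int k * y)"
    by (simp only: sin_add cos_int_2pin sin_int_2pin mult_1_right mult_zero_right add_0_right)
qed

definition circle_cosi :: "int \<Rightarrow> circle \<Rightarrow> real" where
  "circle_cosi k = circle_cos (nat \<bar>k\<bar>)"

lemma circle_cases: obtains r where "x = circle_of_real r" "0 \<le> r" "r < 1"
proof -
  obtain s where s: "x = circle_of_real s"
    using circle.abs_induct[of "\<lambda>x. \<exists>s. x = circle_of_real s" x] by blast
  have "s - frac s \<in> \<int>" by (simp add: frac_def)
  then have "x = circle_of_real (frac s)"
    unfolding s by (simp add: circle.abs_eq_iff)
  then show ?thesis using that frac_ge_0 frac_lt_1 by blast
qed

lemma circle_cosi_of_real: "circle_cosi k (circle_of_real r) = cos (2 * pi * of_int k * r)"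
proof (cases "k \<ge> 0")
  case True
  then show ?thesis by (simp add: circle_cosi_def circle_cos.abs_eq of_nat_nat)
next
  case False
  then have "real (nat \<bar>k\<bar>) = - of_int k" by simp
  then show ?thesis unfolding circle_cosi_def circle_cos.abs_eq
    by (metis cos_minus mult_minus_left mult_minus_right)
qed

lemma circle_cos_eq: "circle_cos k = circle_cosi (int k)"
  by (simp add: circle_cosi_def)

lemma circle_cosi_times: "circle_cosi k (circle_times d x) = circle_cosi (k * d) x"
  by (cases x rule: circle_cases) (simp add: circle_times.abs_eq circle_cosi_of_real mult.assoc)

lemma circle_sin_times: "circle_sin k (circle_times d x) = circle_sin (k * d) x"
  by (cases x rule: circle_cases) (simp add: circle_times.abs_eq circle_sin.abs_eq mult.assoc)

lemma cosi_mult_cosi: "circle_cosi m x * circle_cosi n x = (circle_cosi (m + n) x + circle_cosi (m - n) x) / 2"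
  by (cases x rule: circle_cases) (simp add: circle_cosi_of_real cos_times_cos algebra_simps)

lemma sin_mult_sin_circle: "circle_sin m x * circle_sin n x = (circle_cosi (m - n) x - circle_cosi (m + n) x) / 2"
  by (cases x rule: circle_cases) (simp add: circle_cosi_of_real circle_sin.abs_eq sin_times_sin algebra_simps)

lemma sin_mult_cosi: "circle_sin m x * circle_cosi n x = (circle_sin (m + n) x + circle_sin (m - n) x) / 2"
  by (cases x rule: circle_cases) (simp add: circle_cosi_of_real circle_sin.abs_eq sin_add sin_diff algebra_simps)

lemma circle_cosi_0 [simp]: "circle_cosi 0 x = 1"
  by (cases x rule: circle_cases) (simp add: circle_cosi_of_real)

lemma circle_cos_0 [simp]: "circle_cos 0 x = 1"
  by (simp add: circle_cos_eq)

lemma circle_sin_0 [simp]: "circle_sin 0 x = 0"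
  by (cases x rule: circle_cases) (simp add: circle_sin.abs_eq)

lemma abs_circle_cosi_le: "\<bar>circle_cosi k x\<bar> \<le> 1"
  by (cases x rule: circle_cases) (simp add: circle_cosi_of_real)

lemma abs_circle_cos_le: "\<bar>circle_cos k x\<bar> \<le> 1"
  by (simp add: circle_cos_eq abs_circle_cosi_le)

lemma continuous_on_circleI:
  fixes g :: "circle \<Rightarrow> 'a::topological_space"
  assumes "continuous_on UNIV (\<lambda>r. g (circle_of_real r))"
  shows "continuous_on UNIV g"
  using assms by (simp add: continuous_on_open_vimage open_circle_def vimage_def)

lemma continuous_circle_cosi: "continuous_on UNIV (circle_cosi k)"
  by (rule continuous_on_circleI) (simp add: circle_cosi_of_real; intro continuous_intros)

lemma continuous_circle_cos: "continuous_on UNIV (circle_cos k)"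
  by (simp add: circle_cos_eq continuous_circle_cosi)

lemma continuous_circle_sin: "continuous_on UNIV (circle_sin k)"
  by (rule continuous_on_circleI) (simp add: circle_sin.abs_eq; intro continuous_intros)

lemma compact_circle: "compact (UNIV :: circle set)"
proof -
  have "circle_of_real ` {0..1} = UNIV"
    using circle_cases by (auto simp: image_iff) (metis atLeastAtMost_iff less_imp_le)
  moreover have "compact (circle_of_real ` {0..1})"
    by (rule compact_continuous_image[OF continuous_on_subset[OF continuous_circle_of_real]]) auto
  ultimately show ?thesis by simp
qed

definition circle_embed :: "circle \<Rightarrow> complex" where
  "circle_embed x = Complex (circle_cosi 1 x) (circle_sin 1 x)"

text \<open>The circle sits in the complex plane. Injectivity gives the Hausdorff property, point separation for
  the Stone-Weierstrass theorem, and a distance by which open sets are approximated.\<close>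

lemma circle_embed_inj: "circle_embed x = circle_embed y \<Longrightarrow> x = y"
proof -
  assume eq: "circle_embed x = circle_embed y"
  obtain r s where x: "x = circle_of_real r" and y: "y = circle_of_real s"
    by (metis circle_cases)
  have "sin (2 * pi * r) = sin (2 * pi * s) \<and> cos (2 * pi * r) = cos (2 * pi * s)"
    using eq by (simp add: circle_embed_def x y circle_cosi_of_real circle_sin.abs_eq)
  then obtain n :: int where "2 * pi * r = 2 * pi * s + 2 * pi * of_int n"
    using sin_cos_eq_iff by metis
  then have "2 * pi * (r - s) = 2 * pi * of_int n" by (simp add: algebra_simps)
  then have "r - s = of_int n" by simp
  then show "x = y" by (simp add: x y circle.abs_eq_iff)
qed

lemma continuous_circle_embed: "continuous_on UNIV circle_embed"
proof -
  have "circle_embed = (\<lambda>x. of_real (circle_cosi 1 x) + \<i> * of_real (circle_sin 1 x))"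
    by (auto simp: circle_embed_def complex_eq_iff)
  moreover have "continuous_on UNIV (\<lambda>x. of_real (circle_cosi 1 x) + \<i> * of_real (circle_sin 1 x) :: complex)"
    by (intro continuous_intros continuous_circle_cosi continuous_circle_sin)
  ultimately show ?thesis by metis
qed

instance circle :: t2_space
proof
  fix x y :: circle assume "x \<noteq> y"
  then obtain U V where UV: "open U" "open V" "circle_embed x \<in> U" "circle_embed y \<in> V" "U \<inter> V = {}"
    using circle_embed_inj hausdorff by metis
  show "\<exists>U V. open U \<and> open V \<and> x \<in> U \<and> y \<in> V \<and> U \<inter> V = {}"
    by (rule exI[of _ "circle_embed -` U"], rule exI[of _ "circle_embed -` V"])
      (use UV continuous_circle_embed in \<open>auto intro: open_vimage\<close>)
qed

inductive trigpoly :: "(circle \<Rightarrow> real) \<Rightarrow> bool" where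
  cosine: "trigpoly (\<lambda>x. a * circle_cosi k x)"
| sine: "trigpoly (\<lambda>x. a * circle_sin k x)"
| add: "trigpoly f \<Longrightarrow> trigpoly g \<Longrightarrow> trigpoly (\<lambda>x. f x + g x)"

lemma trigpoly_const: "trigpoly (\<lambda>x. c)"
  using trigpoly.cosine[of c 0] by simp

lemma trigpoly_mult_cosine: "trigpoly g \<Longrightarrow> trigpoly (\<lambda>x. (a * circle_cosi k x) * g x)"
proof (induction rule: trigpoly.induct)
  case (cosine b l)
  have "(\<lambda>x. (a * circle_cosi k x) * (b * circle_cosi l x)) =
     (\<lambda>x. (a * b / 2) * circle_cosi (k + l) x + (a * b / 2) * circle_cosi (k - l) x)"
    using cosi_mult_cosi[of k _ l] by (auto simp: fun_eq_iff field_simps)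
  then show ?case by (metis trigpoly.intros)
next
  case (sine b l)
  have "(\<lambda>x. (a * circle_cosi k x) * (b * circle_sin l x)) =
     (\<lambda>x. (a * b / 2) * circle_sin (l + k) x + (a * b / 2) * circle_sin (l - k) x)"
    using sin_mult_cosi[of l _ k] by (auto simp: fun_eq_iff field_simps)
  then show ?case by (metis trigpoly.intros)
qed (simp add: ring_distribs trigpoly.intros)

lemma trigpoly_mult_sine: "trigpoly g \<Longrightarrow> trigpoly (\<lambda>x. (a * circle_sin k x) * g x)"
proof (induction rule: trigpoly.induct)
  case (cosine b l)
  have "(\<lambda>x. (a * circle_sin k x) * (b * circle_cosi l x)) =
     (\<lambda>x. (a * b / 2) * circle_sin (k + l) x + (a * b / 2) * circle_sin (k - l) x)"
    using sin_mult_cosi[of k _ l] by (auto simp: fun_eq_iff field_simps)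
  then show ?case by (metis trigpoly.intros)
next
  case (sine b l)
  have "(\<lambda>x. (a * circle_sin k x) * (b * circle_sin l x)) =
     (\<lambda>x. (a * b / 2) * circle_cosi (k - l) x + (- a * b / 2) * circle_cosi (k + l) x)"
    by (rule ext) (use sin_mult_sin_circle[of k _ l] in \<open>simp add: mult_ac right_diff_distrib diff_divide_distrib\<close>)
  then show ?case by (metis trigpoly.intros)
qed (simp add: ring_distribs trigpoly.intros)

lemma trigpoly_mult: "trigpoly f \<Longrightarrow> trigpoly g \<Longrightarrow> trigpoly (\<lambda>x. f x * g x)"
  by (induction rule: trigpoly.induct)
    (simp_all add: trigpoly_mult_cosine trigpoly_mult_sine ring_distribs trigpoly.add)

lemma trigpoly_continuous: "trigpoly f \<Longrightarrow> continuous_on UNIV f"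
  by (induction rule: trigpoly.induct)
    (auto intro!: continuous_intros continuous_circle_cosi continuous_circle_sin)

lemma trigpoly_dense:
  fixes f :: "circle \<Rightarrow> real"
  assumes "continuous_on UNIV f" "0 < e"
  shows "\<exists>g. trigpoly g \<and> (\<forall>x. \<bar>f x - g x\<bar> < e)"
proof -
  interpret function_ring_on "Collect trigpoly" "UNIV :: circle set"
  proof
    fix x y :: circle assume "x \<noteq> y"
    then have "circle_cosi 1 x \<noteq> circle_cosi 1 y \<or> circle_sin 1 x \<noteq> circle_sin 1 y"
      using circle_embed_inj[of x y] by (auto simp: circle_embed_def)
    then show "\<exists>f\<in>Collect trigpoly. f x \<noteq> f y"
      using trigpoly.cosine[of 1 1] trigpoly.sine[of 1 1] by auto
  qed (auto simp: compact_circle trigpoly_continuous trigpoly.add trigpoly_mult trigpoly_const)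
  show ?thesis
    using Stone_Weierstrass_basic[OF assms] by auto
qed

lemma integrable_continuous_circle:
  fixes g :: "circle \<Rightarrow> real"
  assumes "finite_measure M" "sets M = sets borel" "continuous_on UNIV g"
  shows "integrable M g"
proof -
  interpret finite_measure M by fact
  have "compact (g ` UNIV)" using compact_continuous_image[OF assms(3) compact_circle] .
  then obtain B where "\<And>x. norm (g x) \<le> B"
    by (metis bounded_iff compact_imp_bounded rangeI)
  moreover have "g \<in> borel_measurable M"
    using borel_measurable_continuous_onI[OF assms(3)] measurable_cong_sets[OF assms(2) refl] by blast
  ultimately show ?thesis by (intro integrable_const_bound[of _ B]) auto
qed

text \<open>A probability measure on the circle is determined by its Fourier coefficients: by density they
  fix the integrals of all continuous functions, and the indicator of an open set is the limit of the
  functions \<open>min 1 (n * dist (x, complement))\<close>.\<close>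

lemma circle_measure_eqI:
  assumes M: "prob_space M" "sets M = sets borel" and N: "prob_space N" "sets N = sets borel"
    and c: "\<And>k. (\<integral>x. circle_cosi k x \<partial>M) = (\<integral>x. circle_cosi k x \<partial>N)"
    and s: "\<And>k. (\<integral>x. circle_sin k x \<partial>M) = (\<integral>x. circle_sin k x \<partial>N)"
  shows "M = N"
proof -
  interpret M: prob_space M by fact
  interpret N: prob_space N by fact
  note iM = integrable_continuous_circle[OF M.finite_measure_axioms M(2)]
  note iN = integrable_continuous_circle[OF N.finite_measure_axioms N(2)]
  have poly: "(\<integral>x. g x \<partial>M) = (\<integral>x. g x \<partial>N)" if "trigpoly g" for g
    using that
    by (induction rule: trigpoly.induct) (auto simp: c s iM iN trigpoly_continuous)
  have cont: "(\<integral>x. g x \<partial>M) = (\<integral>x. g x \<partial>N)" if g: "continuous_on UNIV g" for g :: "circle \<Rightarrow> real"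
  proof (rule ccontr)
    assume ne: "(\<integral>x. g x \<partial>M) \<noteq> (\<integral>x. g x \<partial>N)"
    define e where "e = \<bar>(\<integral>x. g x \<partial>M) - (\<integral>x. g x \<partial>N)\<bar> / 3"
    have "e > 0" using ne by (simp add: e_def)
    then obtain p where p: "trigpoly p" "\<And>x. \<bar>g x - p x\<bar> < e"
      using trigpoly_dense[OF g] by blast
    have bound: "\<bar>(\<integral>x. g x \<partial>L) - (\<integral>x. p x \<partial>L)\<bar> \<le> e" if L: "prob_space L" "sets L = sets borel" for L
    proof -
      interpret L: prob_space L by fact
      note iL = integrable_continuous_circle[OF L.finite_measure_axioms L(2)]
      have ig: "integrable L g" "integrable L p"
        using iL g p trigpoly_continuous by auto
      have "\<bar>\<integral>x. g x - p x \<partial>L\<bar> \<le> (\<integral>x. \<bar>g x - p x\<bar> \<partial>L)"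
        by (rule integral_abs_bound)
      also have "\<dots> \<le> (\<integral>x. e \<partial>L)"
        by (rule integral_mono) (use ig p(2) in \<open>auto intro: less_imp_le\<close>)
      finally show ?thesis using ig by (simp add: L.prob_space)
    qed
    have "\<bar>(\<integral>x. g x \<partial>M) - (\<integral>x. g x \<partial>N)\<bar> \<le> 2 * e"
      using bound[OF M] bound[OF N] poly[OF p(1)] by linarith
    then show False using \<open>e > 0\<close> unfolding e_def by simp
  qed
  have op: "emeasure M U = emeasure N U" if U: "open U" for U
  proof (cases "U = UNIV")
    case True
    then show ?thesis using M.emeasure_space_1 N.emeasure_space_1 sets_eq_imp_space_eq[OF M(2)] sets_eq_imp_space_eq[OF N(2)]
      by simp
  next
    case False
    define K where "K = circle_embed ` (- U)"
    have "compact (- U)" using compact_Int_closed[OF compact_circle, of "- U"] U by (simp add: closed_def)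
    then have K: "closed K" "K \<noteq> {}"
      unfolding K_def using False
      by (auto intro!: compact_imp_closed compact_continuous_image continuous_on_subset[OF continuous_circle_embed])
    define h where "h = (\<lambda>n x. min 1 (real n * infdist (circle_embed x) K))"
    have hc: "continuous_on UNIV (h n)" for n
      unfolding h_def by (intro continuous_intros continuous_circle_embed)
    have h0: "h n x = 0" if "x \<notin> U" for n x
      using that by (auto simp: h_def K_def)
    have hlim: "(\<lambda>n. h n x) \<longlonglongrightarrow> indicator U x" for x
    proof (cases "x \<in> U")
      case True
      then have "circle_embed x \<notin> K" unfolding K_def using circle_embed_inj by auto
      then have pos: "infdist (circle_embed x) K > 0"
        using K infdist_pos_not_in_closed by blast
      obtain n0 where n0: "real n0 * infdist (circle_embed x) K > 1"
        using reals_Archimedean3[OF pos] by blast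
      have "h n x = 1" if "n \<ge> n0" for n
      proof -
        have "real n * infdist (circle_embed x) K \<ge> real n0 * infdist (circle_embed x) K"
          using that pos by (intro mult_right_mono) auto
        then show ?thesis using n0 by (simp add: h_def)
      qed
      then show ?thesis using True
        by (intro tendsto_eventually) (auto simp: eventually_sequentially)
    qed (simp add: h0)
    have lim: "(\<lambda>n. \<integral>x. h n x \<partial>L) \<longlonglongrightarrow> measure L U" if L: "prob_space L" "sets L = sets borel" for L
    proof -
      interpret L: prob_space L by fact
      have m: "h n \<in> borel_measurable L" for n
        using borel_measurable_continuous_onI[OF hc] measurable_cong_sets[OF L(2) refl] by blast
      have US: "U \<in> sets L" using U L(2) by simp
      have "(\<lambda>n. \<integral>x. h n x \<partial>L) \<longlonglongrightarrow> (\<integral>x. indicator U x \<partial>L)"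
        by (rule integral_dominated_convergence[where w="\<lambda>x. 1"])
          (use m US hlim in \<open>auto simp: h_def infdist_nonneg\<close>)
      then show ?thesis using US by simp
    qed
    have "measure M U = measure N U"
      using LIMSEQ_unique[OF lim[OF M]] lim[OF N] cont[OF hc] by simp
    then show ?thesis by (simp add: M.emeasure_eq_measure N.emeasure_eq_measure)
  qed
  show ?thesis
    by (rule measure_eqI_generator_eq[where E="{S. open S}" and \<Omega>=UNIV and A="\<lambda>_. UNIV"])
      (use op M(2) N(2) in \<open>auto simp: Int_stable_def borel_def\<close>)
qed

lemma prob_space_lebesgue_circle: "prob_space lebesgue_circle"
  unfolding lebesgue_circle_def
proof (rule prob_space.prob_space_distr)
  show "prob_space (restrict_space lborel {0..<1::real})"
    by (rule prob_spaceI) (simp add: emeasure_restrict_space space_restrict_space)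
  show "circle_of_real \<in> restrict_space lborel {0..<1} \<rightarrow>\<^sub>M borel"
    by (rule measurable_restrict_space1) simp
qed

lemma sets_lebesgue_circle: "sets lebesgue_circle = sets borel"
  by (simp add: lebesgue_circle_def)

lemma lebesgue_circle_integral_antiderivative:
  fixes g :: "circle \<Rightarrow> real"
  assumes g: "continuous_on UNIV g"
    and H: "\<And>r. (H has_real_derivative g (circle_of_real r)) (at r)"
  shows "(\<integral>x. g x \<partial>lebesgue_circle) = H 1 - H 0"
proof -
  have gc: "continuous_on UNIV (\<lambda>r. g (circle_of_real r))"
    using continuous_on_compose2[OF g continuous_circle_of_real] by simp
  have "(\<integral>x. g x \<partial>lebesgue_circle) = (\<integral>r. g (circle_of_real r) \<partial>restrict_space lborel {0..<1})"
    unfolding lebesgue_circle_def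
    by (rule integral_distr) (auto intro: measurable_restrict_space1 borel_measurable_continuous_onI g)
  also have "\<dots> = (\<integral>r. indicator {0..<1} r *\<^sub>R g (circle_of_real r) \<partial>lborel)"
    by (subst integral_restrict_space) (auto simp: set_lebesgue_integral_def)
  also have "\<dots> = (\<integral>r. indicator {0..1} r *\<^sub>R g (circle_of_real r) \<partial>lborel)"
  proof (rule integral_cong_AE)
    have m: "(\<lambda>r. g (circle_of_real r)) \<in> borel_measurable lborel"
      using borel_measurable_continuous_onI[OF gc] by simp
    show "(\<lambda>r. indicator {0..<1} r *\<^sub>R g (circle_of_real r)) \<in> borel_measurable lborel"
      "(\<lambda>r. indicator {0..1} r *\<^sub>R g (circle_of_real r)) \<in> borel_measurable lborel"
      using m by measurable
    show "AE r in lborel. indicator {0..<1} r *\<^sub>R g (circle_of_real r) = indicator {0..1} r *\<^sub>R g (circle_of_real r)"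
      using AE_lborel_singleton[of "1::real"] by eventually_elim (auto simp: indicator_def)
  qed
  also have "\<dots> = H 1 - H 0"
    by (rule integral_FTC_Icc)
      (use H gc in \<open>auto intro: continuous_on_subset has_vector_derivative_at_within simp: has_real_derivative_iff_has_vector_derivative\<close>)
  finally show ?thesis .
qed

lemma lebesgue_circle_cosi: "(\<integral>x. circle_cosi k x \<partial>lebesgue_circle) = of_bool (k = 0)"
proof (cases "k = 0")
  case True
  then show ?thesis using prob_space.prob_space[OF prob_space_lebesgue_circle] by simp
next
  case False
  have "(\<integral>x. circle_cosi k x \<partial>lebesgue_circle)
      = sin (2 * pi * of_int k * 1) / (2 * pi * of_int k) - sin (2 * pi * of_int k * 0) / (2 * pi * of_int k)"
    by (rule lebesgue_circle_integral_antiderivative[OF continuous_circle_cosi])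
      (use False in \<open>auto simp: circle_cosi_of_real intro!: derivative_eq_intros\<close>)
  then show ?thesis using False by simp
qed

lemma lebesgue_circle_cos: "(\<integral>x. circle_cos k x \<partial>lebesgue_circle) = of_bool (k = 0)"
  by (simp add: circle_cos_eq lebesgue_circle_cosi)

lemma lebesgue_circle_sin: "(\<integral>x. circle_sin k x \<partial>lebesgue_circle) = 0"
proof (cases "k = 0")
  case False
  have "(\<integral>x. circle_sin k x \<partial>lebesgue_circle)
      = - cos (2 * pi * of_int k * 1) / (2 * pi * of_int k) - - cos (2 * pi * of_int k * 0) / (2 * pi * of_int k)"
    by (rule lebesgue_circle_integral_antiderivative[OF continuous_circle_sin])
      (use False in \<open>auto simp: circle_sin.abs_eq intro!: derivative_eq_intros\<close>)
  then show ?thesis by simp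
qed simp

lemma integral_circle_times:
  fixes g :: "circle \<Rightarrow> real"
  assumes "sets \<mu> = sets borel" "continuous_on UNIV g"
  shows "(\<integral>x. g x \<partial>distr \<mu> borel (circle_times d)) = (\<integral>x. g (circle_times d x) \<partial>\<mu>)"
  by (rule integral_distr)
    (use assms measurable_circle_times borel_measurable_continuous_onI measurable_cong_sets[OF assms(1) refl] in blast)+

lemma lebesgue_circle_invariant:
  assumes "d \<noteq> 0" shows "lebesgue_circle \<in> invariant_measures (circle_times d)"
proof -
  have m: "circle_times d \<in> lebesgue_circle \<rightarrow>\<^sub>M borel"
    using measurable_circle_times measurable_cong_sets[OF sets_lebesgue_circle refl] by blast
  have "distr lebesgue_circle borel (circle_times d) = lebesgue_circle"
  proof (rule circle_measure_eqI)
    show "prob_space (distr lebesgue_circle borel (circle_times d))"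
      by (rule prob_space.prob_space_distr[OF prob_space_lebesgue_circle m])
  qed (use assms in \<open>auto simp: prob_space_lebesgue_circle sets_lebesgue_circle
      integral_circle_times continuous_circle_cosi continuous_circle_sin circle_cosi_times circle_sin_times
      lebesgue_circle_cosi lebesgue_circle_sin\<close>)
  then show ?thesis
    unfolding invariant_measures_def by (simp add: prob_space_lebesgue_circle sets_lebesgue_circle)
qed

lemma integral_invariant_funpow:
  fixes g :: "circle \<Rightarrow> real"
  assumes "\<mu> \<in> invariant_measures (circle_times d)" "continuous_on UNIV g"
  shows "(\<integral>x. g ((circle_times d ^^ n) x) \<partial>\<mu>) = (\<integral>x. g x \<partial>\<mu>)"
  using assms(2)
proof (induction n arbitrary: g)
  case (Suc n)
  have "continuous_on UNIV (\<lambda>x. g (circle_times d x))"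
    by (rule continuous_on_compose2[OF Suc.prems continuous_circle_times]) auto
  from Suc.IH[OF this] show ?case
    using assms(1) integral_circle_times[of \<mu> g d] Suc.prems by (auto simp: invariant_measures_def)
qed simp

lemma circle_sin_funpow: "circle_sin k ((circle_times d ^^ n) x) = circle_sin (k * d ^ n) x"
  by (induction n arbitrary: k) (simp_all add: circle_sin_times mult_ac)

lemma circle_cosi_funpow: "circle_cosi k ((circle_times d ^^ n) x) = circle_cosi (k * d ^ n) x"
  by (induction n arbitrary: k) (simp_all add: circle_cosi_times mult_ac)

text \<open>The square of an ergodic average of a sine is a cosine polynomial with small constant term;
  hence for an invariant measure the sine coefficients vanish as soon as the cosine ones do.\<close>

lemma invariant_eq_lebesgue:
  assumes d: "\<bar>d\<bar> \<ge> 2" and mu: "\<mu> \<in> invariant_measures (circle_times d)"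
    and cos0: "\<And>k. k > 0 \<Longrightarrow> (\<integral>x. circle_cos k x \<partial>\<mu>) = 0"
  shows "\<mu> = lebesgue_circle"
proof -
  have P: "prob_space \<mu>" "sets \<mu> = sets borel" using mu by (auto simp: invariant_measures_def)
  interpret prob_space \<mu> by (rule P)
  note int = integrable_continuous_circle[OF finite_measure_axioms P(2)]
  have c: "(\<integral>x. circle_cosi k x \<partial>\<mu>) = of_bool (k = 0)" for k
    using cos0[of "nat \<bar>k\<bar>"] by (cases "k = 0") (auto simp: circle_cosi_def prob_space)
  have s: "(\<integral>x. circle_sin k x \<partial>\<mu>) = 0" if k: "k \<noteq> 0" for k
  proof -
    define b where "b = (\<integral>x. circle_sin k x \<partial>\<mu>)"
    have orth: "(\<integral>x. circle_sin (k * d ^ i) x * circle_sin (k * d ^ j) x \<partial>\<mu>) = of_bool (i = j) / 2" for i j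
    proof -
      have d0: "d \<noteq> 0" using d by auto
      have ij: "\<bar>k * d ^ i\<bar> \<noteq> \<bar>k * d ^ j\<bar>" if "i \<noteq> j"
      proof -
        have "\<bar>d\<bar> ^ i \<noteq> \<bar>d\<bar> ^ j" using that d by (simp add: power_inject_exp)
        then show ?thesis using k by (simp add: abs_mult power_abs)
      qed
      have "k * d ^ i - k * d ^ j = 0 \<longleftrightarrow> i = j" "k * d ^ i + k * d ^ j = 0 \<longleftrightarrow> False"
        using ij[of] k d0 by (cases "i = j"; fastforce)+
      then show ?thesis
        by (subst sin_mult_sin_circle) (simp add: int continuous_circle_cosi c)
    qed
    have est: "b\<^sup>2 \<le> 1 / (2 * real n)" if n: "n > 0" for n
    proof -
      define A where "A = (\<lambda>x. (\<Sum>i<n. circle_sin (k * d ^ i) x) / real n)"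
      have Ac: "continuous_on UNIV A"
        unfolding A_def using n by (intro continuous_intros continuous_circle_sin) auto
      have "(\<integral>x. circle_sin (k * d ^ i) x \<partial>\<mu>) = b" for i
        using integral_invariant_funpow[OF mu continuous_circle_sin, of k i] by (simp add: b_def circle_sin_funpow)
      then have "(\<integral>x. A x \<partial>\<mu>) = b"
        unfolding A_def using n by (simp add: int continuous_circle_sin)
      moreover have "(\<integral>x. A x \<partial>\<mu>)\<^sup>2 \<le> (\<integral>x. (A x)\<^sup>2 \<partial>\<mu>)"
        using variance_positive[of A] variance_eq[of A] int[OF Ac] int[of "\<lambda>x. (A x)\<^sup>2"] Ac
        by (simp add: continuous_intros)
      moreover have "(\<integral>x. (A x)\<^sup>2 \<partial>\<mu>) = 1 / (2 * real n)"
      proof -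
        have "(\<lambda>x. (A x)\<^sup>2) = (\<lambda>x. (\<Sum>i<n. \<Sum>j<n. circle_sin (k * d ^ i) x * circle_sin (k * d ^ j) x) / (real n)\<^sup>2)"
          by (simp add: A_def power2_eq_square sum_product fun_eq_iff)
        then have "(\<integral>x. (A x)\<^sup>2 \<partial>\<mu>) = (\<Sum>i<n. \<Sum>j<n. \<integral>x. circle_sin (k * d ^ i) x * circle_sin (k * d ^ j) x \<partial>\<mu>) / (real n)\<^sup>2"
          by (simp add: int continuous_circle_sin continuous_intros)
        also have "\<dots> = 1 / (2 * real n)"
          using n by (simp add: orth sum_divide_distrib[symmetric] of_bool_def power2_eq_square)
        finally show ?thesis .
      qed
      ultimately show ?thesis by simp
    qed
    have "(\<lambda>n. 1 / (2 * real n)) \<longlonglongrightarrow> 0" by real_asymp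
    then have "b\<^sup>2 \<le> 0"
      by (rule tendsto_lowerbound) (auto simp: eventually_sequentially intro!: exI[of _ 1] est)
    then show ?thesis by (simp add: b_def)
  qed
  show ?thesis
  proof (rule circle_measure_eqI[OF P prob_space_lebesgue_circle sets_lebesgue_circle])
    fix k
    show "(\<integral>x. circle_cosi k x \<partial>\<mu>) = (\<integral>x. circle_cosi k x \<partial>lebesgue_circle)"
      by (simp add: c lebesgue_circle_cosi)
    show "(\<integral>x. circle_sin k x \<partial>\<mu>) = (\<integral>x. circle_sin k x \<partial>lebesgue_circle)"
      using s[of k] by (cases "k = 0") (auto simp: lebesgue_circle_sin)
  qed
qed

section \<open>One step of the construction, pointwise\<close>

text \<open>Nothing in this section depends on the circle: \<open>T\<close> is an arbitrary self-map.\<close>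

definition birkhoff_sum :: "('a \<Rightarrow> 'a) \<Rightarrow> ('a \<Rightarrow> real) \<Rightarrow> nat \<Rightarrow> 'a \<Rightarrow> real" where
  "birkhoff_sum T g N x = (\<Sum>n<N. g ((T ^^ n) x))"

definition spaced_average :: "('a \<Rightarrow> 'a) \<Rightarrow> nat \<Rightarrow> nat \<Rightarrow> nat \<Rightarrow> ('a \<Rightarrow> real) \<Rightarrow> 'a \<Rightarrow> real" where
  "spaced_average T s K M g x = (\<Sum>i<M. g ((T ^^ (s + K * i)) x)) / real M"

definition riesz_product :: "('a \<Rightarrow> 'a) \<Rightarrow> nat \<Rightarrow> nat \<Rightarrow> real \<Rightarrow> ('a \<Rightarrow> real) \<Rightarrow> 'a \<Rightarrow> real" where
  "riesz_product T K m l v x = (\<Prod>i<m. 1 + l / real m * v ((T ^^ (K * i)) x))"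

lemma birkhoff_sum_add: "birkhoff_sum T (\<lambda>x. f x + g x) N x = birkhoff_sum T f N x + birkhoff_sum T g N x"
  and birkhoff_sum_diff: "birkhoff_sum T (\<lambda>x. f x - g x) N x = birkhoff_sum T f N x - birkhoff_sum T g N x"
  and birkhoff_sum_cmult: "birkhoff_sum T (\<lambda>x. c * f x) N x = c * birkhoff_sum T f N x"
  and birkhoff_sum_const: "birkhoff_sum T (\<lambda>x. c) N x = real N * c"
  by (simp_all add: birkhoff_sum_def sum.distrib sum_subtractf sum_distrib_left)

lemma birkhoff_sum_mono: "(\<And>x. f x \<le> g x) \<Longrightarrow> birkhoff_sum T f N x \<le> birkhoff_sum T g N x"
  by (simp add: birkhoff_sum_def sum_mono)

text \<open>A function and its composition with \<open>T\<close> have Birkhoff sums that telescope up to two boundary terms.\<close>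

lemma birkhoff_sum_shift:
  assumes "\<And>x. \<bar>g x\<bar> \<le> B"
  shows "\<bar>birkhoff_sum T (\<lambda>x. g ((T ^^ i) x)) N x - birkhoff_sum T g N x\<bar> \<le> 2 * real i * B"
  using assms
proof (induction i arbitrary: g)
  case (Suc i)
  define h where "h = (\<lambda>x. g (T x))"
  have "birkhoff_sum T h N x - birkhoff_sum T g N x = g ((T ^^ N) x) - g x"
    unfolding birkhoff_sum_def h_def sum_subtractf[symmetric]
    using sum_lessThan_telescope[of "\<lambda>n. g ((T ^^ n) x)" N] by simp
  then have "\<bar>birkhoff_sum T h N x - birkhoff_sum T g N x\<bar> \<le> 2 * B"
    using Suc.prems[of "(T ^^ N) x"] Suc.prems[of x] by linarith
  moreover have "\<bar>birkhoff_sum T (\<lambda>x. h ((T ^^ i) x)) N x - birkhoff_sum T h N x\<bar> \<le> 2 * real i * B"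
    by (rule Suc.IH) (simp add: h_def Suc.prems)
  ultimately show ?case by (simp add: h_def algebra_simps)
qed simp

text \<open>Averaging along an orbit changes Birkhoff sums by a bounded amount only, so it is free of charge
  for the integrals against invariant measures.\<close>

lemma birkhoff_sum_spaced_average:
  assumes B: "\<And>x. \<bar>g x\<bar> \<le> B" and M: "M > 0"
  shows "\<bar>birkhoff_sum T (spaced_average T s K M g) N x - birkhoff_sum T g N x\<bar> \<le> 2 * real (s + K * M) * B"
proof -
  have B0: "B \<ge> 0" using B[of x] by linarith
  have "birkhoff_sum T (spaced_average T s K M g) N x = (\<Sum>i<M. birkhoff_sum T (\<lambda>x. g ((T ^^ (s + K * i)) x)) N x) / M"
    unfolding birkhoff_sum_def spaced_average_def sum_divide_distrib[symmetric] by (subst sum.swap) simp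
  then have "birkhoff_sum T (spaced_average T s K M g) N x - birkhoff_sum T g N x
      = (\<Sum>i<M. birkhoff_sum T (\<lambda>x. g ((T ^^ (s + K * i)) x)) N x - birkhoff_sum T g N x) / M"
    using M by (simp add: sum_subtractf diff_divide_distrib)
  also have "\<bar>\<dots>\<bar> \<le> (\<Sum>i<M. 2 * real (s + K * M) * B) / M"
  proof -
    have "\<bar>\<Sum>i<M. birkhoff_sum T (\<lambda>x. g ((T ^^ (s + K * i)) x)) N x - birkhoff_sum T g N x\<bar> \<le> (\<Sum>i<M. 2 * real (s + K * M) * B)"
    proof (rule order_trans[OF sum_abs sum_mono])
      fix i assume "i \<in> {..<M}"
      then have "2 * real (s + K * i) * B \<le> 2 * real (s + K * M) * B"
        using B0 by (intro mult_right_mono mult_left_mono of_nat_mono add_left_mono) auto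
      with birkhoff_sum_shift[where g=g and T=T and i="s + K * i" and N=N and x=x, OF B]
      show "\<bar>birkhoff_sum T (\<lambda>x. g ((T ^^ (s + K * i)) x)) N x - birkhoff_sum T g N x\<bar> \<le> 2 * real (s + K * M) * B"
        by linarith
    qed
    then show ?thesis unfolding abs_divide abs_of_nat by (rule divide_right_mono) simp
  qed
  also have "\<dots> = 2 * real (s + K * M) * B" using M by simp
  finally show ?thesis .
qed

lemma abs_spaced_average_le:
  assumes "\<And>x. \<bar>g x\<bar> \<le> B" "M > 0" shows "\<bar>spaced_average T s K M g x\<bar> \<le> B"
proof -
  have "\<bar>\<Sum>i<M. g ((T ^^ (s + K * i)) x)\<bar> \<le> (\<Sum>i<M. B)"
    using assms(1) by (intro order_trans[OF sum_abs sum_mono]) auto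
  then show ?thesis using assms(2) by (simp add: spaced_average_def field_simps)
qed

text \<open>A product of many factors close to 1 behaves like the exponential of the sum; the upper bound is
  \<open>1 + y \<le> exp y\<close>, the lower one combines \<open>ln (1 + y) \<ge> y - 2 y\<^sup>2\<close> with \<open>exp t \<ge> 1 + t\<close>.\<close>

lemma riesz_product_bounds:
  assumes v: "\<And>x. \<bar>v x\<bar> \<le> R" and m: "m > 0" and l: "l \<ge> 0" "l * R \<le> real m / 2"
  shows "riesz_product T K m l v x \<ge> 0"
    and "(\<And>x. v x \<le> k) \<Longrightarrow> riesz_product T K m l v x \<le> exp (l * k)"
    and "riesz_product T K m l v x \<ge> 1 + l * spaced_average T 0 K m v x - 2 * (l * R)\<^sup>2 / m"
proof -
  define y where "y = (\<lambda>i. l / real m * v ((T ^^ (K * i)) x))"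
  have yb: "\<bar>y i\<bar> \<le> l * R / m" for i
    using mult_left_mono[OF v[of "(T ^^ (K * i)) x"], of "l / m"] l m by (simp add: y_def abs_mult)
  have half: "l * R / m \<le> 1/2" using l m by (simp add: field_simps)
  have y: "\<bar>y i\<bar> \<le> 1/2" for i using yb[of i] half by linarith
  then have pos: "1 + y i > 0" for i using abs_le_D2[of "y i" "1/2"] by (simp add: le_less_trans less_le_trans)
  have P: "riesz_product T K m l v x = (\<Prod>i<m. 1 + y i)" by (simp add: riesz_product_def y_def)
  show "riesz_product T K m l v x \<ge> 0"
    unfolding P by (rule prod_nonneg) (use pos in \<open>auto intro: less_imp_le\<close>)
  have S: "(\<Sum>i<m. y i) = l * spaced_average T 0 K m v x"
    by (simp add: y_def spaced_average_def sum_distrib_left sum_divide_distrib)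
  show "riesz_product T K m l v x \<le> exp (l * k)" if "\<And>x. v x \<le> k"
  proof -
    have "(\<Prod>i<m. 1 + y i) \<le> (\<Prod>i<m. exp (l / m * k))"
    proof (rule prod_mono)
      fix i
      have "y i \<le> l / m * k" unfolding y_def using that l by (intro mult_left_mono) auto
      then have "1 + y i \<le> exp (l / m * k)"
        using exp_ge_add_one_self[of "y i"] by (meson exp_le_cancel_iff order_trans)
      then show "0 \<le> 1 + y i \<and> 1 + y i \<le> exp (l / m * k)" using pos[of i] by linarith
    qed
    also have "\<dots> = exp (l * k)" using m by (simp add: exp_of_nat_mult[symmetric])
    finally show ?thesis by (simp add: P)
  qed
  have "(\<Sum>i<m. y i - 2 * (y i)\<^sup>2) \<le> (\<Sum>i<m. ln (1 + y i))"
    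
  proof (rule sum_mono)
    fix i show "y i - 2 * (y i)\<^sup>2 \<le> ln (1 + y i)"
      using abs_ln_one_plus_x_minus_x_bound[OF y[of i]] by linarith
  qed
  moreover have "(\<Sum>i<m. (y i)\<^sup>2) \<le> (\<Sum>i<m. (l * R / m)\<^sup>2)"
    using yb by (intro sum_mono) (metis abs_ge_zero power2_abs power_mono)
  moreover have "(\<Sum>i<m. (l * R / m)\<^sup>2) = (l * R)\<^sup>2 / m"
    using m by (simp add: power2_eq_square)
  ultimately have "(\<Sum>i<m. y i) - 2 * ((l * R)\<^sup>2 / m) \<le> (\<Sum>i<m. ln (1 + y i))"
    by (simp add: sum_subtractf sum_distrib_left[symmetric])
  moreover have "(\<Prod>i<m. 1 + y i) = exp (\<Sum>i<m. ln (1 + y i))"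
    using pos by (simp add: exp_sum)
  ultimately have "(\<Prod>i<m. 1 + y i) \<ge> 1 + ((\<Sum>i<m. y i) - 2 * ((l * R)\<^sup>2 / m))"
    using exp_ge_add_one_self[of "\<Sum>i<m. ln (1 + y i)"] by linarith
  then show "riesz_product T K m l v x \<ge> 1 + l * spaced_average T 0 K m v x - 2 * (l * R)\<^sup>2 / m"
    by (simp add: P S)
qed

text \<open>The function \<open>\<theta>\<close> of the introduction: both signs of \<open>u\<close> are needed to control \<open>f + |u|\<close> on average, and
  the constant 2 is the mean of the two products.\<close>

definition riesz_increment :: "('a \<Rightarrow> 'a) \<Rightarrow> real \<Rightarrow> nat \<Rightarrow> nat \<Rightarrow> nat \<Rightarrow> ('a \<Rightarrow> real) \<Rightarrow> ('a \<Rightarrow> real) \<Rightarrow> 'a \<Rightarrow> real" where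
  "riesz_increment T e L K m f u x = e / 4 *
    (riesz_product T K m (4 / e) (spaced_average T 0 1 L (\<lambda>x. f x + u x)) x
     + riesz_product T K m (4 / e) (spaced_average T 0 1 L (\<lambda>x. f x - u x)) x - 2)"

text \<open>The hypothesis \<open>inv\<close> at \<open>N = L\<close> bounds the block averages by \<open>2 e\<close>, which bounds the products. In the second claim
  only the sign of \<open>u\<close> that realizes the absolute value counts; the other product is merely nonnegative.\<close>

lemma riesz_increment_bounds:
  assumes f: "\<And>x. \<bar>f x\<bar> \<le> R - 1" and u: "\<And>x. \<bar>u x\<bar> \<le> 1" and e: "0 < e" "e \<le> 1"
    and inv: "\<And>N x. birkhoff_sum T f N x + \<bar>birkhoff_sum T u N x\<bar> \<le> real N * e + C"
    and L: "L > 0" "C \<le> real L * e" and m: "32 * R\<^sup>2 / e\<^sup>2 \<le> real m" and R: "R \<ge> 1"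
  shows "\<bar>riesz_increment T e L K m f u x\<bar> \<le> e / 2 * exp 8"
    and "birkhoff_sum T (riesz_increment T e L K m f u) N x
      \<ge> birkhoff_sum T f N x + \<bar>birkhoff_sum T u N x\<bar> - real N * (e / 2) - 2 * real (L + K * m) * R"
proof -
  define h where "h = (\<lambda>b x. if b then f x + u x else f x - u x)"
  define v where "v = (\<lambda>b. spaced_average T 0 1 L (h b))"
  define P where "P = (\<lambda>b. riesz_product T K m (4 / e) (v b))"
  have "R > 0" using R by simp
  have m0: "m > 0" 
  proof -
    have "0 < 32 * R\<^sup>2 / e\<^sup>2" using e R by simp
    then show ?thesis using m by (metis less_le_trans of_nat_0_less_iff)
  qed
  have me: "32 * R\<^sup>2 \<le> real m * e\<^sup>2" using m e by (simp add: field_simps)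
  have hb: "\<bar>h b x\<bar> \<le> R" for b x using f[of x] u[of x] by (auto simp: h_def)
  have vb: "\<bar>v b x\<bar> \<le> R" for b x
    unfolding v_def using hb L by (intro abs_spaced_average_le) auto
  have hs: "birkhoff_sum T (h b) N x \<le> birkhoff_sum T f N x + \<bar>birkhoff_sum T u N x\<bar>" for b N x
    by (cases b) (auto simp: h_def birkhoff_sum_add birkhoff_sum_diff)
  have vup: "v b x \<le> 2 * e" for b x
  proof -
    have "v b x = birkhoff_sum T (h b) L x / L"
      by (simp add: v_def spaced_average_def birkhoff_sum_def)
    also have "\<dots> \<le> (real L * e + C) / L"
      using hs[of b L x] inv[of L x] by (intro divide_right_mono) auto
    also have "\<dots> \<le> (real L * e + real L * e) / L"
      using L by (intro divide_right_mono add_left_mono) auto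
    also have "\<dots> = 2 * e" using L by simp
    finally show ?thesis .
  qed
  have l: "4 / e \<ge> 0" "4 / e * R \<le> real m / 2"
  proof -
    have "8 * R * e \<le> 32 * R\<^sup>2"
    proof -
      have "8 * R * e \<le> 8 * R * 1" using e R by (intro mult_left_mono) auto
      also have "\<dots> \<le> 32 * R * R" using R mult_left_mono[of 1 R R] by linarith
      finally show ?thesis by (simp add: power2_eq_square)
    qed
    then have "8 * R * e \<le> real m * e * e" using me by (simp add: power2_eq_square)
    then have "8 * R \<le> real m * e" using e by (metis mult_le_cancel_right not_less_iff_gr_or_eq)
    then show "4 / e * R \<le> real m / 2" using e by (simp add: field_simps)
  qed (use e in simp)
  have P0: "P b x \<ge> 0" for b x unfolding P_def by (rule riesz_product_bounds(1)[where R=R]) (use vb m0 l in auto)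
  have P8: "P b x \<le> exp 8" for b x
    using riesz_product_bounds(2)[where v="v b" and k="2 * e", OF vb m0 l vup] e unfolding P_def by simp
  have inc: "riesz_increment T e L K m f u = (\<lambda>x. e / 4 * (P True x + P False x - 2))"
    by (simp add: riesz_increment_def P_def v_def h_def fun_eq_iff)
  have E8: "exp 8 \<ge> (1::real)" by simp
  have "e / 4 * (P True x + P False x - 2) \<le> e / 4 * (2 * exp 8)"
    using P8[of True x] P8[of False x] e by (intro mult_left_mono) auto
  moreover have "e / 4 * (- (2 * exp 8)) \<le> e / 4 * (P True x + P False x - 2)"
    using P0[of True x] P0[of False x] e E8 by (intro mult_left_mono) linarith+
  ultimately show "\<bar>riesz_increment T e L K m f u x\<bar> \<le> e / 2 * exp 8"
    unfolding inc by (simp add: abs_le_iff)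
  have Plow: "birkhoff_sum T (P b) N x \<ge> 4 / e * (birkhoff_sum T (h b) N x - 2 * real (L + K * m) * R)" for b
  proof -
    \<comment> \<open>\<open>m\<close> is so large that the summand 1 of the lower bound absorbs the quadratic error.\<close>
    have q: "2 * (4 / e * R)\<^sup>2 / m \<le> 1"
      using me m0 e by (simp add: field_simps power2_eq_square)
    have "P b x \<ge> 4 / e * spaced_average T 0 K m (v b) x" for x
      using riesz_product_bounds(3)[where v="v b" and T=T and K=K and x=x, OF vb m0 l] q unfolding P_def by linarith
    then have "birkhoff_sum T (P b) N x \<ge> birkhoff_sum T (\<lambda>x. 4 / e * spaced_average T 0 K m (v b) x) N x"
      by (rule birkhoff_sum_mono)
    then have "birkhoff_sum T (P b) N x \<ge> 4 / e * birkhoff_sum T (spaced_average T 0 K m (v b)) N x"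
      by (simp only: birkhoff_sum_cmult)
    moreover have "birkhoff_sum T (spaced_average T 0 K m (v b)) N x \<ge> birkhoff_sum T (v b) N x - 2 * real (K * m) * R"
      using birkhoff_sum_spaced_average[where g="v b" and T=T and s=0 and K=K and N=N and x=x, OF vb m0] by simp
    moreover have "birkhoff_sum T (v b) N x \<ge> birkhoff_sum T (h b) N x - 2 * real L * R"
      using birkhoff_sum_spaced_average[where g="h b" and T=T and s=0 and K=1 and N=N and x=x, OF hb L(1)] by (simp add: v_def)
    ultimately show ?thesis
      using mult_left_mono[of "birkhoff_sum T (h b) N x - 2 * real (L + K * m) * R" "birkhoff_sum T (spaced_average T 0 K m (v b)) N x" "4 / e"] l(1)
      by (simp add: algebra_simps)
  qed
  have Pnn: "birkhoff_sum T (P b) N x \<ge> 0" for b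
    using P0 by (simp add: birkhoff_sum_def sum_nonneg)
  \<comment> \<open>The sign for which the Birkhoff sum of \<open>h b\<close> is that of \<open>f\<close> plus the absolute value of that of \<open>u\<close>.\<close>
  define b where "b = (birkhoff_sum T u N x \<ge> 0)"
  have hb': "birkhoff_sum T (h b) N x = birkhoff_sum T f N x + \<bar>birkhoff_sum T u N x\<bar>"
    by (cases b) (simp_all add: b_def[symmetric] h_def birkhoff_sum_add birkhoff_sum_diff, simp_all add: b_def)
  have "birkhoff_sum T (riesz_increment T e L K m f u) N x
     = e / 4 * (birkhoff_sum T (P True) N x + birkhoff_sum T (P False) N x - 2 * real N)"
    unfolding inc by (simp only: birkhoff_sum_cmult birkhoff_sum_add birkhoff_sum_diff birkhoff_sum_const) (simp add: mult.commute)
  also have "\<dots> \<ge> e / 4 * (birkhoff_sum T (P b) N x - 2 * real N)"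
    using Pnn[of True] Pnn[of False] e by (intro mult_left_mono) (cases b; simp)+
  finally have "birkhoff_sum T (riesz_increment T e L K m f u) N x \<ge> e / 4 * (birkhoff_sum T (P b) N x - 2 * real N)" .
  moreover have "e / 4 * (birkhoff_sum T (P b) N x - 2 * real N)
      \<ge> e / 4 * (4 / e * (birkhoff_sum T (h b) N x - 2 * real (L + K * m) * R) - 2 * real N)"
    using Plow[of b] e by (intro mult_left_mono diff_right_mono) auto
  moreover have "e / 4 * (4 / e * (birkhoff_sum T (h b) N x - 2 * real (L + K * m) * R) - 2 * real N)
     = birkhoff_sum T (h b) N x - 2 * real (L + K * m) * R - real N * (e / 2)"
    using e by (simp add: field_simps)
  ultimately show "birkhoff_sum T (riesz_increment T e L K m f u) N x
      \<ge> birkhoff_sum T f N x + \<bar>birkhoff_sum T u N x\<bar> - real N * (e / 2) - 2 * real (L + K * m) * R"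
    using hb' by linarith
qed

text \<open>The improvement from \<open>e\<close> to \<open>e / 2\<close>. Averaging the increment with shift \<open>s\<close> and spacing \<open>K'\<close> affects only the additive constant.\<close>

lemma birkhoff_sum_improve:
  assumes f: "\<And>x. \<bar>f x\<bar> \<le> R - 1" and u: "\<And>x. \<bar>u x\<bar> \<le> 1" and e: "0 < e" "e \<le> 1"
    and inv: "\<And>N x. birkhoff_sum T f N x + \<bar>birkhoff_sum T u N x\<bar> \<le> real N * e + C"
    and L: "L > 0" "C \<le> real L * e" and m: "32 * R\<^sup>2 / e\<^sup>2 \<le> real m" and R: "R \<ge> exp 8"
    and M: "M > 0"
  shows "birkhoff_sum T (\<lambda>x. f x - spaced_average T s K' M (riesz_increment T e L K m f u) x) N x
      + \<bar>birkhoff_sum T u N x\<bar> \<le> real N * (e / 2) + 2 * real (L + K * m + s + K' * M) * R"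
proof -
  have R1: "R \<ge> 1" using R using one_le_exp_iff[of "8::real"] by linarith
  note b = riesz_increment_bounds[OF f u e inv L m R1]
  have "e / 2 * exp 8 \<le> 1 * R" using e R by (intro mult_mono) auto
  then have "\<bar>riesz_increment T e L K m f u x\<bar> \<le> R" for x using b(1)[of K x] by linarith
  from birkhoff_sum_spaced_average[where g="riesz_increment T e L K m f u" and T=T and s=s and K=K' and N=N and x=x, OF this M] b(2)[of N x K]
  show ?thesis by (simp add: birkhoff_sum_diff algebra_simps)
qed

section \<open>Cosine polynomials with rational coefficients\<close>

definition supp_le :: "(nat \<Rightarrow> rat) \<Rightarrow> nat \<Rightarrow> bool" where
  "supp_le a B \<longleftrightarrow> (\<forall>k. a k \<noteq> 0 \<longrightarrow> k \<le> B)"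

definition cos_sum :: "nat \<Rightarrow> (nat \<Rightarrow> rat) \<Rightarrow> circle \<Rightarrow> real" where
  "cos_sum n a x = (\<Sum>k\<le>n. of_rat (a k) * circle_cos k x)"

definition unit_coeff :: "nat \<Rightarrow> nat \<Rightarrow> rat" where
  "unit_coeff i k = (if k = i then 1 else 0)"

definition dilate :: "nat \<Rightarrow> (nat \<Rightarrow> rat) \<Rightarrow> nat \<Rightarrow> rat" where
  "dilate q a k = (if q dvd k then a (k div q) else 0)"

text \<open>The coefficients of a product of cosine polynomials of degrees at most \<open>B\<close> and \<open>C\<close>, by the product-to-sum formula;
  \<open>(i - j) + (j - i)\<close> is the distance of \<open>i\<close> and \<open>j\<close>, as subtraction of naturals is truncated.\<close>

definition cos_mult :: "nat \<Rightarrow> nat \<Rightarrow> (nat \<Rightarrow> rat) \<Rightarrow> (nat \<Rightarrow> rat) \<Rightarrow> nat \<Rightarrow> rat" where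
  "cos_mult B C a b k = (\<Sum>i\<le>B. \<Sum>j\<le>C. a i * b j *
     ((if i + j = k then 1 / 2 else 0) + (if (i - j) + (j - i) = k then 1 / 2 else 0)))"

lemma supp_leD: "supp_le a B \<Longrightarrow> B < k \<Longrightarrow> a k = 0"
  unfolding supp_le_def by (meson not_le)

lemma supp_le_mono: "supp_le a B \<Longrightarrow> B \<le> C \<Longrightarrow> supp_le a C"
  unfolding supp_le_def by (meson order_trans)

lemma cos_sum_extend:
  assumes "supp_le a B" "B \<le> n" shows "cos_sum n a x = cos_sum B a x"
  unfolding cos_sum_def
  by (rule sum.mono_neutral_right) (use assms in \<open>auto simp: supp_le_def\<close>)

lemma cos_sum_add: "cos_sum n (\<lambda>k. a k + b k) x = cos_sum n a x + cos_sum n b x"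
  and cos_sum_diff: "cos_sum n (\<lambda>k. a k - b k) x = cos_sum n a x - cos_sum n b x"
  and cos_sum_cmult: "cos_sum n (\<lambda>k. c * a k) x = of_rat c * cos_sum n a x"
  by (simp_all add: cos_sum_def of_rat_add of_rat_diff of_rat_mult ring_distribs sum.distrib sum_subtractf
      sum_distrib_left mult.assoc)

lemma cos_sum_sum: "cos_sum n (\<lambda>k. \<Sum>i\<in>I. a i k) x = (\<Sum>i\<in>I. cos_sum n (a i) x)"
  unfolding cos_sum_def of_rat_sum sum_distrib_right by (rule sum.swap)

lemma cos_sum_unit_coeff: "i \<le> n \<Longrightarrow> cos_sum n (unit_coeff i) x = circle_cos i x"
  by (simp add: cos_sum_def unit_coeff_def if_distrib[of of_rat] if_distrib[of "\<lambda>z. z * _"] cong: if_cong)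

lemma supp_le_dilate:
  assumes "supp_le a B" shows "supp_le (dilate q a) (B * q)"
  unfolding supp_le_def
proof (intro allI impI)
  fix k assume "dilate q a k \<noteq> 0"
  then have "q dvd k" "a (k div q) \<noteq> 0" by (auto simp: dilate_def split: if_splits)
  then show "k \<le> B * q" using assms unfolding supp_le_def
    by (metis dvd_div_mult_self mult_le_mono1)
qed

text \<open>The spectrum of a dilated series consists of multiples of \<open>q\<close>, so cutting it at \<open>n\<close> amounts to cutting the
  original series at \<open>n div q\<close>. Partial sums of averages and superpositions of dilates are computed from this.\<close>

lemma cos_sum_dilate:
  assumes q: "q > 0" and S: "\<And>k. circle_cos k y = circle_cos (k * q) x"
  shows "cos_sum n (dilate q a) x = cos_sum (n div q) a y"
proof -
  have "cos_sum n (dilate q a) x = (\<Sum>k\<in>(\<lambda>k. k * q) ` {..n div q}. of_rat (dilate q a k) * circle_cos k x)"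
    unfolding cos_sum_def
  proof (rule sum.mono_neutral_right)
    show "(\<lambda>k. k * q) ` {..n div q} \<subseteq> {..n}"
      using q by (auto simp: less_eq_div_iff_mult_less_eq)
    have "k \<in> (\<lambda>k. k * q) ` {..n div q}" if "k \<le> n" "q dvd k" for k
      using that by (intro image_eqI[of _ _ "k div q"]) (auto simp: div_le_mono)
    then show "\<forall>k\<in>{..n} - (\<lambda>k. k * q) ` {..n div q}. of_rat (dilate q a k) * circle_cos k x = 0"
      by (auto simp: dilate_def)
  qed auto
  also have "\<dots> = cos_sum (n div q) a y"
    using q by (subst sum.reindex) (auto simp: inj_on_def cos_sum_def dilate_def S)
  finally show ?thesis .
qed

lemma supp_le_cos_mult: "supp_le (cos_mult B C a b) (B + C)"
  unfolding supp_le_def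
proof (intro allI impI)
  fix k assume "cos_mult B C a b k \<noteq> 0"
  show "k \<le> B + C"
  proof (rule ccontr)
    assume "\<not> k \<le> B + C"
    then have "cos_mult B C a b k = 0"
      unfolding cos_mult_def by (intro sum.neutral ballI) auto
    then show False using \<open>cos_mult B C a b k \<noteq> 0\<close> by simp
  qed
qed

lemma circle_cos_mult: "circle_cos i x * circle_cos j x = (circle_cos (i + j) x + circle_cos ((i - j) + (j - i)) x) / 2"
proof -
  have "nat \<bar>int i - int j\<bar> = (i - j) + (j - i)" by auto
  then have "circle_cosi (int i - int j) = circle_cos ((i - j) + (j - i))"
    by (simp only: circle_cosi_def)
  moreover have "circle_cosi (int i + int j) = circle_cos (i + j)"
    by (simp only: circle_cos_eq of_nat_add)
  ultimately show ?thesis using cosi_mult_cosi[of "int i" x "int j"]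
    by (simp only: circle_cos_eq[of i, symmetric] circle_cos_eq[of j, symmetric])
qed

lemma cos_sum_mult: "cos_sum (B + C) (cos_mult B C a b) x = cos_sum B a x * cos_sum C b x"
proof -
  have "cos_sum (B + C) (cos_mult B C a b) x
     = (\<Sum>i\<le>B. \<Sum>j\<le>C. cos_sum (B + C) (\<lambda>k. a i * b j *
         ((if i + j = k then 1 / 2 else 0) + (if (i - j) + (j - i) = k then 1 / 2 else 0))) x)"
    unfolding cos_mult_def by (simp only: cos_sum_sum)
  also have "\<dots> = (\<Sum>i\<le>B. \<Sum>j\<le>C. of_rat (a i) * circle_cos i x * (of_rat (b j) * circle_cos j x))"
  proof (intro sum.cong refl)
    fix i j assume ij: "i \<in> {..B}" "j \<in> {..C}"
    have half: "(\<lambda>k. if l = k then 1 / 2 else 0) = (\<lambda>k. 1 / 2 * unit_coeff l k)" for l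
      by (auto simp: unit_coeff_def fun_eq_iff)
    have "cos_sum (B + C) (\<lambda>k. a i * b j *
         ((if i + j = k then 1 / 2 else 0) + (if (i - j) + (j - i) = k then 1 / 2 else 0))) x
      = of_rat (a i * b j) * (1/2 * circle_cos (i + j) x + 1/2 * circle_cos ((i - j) + (j - i)) x)"
      unfolding cos_sum_cmult cos_sum_add half
      using ij by (simp add: cos_sum_unit_coeff of_rat_divide)
    also have "\<dots> = of_rat (a i * b j) * (circle_cos i x * circle_cos j x)"
      by (simp add: circle_cos_mult add_divide_distrib)
    finally show "cos_sum (B + C) (\<lambda>k. a i * b j *
         ((if i + j = k then 1 / 2 else 0) + (if (i - j) + (j - i) = k then 1 / 2 else 0))) x
      = of_rat (a i) * circle_cos i x * (of_rat (b j) * circle_cos j x)"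
      by (simp add: of_rat_mult)
  qed
  also have "\<dots> = cos_sum B a x * cos_sum C b x"
    by (simp add: cos_sum_def sum_product)
  finally show ?thesis .
qed

lemma continuous_cos_sum: "continuous_on UNIV (cos_sum n a)"
  unfolding cos_sum_def by (intro continuous_intros continuous_circle_cos)

text \<open>Each coefficient is a Fourier integral, hence controlled by the supremum.\<close>

lemma coeff_le_sup:
  assumes k: "0 < k" "k \<le> n" and B: "\<And>x. \<bar>cos_sum n a x\<bar> \<le> B"
  shows "\<bar>of_rat (a k) :: real\<bar> \<le> 2 * B"
proof -
  interpret prob_space lebesgue_circle by (rule prob_space_lebesgue_circle)
  note int = integrable_continuous_circle[OF finite_measure_axioms sets_lebesgue_circle]
  have one: "(\<integral>x. circle_cos i x * circle_cos k x \<partial>lebesgue_circle) = (if i = k then 1/2 else 0)" for i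
  proof -
    have "(\<integral>x. circle_cos i x * circle_cos k x \<partial>lebesgue_circle)
      = ((\<integral>x. circle_cos (i + k) x \<partial>lebesgue_circle) + (\<integral>x. circle_cos ((i - k) + (k - i)) x \<partial>lebesgue_circle)) / 2"
      unfolding circle_cos_mult by (simp add: int continuous_circle_cos)
    moreover have "(i - k) + (k - i) = 0 \<longleftrightarrow> i = k" by auto
    ultimately show ?thesis using k by (simp only: lebesgue_circle_cos) simp
  qed
  have "(\<integral>x. cos_sum n a x * circle_cos k x \<partial>lebesgue_circle)
      = (\<integral>x. (\<Sum>i\<le>n. of_rat (a i) * (circle_cos i x * circle_cos k x)) \<partial>lebesgue_circle)"
    by (simp add: cos_sum_def sum_distrib_right mult.assoc)
  also have "\<dots> = (\<Sum>i\<le>n. of_rat (a i) * (\<integral>x. circle_cos i x * circle_cos k x \<partial>lebesgue_circle))"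
    by (subst Bochner_Integration.integral_sum)
      (auto intro!: int continuous_intros continuous_circle_cos)
  also have "\<dots> = of_rat (a k) / 2"
    using k(2) by (simp add: one if_distrib[of "\<lambda>z. _ * z"] cong: if_cong)
  finally have "of_rat (a k) / 2 = (\<integral>x. cos_sum n a x * circle_cos k x \<partial>lebesgue_circle)" by simp
  also have "\<bar>\<dots>\<bar> \<le> (\<integral>x. \<bar>cos_sum n a x * circle_cos k x\<bar> \<partial>lebesgue_circle)"
    by (rule integral_abs_bound)
  also have "\<dots> \<le> (\<integral>x. B \<partial>lebesgue_circle)"
  proof (rule integral_mono)
    fix x show "\<bar>cos_sum n a x * circle_cos k x\<bar> \<le> B"
      using mult_mono[OF B abs_circle_cos_le[of k x]] B[of x] by (simp add: abs_mult)
  qed (auto intro!: int continuous_intros continuous_circle_cos continuous_cos_sum)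
  also have "\<dots> = B" by (simp add: prob_space)
  finally show ?thesis by simp
qed

definition average_coeff :: "nat \<Rightarrow> nat \<Rightarrow> nat \<Rightarrow> nat \<Rightarrow> (nat \<Rightarrow> rat) \<Rightarrow> nat \<Rightarrow> rat" where
  "average_coeff D s K M a k = (\<Sum>i<M. dilate (D ^ (s + K * i)) a k) / of_nat M"

text \<open>The coefficients of the product over \<open>j < i\<close> of \<open>1 + c v\<close> composed with \<open>T ^^ (K * j)\<close>, multiplied out one factor at a
  time; \<open>V\<close> is a bound for the degree of \<open>v\<close>.\<close>

fun riesz_coeff :: "nat \<Rightarrow> nat \<Rightarrow> nat \<Rightarrow> rat \<Rightarrow> (nat \<Rightarrow> rat) \<Rightarrow> nat \<Rightarrow> nat \<Rightarrow> rat" where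
  "riesz_coeff D K V c v 0 = unit_coeff 0"
| "riesz_coeff D K V c v (Suc i) = cos_mult (D ^ (K * i)) (V * D ^ (K * i)) (riesz_coeff D K V c v i)
     (\<lambda>k. unit_coeff 0 k + c * dilate (D ^ (K * i)) v k)"

lemma circle_cos_funpow: "circle_cos k ((circle_times d ^^ n) x) = circle_cos (k * nat \<bar>d\<bar> ^ n) x"
  unfolding circle_cos_eq circle_cosi_funpow
  by (simp add: circle_cosi_def abs_mult power_abs nat_mult_distrib nat_power_eq)

locale expanding =
  fixes d :: int and D :: nat and T :: "circle \<Rightarrow> circle"
  assumes d: "\<bar>d\<bar> \<ge> 2" and D_def: "D = nat \<bar>d\<bar>" and T_def: "T = circle_times d"
begin

lemma D2: "D \<ge> 2" using d by (simp add: D_def)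

lemma D_power_gt: "D ^ n > n"
  using D2 less_exp[of n] power_mono[of 2 D n] by linarith

lemma cos_sum_dilate_power: "cos_sum n (dilate (D ^ i) a) x = cos_sum (n div D ^ i) a ((T ^^ i) x)"
  by (rule cos_sum_dilate) (use D2 in \<open>auto simp: T_def D_def circle_cos_funpow\<close>)

lemma cos_sum_dilate_full:
  assumes "supp_le a B" "B * D ^ i \<le> n"
  shows "cos_sum n (dilate (D ^ i) a) x = cos_sum B a ((T ^^ i) x)"
proof -
  have "B \<le> n div D ^ i" using assms(2) D2 by (simp add: less_eq_div_iff_mult_less_eq)
  then show ?thesis unfolding cos_sum_dilate_power by (rule cos_sum_extend[OF assms(1)])
qed

lemma average_coeff_nonzero:
  assumes "average_coeff D s K M a k \<noteq> 0"
  shows "\<exists>i<M. dilate (D ^ (s + K * i)) a k \<noteq> 0"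
proof -
  have "(\<Sum>i<M. dilate (D ^ (s + K * i)) a k) \<noteq> 0"
    using assms by (auto simp: average_coeff_def)
  then show ?thesis by (rule sum.not_neutral_contains_not_neutral) auto
qed

lemma supp_le_average_coeff:
  assumes "supp_le a B" shows "supp_le (average_coeff D s K M a) (B * D ^ (s + K * M))"
  unfolding supp_le_def
proof (intro allI impI)
  fix k assume "average_coeff D s K M a k \<noteq> 0"
  then obtain i where i: "i < M" "dilate (D ^ (s + K * i)) a k \<noteq> 0" using average_coeff_nonzero by blast
  then have "k \<le> B * D ^ (s + K * i)" using supp_le_dilate[OF assms] unfolding supp_le_def by blast
  also have "\<dots> \<le> B * D ^ (s + K * M)"
    using i D2 by (intro mult_left_mono power_increasing) auto
  finally show "k \<le> B * D ^ (s + K * M)" .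
qed

text \<open>Dilation moves the spectrum of a mean zero polynomial away from 0, so that later stages leave the
  low coefficients untouched.\<close>

lemma average_coeff_gap:
  assumes a0: "a 0 = 0" and k: "average_coeff D s K M a k \<noteq> 0" shows "k \<ge> D ^ s"
proof -
  obtain i where "dilate (D ^ (s + K * i)) a k \<noteq> 0" using average_coeff_nonzero[OF k] by blast
  then have "D ^ (s + K * i) dvd k" "k \<noteq> 0" using a0 by (auto simp: dilate_def split: if_splits intro!: gr0I)
  then have "D ^ (s + K * i) \<le> k" by (intro dvd_imp_le) auto
  moreover have "D ^ s \<le> D ^ (s + K * i)" using D2 by (intro power_increasing) auto
  ultimately show ?thesis by linarith
qed

lemma cos_sum_average:
  assumes "supp_le a B" "B * D ^ (s + K * M) \<le> n"
  shows "cos_sum n (average_coeff D s K M a) x = spaced_average T s K M (cos_sum B a) x"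
proof -
  have "cos_sum n (dilate (D ^ (s + K * i)) a) x = cos_sum B a ((T ^^ (s + K * i)) x)" if "i < M" for i
  proof (rule cos_sum_dilate_full[OF assms(1)])
    have "B * D ^ (s + K * i) \<le> B * D ^ (s + K * M)"
      using that D2 by (intro mult_left_mono power_increasing) auto
    then show "B * D ^ (s + K * i) \<le> n" using assms(2) by linarith
  qed
  moreover have "average_coeff D s K M a = (\<lambda>k. 1 / of_nat M * (\<Sum>i<M. dilate (D ^ (s + K * i)) a k))"
    by (simp add: average_coeff_def fun_eq_iff)
  ultimately show ?thesis
    by (simp only: cos_sum_cmult cos_sum_sum spaced_average_def) (simp add: of_rat_divide)
qed

text \<open>A partial sum cuts at most one of the dilated copies, because their spectra are disjoint
  blocks; the cut copy costs a factor \<open>W\<close>, which is absorbed by averaging over \<open>2 * W\<close> copies.\<close>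

lemma partial_sum_average_le:
  assumes supp: "supp_le a W" and a0: "a 0 = 0" and B: "\<And>x. \<bar>cos_sum W a x\<bar> \<le> B"
    and K: "W \<le> D ^ K" and W: "W > 0"
  shows "\<bar>cos_sum n (average_coeff D s K (2 * W) a) x\<bar> \<le> 2 * B"
proof -
  define q where "q = (\<lambda>i. D ^ (s + K * i))"
  define g where "g = (\<lambda>i. cos_sum (n div q i) a ((T ^^ (s + K * i)) x))"
  define Bad where "Bad = {i. 0 < n div q i \<and> n div q i < W}"
  have q0: "q i > 0" for i using D2 by (simp add: q_def)
  have B0: "B \<ge> 0" using B[of x] by linarith
  have good: "\<bar>g i\<bar> \<le> B" if "i \<notin> Bad" for i
  proof (cases "n div q i = 0")
    case True
    then show ?thesis using a0 B0 by (simp add: g_def cos_sum_def)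
  next
    case False
    then have "W \<le> n div q i" using that by (auto simp: Bad_def)
    then show ?thesis using B cos_sum_extend[OF supp] unfolding g_def by metis
  qed
  have bad: "\<bar>g i\<bar> \<le> 2 * real W * B" if "i \<in> Bad" for i
  proof -
    define y where "y = (T ^^ (s + K * i)) x"
    have "\<bar>g i\<bar> \<le> (\<Sum>k\<in>{1..n div q i}. \<bar>of_rat (a k) * circle_cos k y\<bar>)"
    proof -
      have "g i = (\<Sum>k\<in>{1..n div q i}. of_rat (a k) * circle_cos k y)"
        unfolding g_def cos_sum_def y_def
        by (rule sum.mono_neutral_right) (auto simp: a0 Suc_le_eq)
      then show ?thesis by (simp only: sum_abs)
    qed
    also have "\<dots> \<le> (\<Sum>k\<in>{1..n div q i}. 2 * B)"
    proof (rule sum_mono)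
      fix k assume k: "k \<in> {1..n div q i}"
      have "\<bar>of_rat (a k) :: real\<bar> \<le> 2 * B"
        by (rule coeff_le_sup[OF _ _ B]) (use k that in \<open>simp_all add: Bad_def\<close>)
      then have "\<bar>of_rat (a k) :: real\<bar> * \<bar>circle_cos k y\<bar> \<le> 2 * B * 1"
        using B0 abs_circle_cos_le by (intro mult_mono) auto
      then show "\<bar>of_rat (a k) * circle_cos k y\<bar> \<le> 2 * B" by (simp add: abs_mult)
    qed
    also have "\<dots> = real (n div q i) * (2 * B)" by simp
    also have "\<dots> \<le> real W * (2 * B)"
      using that B0 by (intro mult_right_mono) (simp_all add: Bad_def)
    finally show ?thesis by (simp add: mult_ac)
  qed
  \<comment> \<open>A cut block starts at or below \<open>n\<close> and ends above it; the next block starts no earlier than the end of this one.\<close>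
  have uniq: "\<not> i < j" if "i \<in> Bad" "j \<in> Bad" for i j
  proof
    assume "i < j"
    have "n < W * q i" using that(1) q0[of i] by (auto simp: Bad_def div_less_iff_less_mult)
    also have "\<dots> \<le> D ^ K * q i" using K by simp
    also have "\<dots> = D ^ (s + K * Suc i)" by (simp add: q_def power_add[symmetric] add_ac)
    also have "\<dots> \<le> q j" unfolding q_def using \<open>i < j\<close> D2
      by (intro power_increasing add_left_mono mult_left_mono) auto
    finally have "n div q j = 0" by simp
    then show False using that(2) by (simp add: Bad_def)
  qed
  have "i = j" if "i \<in> {..<2*W} \<inter> Bad" "j \<in> {..<2*W} \<inter> Bad" for i j
    using uniq[of i j] uniq[of j i] that by (meson IntD2 linorder_neqE_nat)
  then have card: "card ({..<2*W} \<inter> Bad) \<le> 1"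
    by (simp add: card_le_Suc0_iff_eq)
  have "\<bar>\<Sum>i<2*W. g i\<bar> \<le> (\<Sum>i<2*W. B + (if i \<in> Bad then 2 * real W * B else 0))"
    using good bad B0 by (intro order_trans[OF sum_abs sum_mono]) (auto simp: add_increasing)
  also have "\<dots> = real (2 * W) * B + real (card ({..<2*W} \<inter> Bad)) * (2 * real W * B)"
    by (simp add: sum.distrib sum.If_cases)
  also have "\<dots> \<le> real (2 * W) * B + 1 * (2 * real W * B)"
    using card B0 by (intro add_left_mono mult_right_mono) auto
  finally have *: "\<bar>\<Sum>i<2*W. g i\<bar> \<le> real (2 * W) * (2 * B)" by (simp add: mult.commute)
  have "average_coeff D s K (2 * W) a = (\<lambda>k. 1 / of_nat (2 * W) * (\<Sum>i<2*W. dilate (q i) a k))"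
    by (simp add: average_coeff_def q_def fun_eq_iff)
  then have "cos_sum n (average_coeff D s K (2 * W) a) x = (\<Sum>i<2*W. g i) / real (2 * W)"
    by (simp only: cos_sum_cmult cos_sum_sum cos_sum_dilate_power g_def q_def)
      (simp add: of_rat_divide of_rat_mult)
  moreover have "\<bar>\<Sum>i<2*W. g i\<bar> / real (2 * W) \<le> 2 * B"
    using * W by (simp add: divide_le_eq algebra_simps)
  ultimately show ?thesis by (simp only: abs_divide abs_of_nat)
qed

text \<open>The degrees \<open>V q^j\<close> of the factors, with \<open>q = D ^ K > V\<close>, add up like the digits of a number in base \<open>q\<close>.\<close>

lemma supp_le_riesz_coeff:
  assumes V: "V < D ^ K"
  shows "supp_le (riesz_coeff D K V c v i) (D ^ (K * i) - 1)"
proof (induction i)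
  case 0
  then show ?case by (simp add: supp_le_def unit_coeff_def)
next
  case (Suc i)
  define q where "q = D ^ (K * i)"
  have q: "q > 0" using D2 by (simp add: q_def)
  \<comment> \<open>The degree is in fact below \<open>q\<close>, and the strict bound is what propagates.\<close>
  have eq: "riesz_coeff D K V c v (Suc i) = cos_mult (q - 1) (V * q) (riesz_coeff D K V c v i)
     (\<lambda>k. unit_coeff 0 k + c * dilate q v k)"
  proof -
    have "riesz_coeff D K V c v i q = 0"
      by (rule supp_leD[OF Suc.IH]) (use q in \<open>simp add: q_def[symmetric]\<close>)
    then show ?thesis
      unfolding riesz_coeff.simps cos_mult_def q_def[symmetric] fun_eq_iff
      by (intro allI sum.mono_neutral_right) (use q in \<open>auto simp: not_le less_Suc_eq_le dest!: le_antisym\<close>)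
  qed
  have "q - 1 + V * q \<le> D ^ (K * Suc i) - 1"
  proof -
    have "(V + 1) * q \<le> D ^ K * q" using V by (intro mult_right_mono) auto
    also have "\<dots> = D ^ (K * Suc i)" by (simp add: q_def power_add)
    finally show ?thesis using q by (simp add: algebra_simps)
  qed
  then show ?case unfolding eq by (rule supp_le_mono[OF supp_le_cos_mult])
qed

lemma cos_sum_riesz_coeff:
  assumes V: "V < D ^ K" and v: "supp_le v V"
  shows "cos_sum (D ^ (K * i)) (riesz_coeff D K V c v i) x
    = (\<Prod>j<i. 1 + of_rat c * cos_sum V v ((T ^^ (K * j)) x))"
proof (induction i)
  case 0
  then show ?case by (simp add: cos_sum_unit_coeff)
next
  case (Suc i)
  define q where "q = D ^ (K * i)"
  have "q + V * q \<le> D ^ (K * Suc i)"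
  proof -
    have "(V + 1) * q \<le> D ^ K * q" using V by (intro mult_right_mono) auto
    then show ?thesis by (simp add: q_def power_add algebra_simps)
  qed
  then have "cos_sum (D ^ (K * Suc i)) (riesz_coeff D K V c v (Suc i)) x
     = cos_sum q (riesz_coeff D K V c v i) x * cos_sum (V * q) (\<lambda>k. unit_coeff 0 k + c * dilate q v k) x"
    unfolding riesz_coeff.simps q_def[symmetric]
    by (subst cos_sum_extend[OF supp_le_cos_mult]) (auto simp: cos_sum_mult)
  then show ?case
    by (simp add: Suc.IH cos_sum_add cos_sum_cmult cos_sum_unit_coeff cos_sum_dilate_full[OF v] q_def)
qed

text \<open>The factors are dissociated: the spectrum of each new factor lies, except for its constant
  term 1, beyond the spectrum of the preceding product. So the product has mean exactly 1.\<close>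

lemma riesz_coeff_0:
  assumes V: "V < D ^ K" and v: "supp_le v V" and v0: "v 0 = 0"
  shows "riesz_coeff D K V c v i 0 = 1"
proof (induction i)
  case 0
  then show ?case by (simp add: unit_coeff_def)
next
  case (Suc i)
  define q where "q = D ^ (K * i)"
  have q: "q > 0" using D2 by (simp add: q_def)
  define a where "a = riesz_coeff D K V c v i"
  define b where "b = (\<lambda>k. unit_coeff 0 k + c * dilate q v k)"
  have a: "a 0 = 1" using Suc.IH by (simp add: a_def)
  have ab: "a j * b j = (if j = 0 then 1 else 0)" for j
  proof (cases "j = 0")
    case True
    then show ?thesis using a v0 by (simp add: b_def unit_coeff_def dilate_def)
  next
    case False
    have "a j = 0 \<or> b j = 0"
    proof (rule disjCI)
      assume "b j \<noteq> 0"
      then have "q dvd j" using False by (auto simp: b_def unit_coeff_def dilate_def split: if_splits)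
      then have "q \<le> j" using False by (simp add: dvd_imp_le)
      then have "D ^ (K * i) - 1 < j" using q unfolding q_def by linarith
      then show "a j = 0" unfolding a_def by (rule supp_leD[OF supp_le_riesz_coeff[OF V]])
    qed
    then show ?thesis using False by auto
  qed
  have "riesz_coeff D K V c v (Suc i) 0 = (\<Sum>i\<le>q. \<Sum>j\<le>V*q. if i = 0 \<and> j = 0 then 1 else 0)"
    unfolding riesz_coeff.simps cos_mult_def q_def[symmetric] a_def[symmetric] b_def[symmetric]
  proof (intro sum.cong refl)
    fix i j
    show "a i * b j * ((if i + j = 0 then 1 / 2 else 0) + (if i - j + (j - i) = 0 then 1 / 2 else 0))
       = (if i = 0 \<and> j = 0 then 1 else 0)"
    proof (cases "i = j")
      case True
      then show ?thesis using ab[of j] by (cases "j = 0") auto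
    qed auto
  qed
  also have "\<dots> = (\<Sum>i\<le>q. if i = 0 then \<Sum>j\<le>V*q. if j = 0 then 1 else 0 else 0)"
    by (intro sum.cong refl) auto
  also have "\<dots> = 1" by simp
  finally show ?case .
qed

end

section \<open>The stages\<close>

text \<open>The parameters of stage \<open>j\<close>, for \<open>f\<close> of degree at most \<open>G\<close>. They realize \<open>e = 1 / 2 ^ j\<close> and \<open>R = 2 ^ 13\<close>, a number above
  \<open>exp 8 + 1\<close>, in \<open>birkhoff_sum_improve\<close>: the additive constant of stage \<open>j\<close> is \<open>2 * R * G\<close>, so that blocks of length
  \<open>2 * R * G / e\<close> are long enough, and the number of factors is \<open>32 * R\<^sup>2 / e\<^sup>2\<close>. The degree of a block average is taken as the
  spacing exponent of the Riesz product, which makes the factors dissociated because \<open>V < D ^ V\<close>.\<close>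

definition block_length :: "nat \<Rightarrow> nat \<Rightarrow> nat" where
  "block_length j G = 2 ^ (14 + j) * G"

definition block_degree :: "nat \<Rightarrow> nat \<Rightarrow> nat \<Rightarrow> nat" where
  "block_degree D j G = G * D ^ block_length j G"

definition factor_count :: "nat \<Rightarrow> nat" where
  "factor_count j = 2 ^ (31 + 2 * j)"

definition product_degree :: "nat \<Rightarrow> nat \<Rightarrow> nat \<Rightarrow> nat" where
  "product_degree D j G = D ^ (block_degree D j G * factor_count j)"

fun stage_degree :: "nat \<Rightarrow> nat \<Rightarrow> nat" where
  "stage_degree D 0 = 1"
| "stage_degree D (Suc j) = product_degree D j (stage_degree D j) *
     D ^ (stage_degree D j + product_degree D j (stage_degree D j) * (2 * product_degree D j (stage_degree D j)))"

definition block_coeff :: "nat \<Rightarrow> nat \<Rightarrow> nat \<Rightarrow> (nat \<Rightarrow> rat) \<Rightarrow> rat \<Rightarrow> nat \<Rightarrow> rat" where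
  "block_coeff D j G a \<sigma> = average_coeff D 0 1 (block_length j G) (\<lambda>k. a k + \<sigma> * unit_coeff 1 k)"

text \<open>The constant \<open>1 / 2 ^ (29 + j)\<close> is \<open>4 / e\<close> divided by the number of factors.\<close>

definition product_coeff :: "nat \<Rightarrow> nat \<Rightarrow> nat \<Rightarrow> (nat \<Rightarrow> rat) \<Rightarrow> rat \<Rightarrow> nat \<Rightarrow> rat" where
  "product_coeff D j G a \<sigma> = riesz_coeff D (block_degree D j G) (block_degree D j G) (1 / of_nat (2 ^ (29 + j)))
     (block_coeff D j G a \<sigma>) (factor_count j)"

definition increment_coeff :: "nat \<Rightarrow> nat \<Rightarrow> nat \<Rightarrow> (nat \<Rightarrow> rat) \<Rightarrow> nat \<Rightarrow> rat" where
  "increment_coeff D j G a k = (product_coeff D j G a 1 k + product_coeff D j G a (-1) k - 2 * unit_coeff 0 k) / of_nat (2 ^ (j + 2))"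

text \<open>The increment is averaged over \<open>2 * W\<close> dilates, where \<open>W\<close> is its degree. The shift by the degree reached so far puts
  the new frequencies beyond the old ones, and the spacing \<open>W\<close> makes the spectra of the dilates disjoint.\<close>

fun stage_coeff :: "nat \<Rightarrow> nat \<Rightarrow> nat \<Rightarrow> rat" where
  "stage_coeff D 0 = (\<lambda>k. 0)"
| "stage_coeff D (Suc j) = (\<lambda>k. stage_coeff D j k -
     average_coeff D (stage_degree D j) (product_degree D j (stage_degree D j)) (2 * product_degree D j (stage_degree D j))
       (increment_coeff D j (stage_degree D j) (stage_coeff D j)) k)"

context expanding begin

lemma block_coeff_eval:
  assumes a: "supp_le a G" and G: "G \<ge> 1"
  shows "supp_le (block_coeff D j G a \<sigma>) (block_degree D j G)"
    and "cos_sum (block_degree D j G) (block_coeff D j G a \<sigma>) x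
      = spaced_average T 0 1 (block_length j G) (\<lambda>x. cos_sum G a x + of_rat \<sigma> * circle_cos 1 x) x"
    and "a 0 = 0 \<Longrightarrow> block_coeff D j G a \<sigma> 0 = 0"
proof -
  define b where "b = (\<lambda>k. a k + \<sigma> * unit_coeff 1 k)"
  have b: "supp_le b G" using a G by (auto simp: b_def supp_le_def unit_coeff_def split: if_splits)
  have eq: "block_coeff D j G a \<sigma> = average_coeff D 0 1 (block_length j G) b"
    by (simp add: block_coeff_def b_def)
  show "supp_le (block_coeff D j G a \<sigma>) (block_degree D j G)"
    using supp_le_average_coeff[OF b, of 0 1 "block_length j G"] by (simp add: eq block_degree_def)
  have "cos_sum G b = (\<lambda>x. cos_sum G a x + of_rat \<sigma> * circle_cos 1 x)"
    using G by (simp add: b_def cos_sum_add cos_sum_cmult cos_sum_unit_coeff fun_eq_iff)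
  then show "cos_sum (block_degree D j G) (block_coeff D j G a \<sigma>) x
      = spaced_average T 0 1 (block_length j G) (\<lambda>x. cos_sum G a x + of_rat \<sigma> * circle_cos 1 x) x"
    using cos_sum_average[OF b, of 0 1 "block_length j G" "block_degree D j G" x] by (simp add: eq block_degree_def)
  show "block_coeff D j G a \<sigma> 0 = 0" if "a 0 = 0"
    using that by (simp add: eq average_coeff_def dilate_def b_def unit_coeff_def)
qed

lemma product_coeff_eval:
  assumes a: "supp_le a G" and G: "G \<ge> 1"
  shows "supp_le (product_coeff D j G a \<sigma>) (product_degree D j G)"
    and "cos_sum (product_degree D j G) (product_coeff D j G a \<sigma>) x
      = riesz_product T (block_degree D j G) (factor_count j) (4 / (1 / 2 ^ j))
         (spaced_average T 0 1 (block_length j G) (\<lambda>x. cos_sum G a x + of_rat \<sigma> * circle_cos 1 x)) x"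
    and "a 0 = 0 \<Longrightarrow> product_coeff D j G a \<sigma> 0 = 1"
proof -
  have V: "block_degree D j G < D ^ block_degree D j G" by (rule D_power_gt)
  show "supp_le (product_coeff D j G a \<sigma>) (product_degree D j G)"
    unfolding product_coeff_def product_degree_def
    by (rule supp_le_mono[OF supp_le_riesz_coeff[OF V]]) simp
  have l: "of_rat (1 / of_nat (2 ^ (29 + j))) = 4 / (1 / 2 ^ j) / real (factor_count j)"
  proof -
    have cancel: "1 / (2 ^ 29 * y) = 4 / (1 / y) / (2 ^ 31 * (y * y))" if "y \<noteq> 0" for y :: real
      using that by (simp add: field_simps)
    have "of_rat (1 / of_nat (2 ^ (29 + j))) = (1 / (2 ^ 29 * 2 ^ j) :: real)"
      by (simp add: of_rat_divide of_rat_mult of_rat_power power_add)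
    also have "\<dots> = 4 / (1 / 2 ^ j) / (2 ^ 31 * (2 ^ j * 2 ^ j))" by (rule cancel) simp
    also have "2 ^ 31 * (2 ^ j * 2 ^ j) = real (factor_count j)"
      by (simp add: factor_count_def power_add power_even_eq power2_eq_square)
    finally show ?thesis .
  qed
  show "cos_sum (product_degree D j G) (product_coeff D j G a \<sigma>) x
      = riesz_product T (block_degree D j G) (factor_count j) (4 / (1 / 2 ^ j))
         (spaced_average T 0 1 (block_length j G) (\<lambda>x. cos_sum G a x + of_rat \<sigma> * circle_cos 1 x)) x"
    unfolding product_coeff_def product_degree_def riesz_product_def
      cos_sum_riesz_coeff[OF V block_coeff_eval(1)[OF a G]] block_coeff_eval(2)[OF a G] l ..
  show "product_coeff D j G a \<sigma> 0 = 1" if "a 0 = 0"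
    unfolding product_coeff_def by (rule riesz_coeff_0[OF V block_coeff_eval(1)[OF a G] block_coeff_eval(3)[OF a G that]])
qed

lemma increment_coeff_eval:
  assumes a: "supp_le a G" and G: "G \<ge> 1"
  shows "supp_le (increment_coeff D j G a) (product_degree D j G)"
    and "cos_sum (product_degree D j G) (increment_coeff D j G a) x
      = riesz_increment T (1 / 2 ^ j) (block_length j G) (block_degree D j G) (factor_count j) (cos_sum G a) (circle_cos 1) x"
    and "a 0 = 0 \<Longrightarrow> increment_coeff D j G a 0 = 0"
proof -
  note p = product_coeff_eval[OF a G]
  show "supp_le (increment_coeff D j G a) (product_degree D j G)"
    unfolding supp_le_def
  proof (intro allI impI)
    fix k assume nz: "increment_coeff D j G a k \<noteq> 0"
    show "k \<le> product_degree D j G"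
    proof (rule ccontr)
      assume "\<not> k \<le> product_degree D j G"
      then show False using nz supp_leD[OF p(1), of j k] by (simp add: increment_coeff_def unit_coeff_def)
    qed
  qed
  have eq: "increment_coeff D j G a = (\<lambda>k. 1 / of_nat (2 ^ (j + 2)) *
     ((product_coeff D j G a 1 k + product_coeff D j G a (-1) k) - 2 * unit_coeff 0 k))"
    by (simp add: increment_coeff_def fun_eq_iff)
  have c: "of_rat (1 / of_nat (2 ^ (j + 2))) = (1 / 2 ^ j / 4 :: real)"
    by (simp add: of_rat_divide of_rat_mult of_rat_power power_add)
  show "cos_sum (product_degree D j G) (increment_coeff D j G a) x
      = riesz_increment T (1 / 2 ^ j) (block_length j G) (block_degree D j G) (factor_count j) (cos_sum G a) (circle_cos 1) x"
    unfolding eq cos_sum_cmult cos_sum_add cos_sum_diff p(2) c riesz_increment_def cos_sum_unit_coeff[OF le0]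
    by (simp add: of_rat_minus)
  show "increment_coeff D j G a 0 = 0" if "a 0 = 0"
    using p(3)[OF that] by (simp add: increment_coeff_def unit_coeff_def)
qed

abbreviation "Gd \<equiv> stage_degree D"
abbreviation "Ac \<equiv> stage_coeff D"
abbreviation "Wd j \<equiv> product_degree D j (Gd j)"
abbreviation "incr j \<equiv> increment_coeff D j (Gd j) (Ac j)"

definition stage :: "nat \<Rightarrow> circle \<Rightarrow> real" where "stage j = cos_sum (Gd j) (Ac j)"

lemma stage_degree_ge: "Gd j \<ge> Suc j"
proof (induction j)
  case (Suc j)
  have "Gd j + Wd j * (2 * Wd j) < D ^ (Gd j + Wd j * (2 * Wd j))" by (rule D_power_gt)
  also have "\<dots> \<le> Gd (Suc j)" using D2 by (simp add: product_degree_def)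
  finally show ?case using Suc.IH by linarith
qed simp

lemma stage_degree_gt: "Gd j < Gd (Suc j)"
proof -
  have "Gd j + Wd j * (2 * Wd j) < D ^ (Gd j + Wd j * (2 * Wd j))" by (rule D_power_gt)
  also have "\<dots> \<le> Gd (Suc j)" using D2 by (simp add: product_degree_def)
  finally show ?thesis by linarith
qed

lemma stage_degree_mono: "i \<le> j \<Longrightarrow> Gd i \<le> Gd j"
  using stage_degree_gt by (meson lift_Suc_mono_le less_imp_le)

lemma supp_le_stage: "supp_le (Ac j) (Gd j)" and stage_coeff_0: "Ac j 0 = 0"
proof -
  have "supp_le (Ac j) (Gd j) \<and> Ac j 0 = 0"
  proof (induction j)
    case 0
    then show ?case by (simp add: supp_le_def)
  next
    case (Suc j)
    have G: "Gd j \<ge> 1" using stage_degree_ge[of j] by simp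
    note i = increment_coeff_eval[where j=j, OF Suc.IH[THEN conjunct1] G]
    have s: "supp_le (average_coeff D (Gd j) (Wd j) (2 * Wd j) (incr j)) (Gd (Suc j))"
      using supp_le_average_coeff[OF i(1)] by simp
    have "supp_le (Ac (Suc j)) (Gd (Suc j))"
      unfolding supp_le_def
    proof (intro allI impI)
      fix k assume nz: "Ac (Suc j) k \<noteq> 0"
      show "k \<le> Gd (Suc j)"
      proof (rule ccontr)
        assume "\<not> k \<le> Gd (Suc j)"
        then have "k > Gd (Suc j)" "k > Gd j" using stage_degree_gt[of j] by linarith+
        then show False using nz supp_leD[OF s] supp_leD[OF Suc.IH[THEN conjunct1]]
          by (simp del: stage_degree.simps)
      qed
    qed
    moreover have "Ac (Suc j) 0 = 0"
    proof -
      have "average_coeff D (Gd j) (Wd j) (2 * Wd j) (incr j) 0 = 0"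
        using i(3) Suc.IH by (simp add: average_coeff_def dilate_def)
      then show ?thesis using Suc.IH by simp
    qed
    ultimately show ?case by blast
  qed
  then show "supp_le (Ac j) (Gd j)" "Ac j 0 = 0" by blast+
qed

lemma stage_ge1: "Gd j \<ge> 1"
  using stage_degree_ge[of j] by simp

lemmas incr_eval = increment_coeff_eval[OF supp_le_stage stage_ge1]

lemma product_degree_pos: "Wd j > 0" using D2 by (simp add: product_degree_def)

lemma stage_Suc: "stage (Suc j) x = stage j x - spaced_average T (Gd j) (Wd j) (2 * Wd j)
   (riesz_increment T (1 / 2 ^ j) (block_length j (Gd j)) (block_degree D j (Gd j)) (factor_count j) (stage j) (circle_cos 1)) x"
proof -
  have "cos_sum (Wd j) (incr j) = riesz_increment T (1 / 2 ^ j) (block_length j (Gd j)) (block_degree D j (Gd j)) (factor_count j) (stage j) (circle_cos 1)"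
    using incr_eval(2) by (simp add: stage_def fun_eq_iff)
  moreover have "cos_sum (Gd (Suc j)) (average_coeff D (Gd j) (Wd j) (2 * Wd j) (incr j)) x
     = spaced_average T (Gd j) (Wd j) (2 * Wd j) (cos_sum (Wd j) (incr j)) x"
    by (rule cos_sum_average[OF incr_eval(1)]) simp
  moreover have "cos_sum (Gd (Suc j)) (Ac j) x = stage j x"
    unfolding stage_def by (rule cos_sum_extend[OF supp_le_stage]) (use stage_degree_gt[of j] in linarith)
  ultimately show ?thesis
    by (simp only: stage_def stage_coeff.simps(2) cos_sum_diff)
qed

lemma exp8: "exp 8 \<le> (8191::real)"
proof -
  have "exp 8 = (exp 1 ^ 8 :: real)" by (simp add: exp_of_nat_mult[symmetric])
  also have "\<dots> \<le> 3 ^ 8" by (intro power_mono exp_le) auto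
  finally show ?thesis by simp
qed

text \<open>The degree grows so fast that it also dominates the additive constant produced by \<open>birkhoff_sum_improve\<close>; it can therefore
  serve as the only parameter carried from stage to stage.\<close>

lemma parameter_sum: "block_length j (Gd j) + block_degree D j (Gd j) * factor_count j + Gd j + Wd j * (2 * Wd j) \<le> Gd (Suc j)"
proof -
  define L V m W X where "L = block_length j (Gd j)" "V = block_degree D j (Gd j)" "m = factor_count j"
    "W = Wd j" "X = Gd j + W * (2 * W)"
  note defs = this
  have "L < V"
  proof -
    have "L < D ^ L" by (rule D_power_gt)
    also have "\<dots> \<le> Gd j * D ^ L" using stage_ge1[of j] by simp
    finally show ?thesis by (simp add: defs block_degree_def)
  qed
  moreover have m1: "m \<ge> 1" by (simp add: defs factor_count_def)
  ultimately have "L < V * m" by (metis less_le_trans mult.right_neutral mult_le_mono2)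
  have "2 ^ n \<ge> 2 * n" if "n \<ge> 1" for n :: nat
    using that by (induction rule: dec_induct) auto
  moreover have "V * m \<ge> 1" using \<open>L < V * m\<close> by linarith
  ultimately have "2 * (V * m) \<le> 2 ^ (V * m)" by blast
  also have "\<dots> \<le> W" unfolding defs product_degree_def using D2 by (intro power_mono) auto
  finally have "L + V * m \<le> W" using \<open>L < V * m\<close> by linarith
  have "X + W \<le> W * (X + 1)" using product_degree_pos[of j] by (cases W) (auto simp: defs)
  also have "\<dots> \<le> W * D ^ X" using D_power_gt[of X] by (intro mult_left_mono) auto
  also have "\<dots> = Gd (Suc j)" by (simp add: defs)
  finally show ?thesis using \<open>L + V * m \<le> W\<close> unfolding defs by linarith
qed

abbreviation "theta j \<equiv> riesz_increment T (1 / 2 ^ j) (block_length j (Gd j)) (block_degree D j (Gd j)) (factor_count j) (stage j) (circle_cos 1)"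

text \<open>The three bounds are proved together: the first two at stage \<open>j\<close> give the third, and all of them give the first two
  at the next stage. The factor \<open>1 - 1 / 2 ^ j\<close> sums the increments.\<close>

lemma stage_invariant:
  "\<bar>stage j x\<bar> \<le> exp 8 * (1 - 1 / 2 ^ j)"
  "birkhoff_sum T (stage j) N x + \<bar>birkhoff_sum T (circle_cos 1) N x\<bar> \<le> real N * (1 / 2 ^ j) + 2 ^ 14 * real (Gd j)"
  "\<bar>theta j x\<bar> \<le> exp 8 / 2 ^ (Suc j)"
proof -
  have theta: "(\<forall>x. \<bar>theta j x\<bar> \<le> exp 8 / 2 ^ (Suc j)) \<and>
     (\<forall>N x. birkhoff_sum T (stage (Suc j)) N x + \<bar>birkhoff_sum T (circle_cos 1) N x\<bar> \<le> real N * (1 / 2 ^ Suc j) + 2 ^ 14 * real (Gd (Suc j)))"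
    if IH: "\<And>x. \<bar>stage j x\<bar> \<le> exp 8 * (1 - 1 / 2 ^ j)"
     "\<And>N x. birkhoff_sum T (stage j) N x + \<bar>birkhoff_sum T (circle_cos 1) N x\<bar> \<le> real N * (1 / 2 ^ j) + 2 ^ 14 * real (Gd j)" for j
  proof -
    have f: "\<bar>stage j x\<bar> \<le> 8192 - 1" for x
    proof -
      have "exp 8 * (1 - 1 / 2 ^ j) \<le> exp (8::real) * 1" by (intro mult_left_mono) auto
      then show ?thesis using IH(1)[of x] exp8 by linarith
    qed
    have e: "0 < (1 / 2 ^ j :: real)" "1 / 2 ^ j \<le> (1::real)" by auto
    have L: "block_length j (Gd j) > 0" "2 ^ 14 * real (Gd j) \<le> real (block_length j (Gd j)) * (1 / 2 ^ j)"
      using stage_ge1[of j] by (auto simp: block_length_def power_add)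
    have m: "32 * 8192\<^sup>2 / (1 / 2 ^ j)\<^sup>2 \<le> real (factor_count j)"
      by (simp add: factor_count_def power_add power_even_eq power_divide)
    have "\<bar>theta j x\<bar> \<le> (1 / 2 ^ j) / 2 * exp 8" for x
      by (rule riesz_increment_bounds(1)[OF f _ e IH(2) L m]) (auto intro: abs_circle_cos_le)
    then have "\<bar>theta j x\<bar> \<le> exp 8 / 2 ^ Suc j" for x by (simp add: mult.commute)
    moreover have "birkhoff_sum T (stage (Suc j)) N x + \<bar>birkhoff_sum T (circle_cos 1) N x\<bar> \<le> real N * (1 / 2 ^ Suc j) + 2 ^ 14 * real (Gd (Suc j))" for N x
    proof -
      have "birkhoff_sum T (stage (Suc j)) N x + \<bar>birkhoff_sum T (circle_cos 1) N x\<bar>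
        \<le> real N * ((1 / 2 ^ j) / 2) + 2 * real (block_length j (Gd j) + block_degree D j (Gd j) * factor_count j + Gd j + Wd j * (2 * Wd j)) * 8192"
        unfolding stage_Suc
        by (rule birkhoff_sum_improve[OF f _ e IH(2) L m])
          (use exp8 product_degree_pos[of j] in \<open>auto intro: abs_circle_cos_le\<close>)
      moreover have "real (block_length j (Gd j) + block_degree D j (Gd j) * factor_count j + Gd j + Wd j * (2 * Wd j)) \<le> real (Gd (Suc j))"
        by (rule of_nat_mono[OF parameter_sum])
      ultimately show ?thesis by (simp del: stage_degree.simps)
    qed
    ultimately show ?thesis by blast
  qed
  have main: "(\<forall>x. \<bar>stage j x\<bar> \<le> exp 8 * (1 - 1 / 2 ^ j)) \<and>
     (\<forall>N x. birkhoff_sum T (stage j) N x + \<bar>birkhoff_sum T (circle_cos 1) N x\<bar> \<le> real N * (1 / 2 ^ j) + 2 ^ 14 * real (Gd j))" for j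
  proof (induction j)
    case 0
    have "\<bar>birkhoff_sum T (circle_cos 1) N x\<bar> \<le> real N + 16384" for N x
    proof -
      have "\<bar>birkhoff_sum T (circle_cos 1) N x\<bar> \<le> (\<Sum>n<N. 1)"
        unfolding birkhoff_sum_def by (intro order_trans[OF sum_abs sum_mono] abs_circle_cos_le)
      then show ?thesis by simp
    qed
    moreover have "stage 0 = (\<lambda>x. 0)" by (simp add: stage_def cos_sum_def fun_eq_iff)
    ultimately show ?case by (simp add: birkhoff_sum_def)
  next
    case (Suc j)
    note th = theta[of j, OF Suc.IH[THEN conjunct1, rule_format] Suc.IH[THEN conjunct2, rule_format]]
    have "\<bar>stage (Suc j) x\<bar> \<le> exp 8 * (1 - 1 / 2 ^ Suc j)" for x
    proof -
      have "\<bar>spaced_average T (Gd j) (Wd j) (2 * Wd j) (theta j) x\<bar> \<le> exp 8 / 2 ^ Suc j"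
        by (rule abs_spaced_average_le) (use th product_degree_pos[of j] in auto)
      then have "\<bar>stage (Suc j) x\<bar> \<le> exp 8 * (1 - 1 / 2 ^ j) + exp 8 / 2 ^ Suc j"
        using Suc.IH[THEN conjunct1, rule_format, of x] unfolding stage_Suc by linarith
      moreover have "exp 8 / 2 ^ j = 2 * (exp 8 / 2 ^ Suc j :: real)" by simp
      ultimately show ?thesis
        by (simp only: right_diff_distrib times_divide_eq_right mult_1_right)
    qed
    then show ?case using th by blast
  qed
  show "\<bar>stage j x\<bar> \<le> exp 8 * (1 - 1 / 2 ^ j)"
    "birkhoff_sum T (stage j) N x + \<bar>birkhoff_sum T (circle_cos 1) N x\<bar> \<le> real N * (1 / 2 ^ j) + 2 ^ 14 * real (Gd j)"
    "\<bar>theta j x\<bar> \<le> exp 8 / 2 ^ (Suc j)"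
    using main[of j] theta[of j] by blast+
qed

end

section \<open>The limit function\<close>

text \<open>The \<open>k\<close>-th coefficient is final from stage \<open>k\<close> on, because the degree of that stage exceeds \<open>k\<close>.\<close>

definition base_coeff :: "nat \<Rightarrow> nat \<Rightarrow> rat" where "base_coeff D k = stage_coeff D k k"

context expanding begin

lemma stage_coeff_Suc_eq: "k \<le> Gd j \<Longrightarrow> Ac (Suc j) k = Ac j k"
proof -
  assume k: "k \<le> Gd j"
  have "average_coeff D (Gd j) (Wd j) (2 * Wd j) (incr j) k = 0"
  proof (rule ccontr)
    assume "average_coeff D (Gd j) (Wd j) (2 * Wd j) (incr j) k \<noteq> 0"
    from average_coeff_gap[OF incr_eval(3)[OF stage_coeff_0] this]
    show False using k D_power_gt[of "Gd j"] by linarith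
  qed
  then show ?thesis by simp
qed

lemma stage_coeff_stable: "k \<le> Gd i \<Longrightarrow> i \<le> j \<Longrightarrow> Ac j k = Ac i k"
proof (induction j)
  case (Suc j)
  show ?case
  proof (cases "i = Suc j")
    case False
    then have "i \<le> j" using Suc.prems by simp
    then have "k \<le> Gd j" using Suc.prems(1) stage_degree_mono order_trans by blast
    then show ?thesis using Suc.IH[OF Suc.prems(1) \<open>i \<le> j\<close>] by (simp only: stage_coeff_Suc_eq)
  qed simp
qed simp

lemma base_coeff_eq: "k \<le> Gd j \<Longrightarrow> base_coeff D k = Ac j k"
  unfolding base_coeff_def using stage_coeff_stable[of k j k] stage_coeff_stable[of k k j] stage_degree_ge[of k]
  by (metis Suc_leD le_cases)

lemma base_coeff_0: "base_coeff D 0 = 0"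
  by (simp add: base_coeff_def)

lemma partial_sum_stage:
  assumes "Gd j \<le> n" "n \<le> Gd (Suc j)"
  shows "\<bar>cos_sum n (base_coeff D) x - stage j x\<bar> \<le> exp 8 / 2 ^ j"
proof -
  define phi where "phi = average_coeff D (Gd j) (Wd j) (2 * Wd j) (incr j)"
  have "cos_sum n (base_coeff D) x = cos_sum n (Ac (Suc j)) x"
    unfolding cos_sum_def using assms base_coeff_eq[of _ "Suc j"] by (intro sum.cong) (auto simp del: stage_degree.simps)
  also have "\<dots> = cos_sum n (Ac j) x - cos_sum n phi x"
    by (simp add: phi_def cos_sum_diff)
  also have "cos_sum n (Ac j) x = stage j x"
    unfolding stage_def by (rule cos_sum_extend[OF supp_le_stage assms(1)])
  finally have "\<bar>cos_sum n (base_coeff D) x - stage j x\<bar> = \<bar>cos_sum n phi x\<bar>" by simp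
  also have "\<dots> \<le> 2 * (exp 8 / 2 ^ Suc j)"
    unfolding phi_def
  proof (rule partial_sum_average_le[OF incr_eval(1) incr_eval(3)[OF stage_coeff_0]])
    show "\<bar>cos_sum (Wd j) (incr j) y\<bar> \<le> exp 8 / 2 ^ Suc j" for y
      using stage_invariant(3)[of j y] unfolding incr_eval(2) stage_def .
    show "Wd j \<le> D ^ Wd j" using D_power_gt[of "Wd j"] by simp
  qed (rule product_degree_pos)
  finally show ?thesis by simp
qed

lemma stage_increment: "\<bar>stage (Suc j) x - stage j x\<bar> \<le> exp 8 / 2 ^ Suc j"
proof -
  have "\<bar>spaced_average T (Gd j) (Wd j) (2 * Wd j) (theta j) x\<bar> \<le> exp 8 / 2 ^ Suc j"
    by (rule abs_spaced_average_le) (use stage_invariant(3) product_degree_pos[of j] in auto)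
  then show ?thesis by (simp add: stage_Suc)
qed

lemma stage_cauchy: "i \<le> j \<Longrightarrow> \<bar>stage j x - stage i x\<bar> \<le> exp 8 * (1 / 2 ^ i - 1 / 2 ^ j)"
proof (induction j rule: dec_induct)
  case (step j)
  have "exp 8 / 2 ^ j = 2 * (exp 8 / 2 ^ Suc j :: real)" by simp
  then have "exp 8 * (1 / 2 ^ i - 1 / 2 ^ j) + exp 8 / 2 ^ Suc j = exp (8::real) * (1 / 2 ^ i - 1 / 2 ^ Suc j)"
    by (simp only: right_diff_distrib times_divide_eq_right mult_1_right)
  then show ?case using step.IH stage_increment[of j x] by linarith
qed simp

definition base_fun :: "circle \<Rightarrow> real" where "base_fun x = lim (\<lambda>j. stage j x)"

lemma base_fun_stage: "\<bar>base_fun x - stage i x\<bar> \<le> exp 8 / 2 ^ i"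
proof -
  have b: "\<bar>stage j x - stage i x\<bar> \<le> exp 8 / 2 ^ i" if "i \<le> j" for i j
  proof -
    have "exp 8 * (1 / 2 ^ i - 1 / 2 ^ j) \<le> exp (8::real) * (1 / 2 ^ i)" by (intro mult_left_mono) auto
    then show ?thesis using stage_cauchy[OF that, of x] by simp
  qed
  have t0: "(\<lambda>i. exp 8 / 2 ^ i :: real) \<longlonglongrightarrow> 0" by real_asymp
  have "Cauchy (\<lambda>j. stage j x)"
  proof (rule CauchyI')
    fix e :: real assume "e > 0"
    then obtain i where i: "exp 8 / 2 ^ i < e"
      using order_tendstoD(2)[OF t0] by (meson eventually_sequentially order_refl)
    show "\<exists>M. \<forall>m\<ge>M. \<forall>n>m. dist (stage m x) (stage n x) < e"
    proof (intro exI[of _ i] allI impI)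
      fix m n assume "i \<le> m" "m < n"
      then have "\<bar>stage n x - stage m x\<bar> \<le> exp 8 / 2 ^ m" by (intro b) auto
      also have "\<dots> \<le> exp 8 / 2 ^ i" using \<open>i \<le> m\<close> by (intro divide_left_mono power_increasing) auto
      finally show "dist (stage m x) (stage n x) < e"
        unfolding dist_real_def abs_minus_commute[of "stage m x"] using i by linarith
    qed
  qed
  then have lim: "(\<lambda>j. stage j x) \<longlonglongrightarrow> base_fun x"
    unfolding base_fun_def by (simp add: convergent_LIMSEQ_iff[symmetric] Cauchy_convergent_iff)
  have "(\<lambda>j. \<bar>stage j x - stage i x\<bar>) \<longlonglongrightarrow> \<bar>base_fun x - stage i x\<bar>"
    by (intro tendsto_intros lim)
  then show ?thesis
    by (rule tendsto_upperbound) (auto simp: eventually_sequentially intro!: exI[of _ i] b)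
qed

lemma base_fun_bound: "\<bar>base_fun x\<bar> \<le> exp 8"
  using base_fun_stage[of x 0] by (simp add: stage_def cos_sum_def)

lemma uniform_limit_stage: "uniform_limit UNIV stage base_fun sequentially"
  unfolding uniform_limit_iff
proof (intro allI impI)
  fix e :: real assume "e > 0"
  have "(\<lambda>i. exp 8 / 2 ^ i :: real) \<longlonglongrightarrow> 0" by real_asymp
  from order_tendstoD(2)[OF this \<open>e > 0\<close>]
  show "\<forall>\<^sub>F n in sequentially. \<forall>x\<in>UNIV. dist (stage n x) (base_fun x) < e"
    by eventually_elim
      (metis (no_types, lifting) abs_minus_commute base_fun_stage dist_norm order_le_less_trans real_norm_def)
qed

lemma continuous_stage: "continuous_on UNIV (stage j)"
  unfolding stage_def by (rule continuous_cos_sum)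

lemma continuous_base_fun: "continuous_on UNIV base_fun"
  by (rule uniform_limit_theorem[OF _ uniform_limit_stage]) (auto simp: continuous_stage)

lemma partial_sum_base:
  assumes "Gd j \<le> n" shows "\<bar>cos_sum n (base_coeff D) x - base_fun x\<bar> \<le> 2 * exp 8 / 2 ^ j"
proof -
  \<comment> \<open>The stage whose frequency band contains the cut-off.\<close>
  obtain i where i: "Gd i \<le> n" "n < Gd (Suc i)" "j \<le> i"
  proof -
    define P where "P = (\<lambda>i. j \<le> i \<and> Gd i \<le> n)"
    have Pj: "P j" using assms by (simp add: P_def)
    have bd: "P i \<Longrightarrow> i \<le> n" for i using stage_degree_ge[of i] by (auto simp: P_def)
    define i where "i = (GREATEST i. P i)"
    have Pi: "P i" unfolding i_def using GreatestI_nat[of P, OF Pj] bd by blast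
    have "\<not> P (Suc i)" using Greatest_le_nat[of P "Suc i"] bd unfolding i_def by (metis Suc_n_not_le_n)
    then show thesis using Pi that[of i] by (auto simp: P_def simp del: stage_degree.simps)
  qed
  have "\<bar>cos_sum n (base_coeff D) x - base_fun x\<bar> \<le> exp 8 / 2 ^ i + exp 8 / 2 ^ i"
    using partial_sum_stage[of i n x] i base_fun_stage[of x i] by linarith
  also have "\<dots> \<le> exp 8 / 2 ^ j + exp 8 / 2 ^ j"
    using i(3) by (intro add_mono divide_left_mono power_increasing) auto
  finally show ?thesis by simp
qed

lemma partial_sum_base_all: "\<bar>cos_sum n (base_coeff D) x - base_fun x\<bar> \<le> 2 * exp 8"
proof (cases "n = 0")
  case True
  then show ?thesis using base_fun_bound[of x] by (simp add: cos_sum_def base_coeff_0)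
next
  case False
  then show ?thesis using partial_sum_base[of 0 n x] by simp
qed

text \<open>For a stage \<open>f\<close>, the Birkhoff sums of \<open>f\<close> and \<open>u\<close> have integrals \<open>N \<integral> f\<close> and \<open>N \<integral> u\<close>; dividing the stage invariant
  by \<open>N\<close> removes the additive constant.\<close>

lemma integral_base_fun:
  assumes mu: "\<mu> \<in> invariant_measures T"
  shows "(\<integral>x. base_fun x \<partial>\<mu>) \<le> - \<bar>\<integral>x. circle_cos 1 x \<partial>\<mu>\<bar>"
proof -
  have P: "prob_space \<mu>" "sets \<mu> = sets borel" using mu by (auto simp: invariant_measures_def)
  interpret prob_space \<mu> by (rule P)
  note int = integrable_continuous_circle[OF finite_measure_axioms P(2)]
  have cT: "continuous_on UNIV (\<lambda>x. g ((T ^^ n) x))" if "continuous_on UNIV g" for g :: "circle \<Rightarrow> real" and n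
  proof -
    have "continuous_on UNIV (T ^^ n)"
      by (induction n) (auto simp: T_def intro: continuous_on_compose2[OF continuous_circle_times])
    then show ?thesis by (rule continuous_on_compose2[OF that]) auto
  qed
  have bs: "(\<integral>x. birkhoff_sum T g N x \<partial>\<mu>) = real N * (\<integral>x. g x \<partial>\<mu>)" if "continuous_on UNIV g" for g :: "circle \<Rightarrow> real" and N
  proof -
    have "(\<integral>x. birkhoff_sum T g N x \<partial>\<mu>) = (\<Sum>n<N. \<integral>x. g ((T ^^ n) x) \<partial>\<mu>)"
      unfolding birkhoff_sum_def by (intro Bochner_Integration.integral_sum int cT that)
    then show ?thesis using integral_invariant_funpow[OF mu[unfolded T_def] that] by (simp add: T_def)
  qed
  have cb: "continuous_on UNIV (\<lambda>x. birkhoff_sum T g N x)" if "continuous_on UNIV g" for g :: "circle \<Rightarrow> real" and N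
    unfolding birkhoff_sum_def by (intro continuous_intros cT that)
  define a where "a = (\<integral>x. circle_cos 1 x \<partial>\<mu>)"
  have j: "(\<integral>x. stage j x \<partial>\<mu>) + \<bar>a\<bar> \<le> 1 / 2 ^ j" for j
  proof -
    define s C where "s = (\<integral>x. stage j x \<partial>\<mu>)" and "C = 2 ^ 14 * real (Gd j)"
    have N: "real N * (s + \<bar>a\<bar>) \<le> real N * (1 / 2 ^ j) + C" for N
    proof -
      have "real N * \<bar>a\<bar> = \<bar>\<integral>x. birkhoff_sum T (circle_cos 1) N x \<partial>\<mu>\<bar>"
        by (simp add: bs continuous_circle_cos a_def abs_mult)
      also have "\<dots> \<le> (\<integral>x. \<bar>birkhoff_sum T (circle_cos 1) N x\<bar> \<partial>\<mu>)" by (rule integral_abs_bound)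
      finally have "real N * (s + \<bar>a\<bar>) \<le> (\<integral>x. birkhoff_sum T (stage j) N x \<partial>\<mu>) + (\<integral>x. \<bar>birkhoff_sum T (circle_cos 1) N x\<bar> \<partial>\<mu>)"
        by (simp add: bs continuous_stage s_def ring_distribs)
      also have "\<dots> = (\<integral>x. birkhoff_sum T (stage j) N x + \<bar>birkhoff_sum T (circle_cos 1) N x\<bar> \<partial>\<mu>)"
        by (rule Bochner_Integration.integral_add[symmetric])
          (intro int continuous_intros cb continuous_stage continuous_circle_cos)+
      also have "\<dots> \<le> (\<integral>x. real N * (1 / 2 ^ j) + C \<partial>\<mu>)"
        by (rule integral_mono)
          (auto simp: C_def intro!: int continuous_intros cb continuous_stage continuous_circle_cos stage_invariant(2)[simplified])
      finally show ?thesis by (simp add: prob_space)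
    qed
    show ?thesis
    proof (rule ccontr)
      assume "\<not> ?thesis"
      then have "s + \<bar>a\<bar> - 1 / 2 ^ j > 0" by (simp add: s_def)
      then obtain N where "C < real N * (s + \<bar>a\<bar> - 1 / 2 ^ j)" using reals_Archimedean3 by blast
      then show False using N[of N] by (simp add: right_diff_distrib)
    qed
  qed
  have est: "(\<integral>x. base_fun x \<partial>\<mu>) + \<bar>a\<bar> \<le> 1 / 2 ^ j + exp 8 / 2 ^ j" for j
  proof -
    have "(\<integral>x. base_fun x \<partial>\<mu>) \<le> (\<integral>x. stage j x + exp 8 / 2 ^ j \<partial>\<mu>)"
    proof (rule integral_mono)
      show "base_fun x \<le> stage j x + exp 8 / 2 ^ j" for x using base_fun_stage[of x j] by linarith
    qed (intro int continuous_intros continuous_base_fun continuous_stage)+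
    also have "\<dots> = (\<integral>x. stage j x \<partial>\<mu>) + exp 8 / 2 ^ j"
      by (simp add: int continuous_stage prob_space)
    finally show ?thesis using j[of j] by linarith
  qed
  have "(\<lambda>j. 1 / 2 ^ j + exp 8 / 2 ^ j :: real) \<longlonglongrightarrow> 0" by real_asymp
  then have "(\<integral>x. base_fun x \<partial>\<mu>) + \<bar>a\<bar> \<le> 0"
    by (rule tendsto_lowerbound) (use est in auto)
  then show ?thesis by (simp add: a_def)
qed

end

section \<open>Superposition over all frequencies\<close>

text \<open>Summation over the divisors \<open>Suc k\<close> of \<open>n\<close>, since the dilates vanish elsewhere.\<close>

definition full_coeff :: "nat \<Rightarrow> nat \<Rightarrow> rat" where
  "full_coeff D n = (\<Sum>k<n. dilate (Suc k) (base_coeff D) n / of_nat (4 ^ Suc k))"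

lemma circle_cos_times_nat: "circle_cos m (circle_times (int k) x) = circle_cos (m * k) x"
  by (simp only: circle_cos_eq circle_cosi_times of_nat_mult)

context expanding begin

definition full_fun :: "circle \<Rightarrow> real" where
  "full_fun x = (\<Sum>k. base_fun (circle_times (int (Suc k)) x) / 4 ^ Suc k)"

lemma four_power: "(4::real) ^ n = 2 ^ n * 2 ^ n"
  by (simp add: power_mult_distrib[symmetric])

lemma abs_term_le: "\<bar>base_fun y / 4 ^ Suc k\<bar> \<le> exp 8 * (1 / 2) ^ Suc k"
proof -
  have "\<bar>base_fun y / 4 ^ Suc k\<bar> = \<bar>base_fun y\<bar> / 2 ^ Suc k / 2 ^ Suc k"
    unfolding four_power by (simp add: abs_mult)
  also have "\<dots> \<le> exp 8 / 2 ^ Suc k / 1"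
    using base_fun_bound[of y] by (intro frac_le divide_right_mono) (auto intro: one_le_power simp del: power_Suc)
  finally show ?thesis by (simp add: power_one_over divide_simps)
qed

lemma summable_half: "summable (\<lambda>k. c * (1 / 2 :: real) ^ Suc k)"
  using power_half_series by (intro summable_mult) (rule sums_summable)

lemma summable_terms: "summable (\<lambda>k. base_fun (circle_times (int (Suc k)) x) / 4 ^ Suc k)"
  by (rule summable_comparison_test[OF _ summable_half[of "exp 8"]])
    (use abs_term_le in \<open>auto simp del: power_Suc\<close>)

lemma cos_sum_full_coeff:
  "cos_sum K (full_coeff D) x = (\<Sum>k<K. cos_sum (K div Suc k) (base_coeff D) (circle_times (int (Suc k)) x) / 4 ^ Suc k)"
proof -
  have eq: "full_coeff D n = (\<Sum>k<K. 1 / of_nat (4 ^ Suc k) * dilate (Suc k) (base_coeff D) n)" if "n \<le> K" for n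
  proof -
    have "full_coeff D n = (\<Sum>k<n. 1 / of_nat (4 ^ Suc k) * dilate (Suc k) (base_coeff D) n)"
      by (simp add: full_coeff_def)
    also have "\<dots> = (\<Sum>k<K. 1 / of_nat (4 ^ Suc k) * dilate (Suc k) (base_coeff D) n)"
    proof (rule sum.mono_neutral_left)
      have "dilate (Suc k) (base_coeff D) n = 0" if "\<not> k < n" for k
      proof (cases "n = 0")
        case False
        then have "\<not> Suc k dvd n" using that by (auto dest: dvd_imp_le)
        then show ?thesis by (simp add: dilate_def)
      qed (simp add: dilate_def base_coeff_0)
      then show "\<forall>k\<in>{..<K} - {..<n}. 1 / of_nat (4 ^ Suc k) * dilate (Suc k) (base_coeff D) n = 0" by auto
    qed (use that in auto)
    finally show ?thesis .
  qed
  have "cos_sum K (full_coeff D) x = cos_sum K (\<lambda>n. \<Sum>k<K. 1 / of_nat (4 ^ Suc k) * dilate (Suc k) (base_coeff D) n) x"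
    unfolding cos_sum_def by (intro sum.cong refl) (simp only: eq atMost_iff)
  also have "\<dots> = (\<Sum>k<K. of_rat (1 / of_nat (4 ^ Suc k)) * cos_sum K (dilate (Suc k) (base_coeff D)) x)"
    by (simp only: cos_sum_sum cos_sum_cmult)
  also have "\<dots> = (\<Sum>k<K. cos_sum (K div Suc k) (base_coeff D) (circle_times (int (Suc k)) x) / 4 ^ Suc k)"
  proof (intro sum.cong refl)
    fix k
    have "cos_sum K (dilate (Suc k) (base_coeff D)) x = cos_sum (K div Suc k) (base_coeff D) (circle_times (int (Suc k)) x)"
      by (rule cos_sum_dilate) (auto simp only: circle_cos_times_nat)
    moreover have "of_rat (1 / of_nat (4 ^ Suc k)) = (1 / 4 ^ Suc k :: real)"
      by (simp add: of_rat_divide of_rat_mult of_rat_power)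
    ultimately show "of_rat (1 / of_nat (4 ^ Suc k)) * cos_sum K (dilate (Suc k) (base_coeff D)) x
      = cos_sum (K div Suc k) (base_coeff D) (circle_times (int (Suc k)) x) / 4 ^ Suc k"
      by (simp only: times_divide_eq_left mult_1_left)
  qed
  finally show ?thesis .
qed

text \<open>For the first \<open>j\<close> superposed copies the partial sum is already close to its limit; for the others one factor
  \<open>1 / 2 ^ Suc k\<close> of the weight is at most \<open>1 / 2 ^ j\<close>. The other factor \<open>1 / 2 ^ Suc k\<close> makes the errors summable.\<close>

lemma partial_sum_full:
  assumes K: "j * Gd j \<le> K"
  shows "\<bar>cos_sum K (full_coeff D) x - full_fun x\<bar> \<le> 2 * exp 8 / 2 ^ j"
proof -
  define y where "y = (\<lambda>k. circle_times (int (Suc k)) x)"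
  define p where "p = (\<lambda>k. cos_sum (K div Suc k) (base_coeff D) (y k) / 4 ^ Suc k)"
  define t where "t = (\<lambda>k. base_fun (y k) / 4 ^ Suc k)"
  have p0: "p k = 0" if "k \<notin> {..<K}" for k
    using that by (simp add: p_def cos_sum_def base_coeff_0)
  have ps: "p sums cos_sum K (full_coeff D) x"
    unfolding cos_sum_full_coeff using sums_finite[of "{..<K}" p] p0 by (simp only: p_def y_def finite_lessThan) simp
  have ts: "t sums full_fun x"
    unfolding full_fun_def t_def y_def by (rule summable_sums[OF summable_terms])
  have est: "\<bar>p k - t k\<bar> \<le> 2 * exp 8 / 2 ^ j * (1 / 2) ^ Suc k" for k
  proof -
    have *: "\<bar>p k - t k\<bar> = \<bar>cos_sum (K div Suc k) (base_coeff D) (y k) - base_fun (y k)\<bar> / 2 ^ Suc k / 2 ^ Suc k"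
      unfolding p_def t_def diff_divide_distrib[symmetric] four_power by (simp add: abs_mult)
    have "\<bar>cos_sum (K div Suc k) (base_coeff D) (y k) - base_fun (y k)\<bar> / 2 ^ Suc k \<le> 2 * exp 8 / 2 ^ j"
    proof (cases "k < j")
      case True
      have "Gd j * Suc k \<le> Gd j * j" using True by (intro mult_left_mono) auto
      then have "Gd j * Suc k \<le> K" using K by (simp only: mult.commute[of j] order_trans)
      then have "Gd j \<le> K div Suc k" by (simp only: less_eq_div_iff_mult_less_eq zero_less_Suc)
      then have "\<bar>cos_sum (K div Suc k) (base_coeff D) (y k) - base_fun (y k)\<bar> / 2 ^ Suc k \<le> (2 * exp 8 / 2 ^ j) / 1"
        by (intro frac_le partial_sum_base) (auto intro: one_le_power simp del: power_Suc)
      then show ?thesis by simp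
    next
      case False
      then have "(2::real) ^ j \<le> 2 ^ Suc k" by (intro power_increasing) auto
      then show ?thesis by (intro frac_le partial_sum_base_all) auto
    qed
    then have "\<bar>p k - t k\<bar> \<le> 2 * exp 8 / 2 ^ j / 2 ^ Suc k"
      unfolding * by (rule divide_right_mono) simp
    then show ?thesis by (simp add: power_one_over)
  qed
  have "norm (\<Sum>k. p k - t k) \<le> (\<Sum>k. 2 * exp 8 / 2 ^ j * (1 / 2) ^ Suc k)"
    by (rule norm_suminf_le[OF _ summable_half]) (use est in \<open>simp only: real_norm_def\<close>)
  also have "\<dots> = 2 * exp 8 / 2 ^ j"
    using sums_unique[OF sums_mult[OF power_half_series, of "2 * exp 8 / 2 ^ j"], symmetric] by (simp only: mult_1_right)
  finally show ?thesis using sums_unique[OF sums_diff[OF ps ts]] by simp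
qed

lemma full_coeff_0: "full_coeff D 0 = 0"
  by (simp add: full_coeff_def)

lemma uniform_limit_full: "uniform_limit UNIV (\<lambda>K x. cos_sum K (full_coeff D) x) full_fun sequentially"
  unfolding uniform_limit_iff
proof (intro allI impI)
  fix e :: real assume "e > 0"
  have "(\<lambda>i. 2 * exp 8 / 2 ^ i :: real) \<longlonglongrightarrow> 0" by real_asymp
  from order_tendstoD(2)[OF this \<open>e > 0\<close>] obtain j where j: "2 * exp 8 / 2 ^ j < e"
    by (meson eventually_sequentially order_refl)
  show "\<forall>\<^sub>F K in sequentially. \<forall>x\<in>UNIV. dist (cos_sum K (full_coeff D) x) (full_fun x) < e"
    using eventually_ge_at_top[of "j * Gd j"]
  proof eventually_elim
    case (elim K)
    then show ?case using partial_sum_full[OF elim] j by (auto simp: dist_real_def intro: le_less_trans)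
  qed
qed

lemma continuous_full_fun: "continuous_on UNIV full_fun"
  by (rule uniform_limit_theorem[OF _ uniform_limit_full]) (auto simp: continuous_cos_sum)

lemma lebesgue_full_fun: "(\<integral>x. full_fun x \<partial>lebesgue_circle) = 0"
proof -
  interpret prob_space lebesgue_circle by (rule prob_space_lebesgue_circle)
  note int = integrable_continuous_circle[OF finite_measure_axioms sets_lebesgue_circle]
  have bound: "\<bar>\<integral>x. full_fun x \<partial>lebesgue_circle\<bar> \<le> 2 * exp 8 / 2 ^ j" for j
  proof -
    define s where "s = cos_sum (j * Gd j) (full_coeff D)"
    have sc: "continuous_on UNIV s" unfolding s_def by (rule continuous_cos_sum)
    have "(\<integral>x. s x \<partial>lebesgue_circle) = (\<Sum>k\<le>j * Gd j. \<integral>x. of_rat (full_coeff D k) * circle_cos k x \<partial>lebesgue_circle)"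
      unfolding s_def cos_sum_def by (intro Bochner_Integration.integral_sum int continuous_intros continuous_circle_cos)
    also have "\<dots> = 0" using full_coeff_0 by (intro sum.neutral) (auto simp: lebesgue_circle_cos of_bool_def)
    finally have "(\<integral>x. full_fun x \<partial>lebesgue_circle) = (\<integral>x. full_fun x - s x \<partial>lebesgue_circle)"
      by (simp add: int sc continuous_full_fun)
    also have "\<bar>\<dots>\<bar> \<le> (\<integral>x. \<bar>full_fun x - s x\<bar> \<partial>lebesgue_circle)" by (rule integral_abs_bound)
    also have "\<dots> \<le> (\<integral>x. 2 * exp 8 / 2 ^ j \<partial>lebesgue_circle)"
    proof (rule integral_mono)
      show "\<bar>full_fun x - s x\<bar> \<le> 2 * exp 8 / 2 ^ j" for x
        unfolding s_def using partial_sum_full[of j "j * Gd j" x] by (simp add: abs_minus_commute)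
    qed (intro int continuous_intros sc continuous_full_fun)+
    finally show ?thesis by (simp add: prob_space)
  qed
  have "(\<lambda>j. 2 * exp 8 / 2 ^ j :: real) \<longlonglongrightarrow> 0" by real_asymp
  then have "\<bar>\<integral>x. full_fun x \<partial>lebesgue_circle\<bar> \<le> 0"
    by (rule tendsto_lowerbound) (use bound in auto)
  then show ?thesis by simp
qed

text \<open>Multiplications of the circle commute, so the image of an invariant measure under one of them is invariant.\<close>

lemma distr_times_invariant:
  assumes mu: "\<mu> \<in> invariant_measures T"
  shows "distr \<mu> borel (circle_times k) \<in> invariant_measures T"
proof -
  have P: "prob_space \<mu>" "sets \<mu> = sets borel" "distr \<mu> borel T = \<mu>" using mu by (auto simp: invariant_measures_def)
  have m: "circle_times l \<in> \<mu> \<rightarrow>\<^sub>M borel" for l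
    using measurable_circle_times measurable_cong_sets[OF P(2) refl] by blast
  have comm: "T \<circ> circle_times k = circle_times k \<circ> T"
  proof
    fix x show "(T \<circ> circle_times k) x = (circle_times k \<circ> T) x"
      by (cases x rule: circle_cases) (simp add: T_def circle_times.abs_eq mult.left_commute)
  qed
  have "distr (distr \<mu> borel (circle_times k)) borel T = distr \<mu> borel (T \<circ> circle_times k)"
    unfolding T_def by (rule distr_distr) (auto intro: m)
  also have "\<dots> = distr (distr \<mu> borel T) borel (circle_times k)"
    unfolding comm unfolding T_def by (rule distr_distr[symmetric]) (auto intro: m)
  finally show ?thesis
    using prob_space.prob_space_distr[OF P(1) m] by (simp add: invariant_measures_def P)
qed

text \<open>The \<open>k\<close>-th term is the integral of the base function against the image of \<open>\<mu>\<close> under multiplication by \<open>Suc k\<close>, whose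
  first cosine coefficient is the one of \<open>\<mu>\<close> at \<open>Suc k\<close>. All terms are nonpositive, so the sum is at most any single one.\<close>

lemma integral_full_fun:
  assumes mu: "\<mu> \<in> invariant_measures T"
  shows "(\<integral>x. full_fun x \<partial>\<mu>) \<le> - \<bar>\<integral>x. circle_cos (Suc k) x \<partial>\<mu>\<bar> / 4 ^ Suc k"
proof -
  have P: "prob_space \<mu>" "sets \<mu> = sets borel" using mu by (auto simp: invariant_measures_def)
  interpret prob_space \<mu> by (rule P)
  note int = integrable_continuous_circle[OF finite_measure_axioms P(2)]
  define t where "t = (\<lambda>k x. base_fun (circle_times (int (Suc k)) x) / 4 ^ Suc k)"
  have tc: "continuous_on UNIV (t k)" for k
    unfolding t_def
    by (intro continuous_intros continuous_on_compose2[OF continuous_base_fun continuous_circle_times]) auto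
  have tb: "norm (t k x) \<le> exp 8 * (1 / 2) ^ Suc k" for k x
    unfolding t_def real_norm_def by (rule abs_term_le)
  define s where "s = (\<lambda>k. \<integral>x. t k x \<partial>\<mu>)"
  have sn: "(\<integral>x. norm (t k x) \<partial>\<mu>) \<le> exp 8 * (1 / 2) ^ Suc k" for k
  proof -
    have "(\<integral>x. norm (t k x) \<partial>\<mu>) \<le> (\<integral>x. exp 8 * (1 / 2) ^ Suc k \<partial>\<mu>)"
      by (rule integral_mono) (use tb in \<open>auto intro!: int continuous_intros tc simp del: power_Suc\<close>)
    then show ?thesis by (simp add: prob_space)
  qed
  have su: "summable (\<lambda>k. \<integral>x. norm (t k x) \<partial>\<mu>)"
    by (rule summable_comparison_test[OF _ summable_half[of "exp 8"]]) (use sn in \<open>auto simp del: power_Suc\<close>)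
  have AEs: "AE x in \<mu>. summable (\<lambda>k. norm (t k x))"
    by (intro AE_I2 summable_comparison_test[OF _ summable_half[of "exp 8"]])
      (use tb in \<open>auto simp del: power_Suc\<close>)
  have F: "(\<integral>x. full_fun x \<partial>\<mu>) = (\<Sum>k. s k)"
    unfolding full_fun_def s_def using integral_suminf[of \<mu> t, OF int[OF tc] AEs su] by (simp only: t_def)
  have ssum: "summable s"
    unfolding s_def using summable_integral[of \<mu> t, OF int[OF tc] AEs su] by simp
  have sk: "s k \<le> - \<bar>\<integral>x. circle_cos (Suc k) x \<partial>\<mu>\<bar> / 4 ^ Suc k" for k
  proof -
    let ?\<nu> = "distr \<mu> borel (circle_times (int (Suc k)))"
    have "(\<integral>x. base_fun (circle_times (int (Suc k)) x) \<partial>\<mu>) = (\<integral>x. base_fun x \<partial>?\<nu>)"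
      by (rule integral_circle_times[OF P(2) continuous_base_fun, symmetric])
    also have "\<dots> \<le> - \<bar>\<integral>x. circle_cos 1 x \<partial>?\<nu>\<bar>"
      by (rule integral_base_fun[OF distr_times_invariant[OF mu]])
    also have "(\<integral>x. circle_cos 1 x \<partial>?\<nu>) = (\<integral>x. circle_cos (Suc k) x \<partial>\<mu>)"
      unfolding integral_circle_times[OF P(2) continuous_circle_cos] circle_cos_times_nat by simp
    finally have "(\<integral>x. base_fun (circle_times (int (Suc k)) x) \<partial>\<mu>) / 4 ^ Suc k \<le> - \<bar>\<integral>x. circle_cos (Suc k) x \<partial>\<mu>\<bar> / 4 ^ Suc k"
      by (rule divide_right_mono) simp
    then show ?thesis by (simp add: s_def t_def)
  qed
  have nonpos: "s k \<le> 0" for k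
  proof -
    have "- \<bar>\<integral>x. circle_cos (Suc k) x \<partial>\<mu>\<bar> / 4 ^ Suc k \<le> 0" by (simp add: divide_nonpos_pos)
    then show ?thesis using sk[of k] by linarith
  qed
  have "(\<Sum>i\<in>{k}. - s i) \<le> (\<Sum>i. - s i)"
    by (rule sum_le_suminf) (use nonpos ssum in \<open>auto intro: summable_minus\<close>)
  then have "(\<Sum>i. s i) \<le> s k" using suminf_minus[OF ssum] by simp
  then show ?thesis using F sk[of k] by linarith
qed

lemma maximizing_iff: "maximizing_measure T full_fun \<mu> \<longleftrightarrow> \<mu> = lebesgue_circle"
proof -
  have d0: "d \<noteq> 0" using d by auto
  have leb: "lebesgue_circle \<in> invariant_measures T" unfolding T_def by (rule lebesgue_circle_invariant[OF d0])
  have nonpos: "(\<integral>x. full_fun x \<partial>\<nu>) \<le> 0" if "\<nu> \<in> invariant_measures T" for \<nu>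
  proof -
    have "- \<bar>\<integral>x. circle_cos (Suc 0) x \<partial>\<nu>\<bar> / 4 ^ Suc 0 \<le> 0" by simp
    then show ?thesis using integral_full_fun[OF that, of 0] by linarith
  qed
  have sup: "(SUP \<nu> \<in> invariant_measures T. \<integral>x. full_fun x \<partial>\<nu>) = 0"
    by (rule cSup_eq_maximum) (use leb lebesgue_full_fun nonpos in \<open>auto simp: image_iff intro!: bexI[of _ lebesgue_circle]\<close>)
  have "\<mu> = lebesgue_circle" if mu: "\<mu> \<in> invariant_measures T" and z: "(\<integral>x. full_fun x \<partial>\<mu>) = 0"
  proof (rule invariant_eq_lebesgue[OF d mu[unfolded T_def]])
    fix k :: nat assume "k > 0"
    then obtain i where k: "k = Suc i" by (cases k) auto
    have "\<bar>\<integral>x. circle_cos (Suc i) x \<partial>\<mu>\<bar> / 4 ^ Suc i \<le> 0"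
      using integral_full_fun[OF mu, of i] z by simp
    moreover have "(0::real) < 4 ^ Suc i" by simp
    ultimately have "\<bar>\<integral>x. circle_cos (Suc i) x \<partial>\<mu>\<bar> \<le> 0"
      by (simp only: pos_divide_le_eq mult_zero_left)
    then show "(\<integral>x. circle_cos k x \<partial>\<mu>) = 0" using k by simp
  qed
  then show ?thesis unfolding maximizing_measure_def sup using leb lebesgue_full_fun by auto
qed

end

section \<open>Computability of the coefficients\<close>

text \<open>Families of sequences are treated as functions of a pair: in \<open>\<lambda>q. a (p1 q) (p2 q)\<close> the first component carries the parameters, the
  second one the index.\<close>

lemma computable_rat_comp2:
  assumes "computable_rat (\<lambda>q. a (p1 q) (p2 q))" "computable f" "computable g"
  shows "computable_rat (\<lambda>x. a (f x) (g x))"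
  using computable_rat_comp[OF assms(1) computable_pr[OF assms(2,3)]] by simp

lemma computable_rat_unit_coeff:
  "computable f \<Longrightarrow> computable_rat (\<lambda>x. unit_coeff i (f x))"
  unfolding unit_coeff_def by (intro computable_rat_if decidable_eq computable_const computable_rat_const)

lemma computable_rat_dilate:
  assumes a: "computable_rat (\<lambda>q. a (p1 q) (p2 q))" and q: "computable q" and k: "computable k"
  shows "computable_rat (\<lambda>x. dilate (q x) (a x) (k x))"
  unfolding dilate_def
  by (intro computable_rat_if decidable_dvd computable_rat_const q k computable_rat_comp2[OF a] computable_div computable_id)

lemma computable_rat_average_coeff:
  assumes a: "computable_rat (\<lambda>q. a (p1 q) (p2 q))" and s: "computable s" and K: "computable K"
    and M: "computable M" and k: "computable k"
  shows "computable_rat (\<lambda>x. average_coeff D (s x) (K x) (M x) (a x) (k x))"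
  unfolding average_coeff_def
  by (intro computable_rat_divide_nat computable_rat_sum computable_rat_dilate computable_rat_comp2[OF a]
      computable_power computable_add computable_mult computable_const computable_p1 computable_p2 computable_id
      computable_comp[OF s] computable_comp[OF K] computable_comp[OF k] M)

lemma computable_rat_cos_mult:
  assumes a: "computable_rat (\<lambda>q. a (p1 q) (p2 q))" and b: "computable_rat (\<lambda>q. b (p1 q) (p2 q))"
    and B: "computable B" and C: "computable C" and k: "computable k"
  shows "computable_rat (\<lambda>x. cos_mult (B x) (C x) (a x) (b x) (k x))"
  unfolding cos_mult_def
  by (intro computable_rat_sum_atMost computable_rat_mult computable_rat_add computable_rat_if decidable_eq
      computable_rat_comp2[OF a] computable_rat_comp2[OF b] computable_rat_const
      computable_add computable_diff computable_p1 computable_p2 computable_id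
      computable_comp[OF k] computable_comp[OF C] B)

text \<open>A crude degree bound valid for all parameters: the recursion on codes needs one bound for all of them.\<close>

lemma supp_le_riesz_coeff_any:
  assumes "D > 0" shows "supp_le (riesz_coeff D K V c v i) (D ^ (K * i) * (V + 1))"
proof (cases i)
  case 0
  then show ?thesis by (simp add: supp_le_def unit_coeff_def)
next
  case (Suc j)
  have "supp_le (riesz_coeff D K V c v i) (D ^ (K * j) + V * D ^ (K * j))"
    unfolding Suc riesz_coeff.simps by (rule supp_le_cos_mult)
  moreover have "D ^ (K * j) \<le> D ^ (K * i)"
    using assms Suc by (intro power_increasing) auto
  then have "D ^ (K * j) + V * D ^ (K * j) \<le> D ^ (K * i) * (V + 1)"
    by (metis add.commute mult.commute mult_1 distrib_right mult_le_mono1)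
  ultimately show ?thesis by (rule supp_le_mono)
qed

lemma computable_rat_riesz_coeff:
  assumes D: "D > 0" and v: "computable_rat (\<lambda>q. v (p1 q) (p2 q))" and c: "computable_rat c"
    and K: "computable K" and V: "computable V" and i: "computable i" and k: "computable k"
  shows "computable_rat (\<lambda>x. riesz_coeff D (K x) (V x) (c x) (v x) (i x) (k x))"
proof (rule computable_rat_recursion[where f="\<lambda>x. x" and a="\<lambda>x i. riesz_coeff D (K x) (V x) (c x) (v x) i"
      and G="\<lambda>x i. D ^ (K x * i) * (V x + 1)"
      and init="\<lambda>x. unit_coeff 0"
      and step="\<lambda>x i a. cos_mult (D ^ (K x * i)) (V x * D ^ (K x * i)) a (\<lambda>k. unit_coeff 0 k + c x * dilate (D ^ (K x * i)) (v x) k)"])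
  show "computable_rat (\<lambda>q. cos_mult (D ^ (K (p1 q) * p1 (p2 q))) (V (p1 q) * D ^ (K (p1 q) * p1 (p2 q)))
      (seq_of_code (p1 (p2 (p2 q))))
      (\<lambda>k. unit_coeff 0 k + c (p1 q) * dilate (D ^ (K (p1 q) * p1 (p2 q))) (v (p1 q)) k) (p2 (p2 (p2 q))))"
    by (intro computable_rat_cos_mult computable_rat_seq_of_code computable_rat_add computable_rat_mult
        computable_rat_unit_coeff computable_rat_dilate computable_rat_comp2[OF v] computable_rat_comp[OF c]
        computable_power computable_mult computable_const computable_p1 computable_p2 computable_id
        computable_comp[OF K] computable_comp[OF V])
  show "riesz_coeff D (K x) (V x) (c x) (v x) j k \<noteq> 0 \<Longrightarrow> k \<le> D ^ (K x * j) * (V x + 1)" for x j k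
    using supp_le_riesz_coeff_any[OF D] unfolding supp_le_def by blast
qed (auto intro!: computable_rat_unit_coeff computable_power computable_mult computable_add computable_const
    computable_Suc computable_p1 computable_p2 computable_id computable_comp[OF K] computable_comp[OF V] i k)

lemma computable_block_length: "computable f \<Longrightarrow> computable g \<Longrightarrow> computable (\<lambda>x. block_length (f x) (g x))"
  unfolding block_length_def by (intro computable_mult computable_power computable_const computable_add)

lemma computable_block_degree: "computable f \<Longrightarrow> computable g \<Longrightarrow> computable (\<lambda>x. block_degree D (f x) (g x))"
  unfolding block_degree_def by (intro computable_mult computable_power computable_const computable_block_length)

lemma computable_factor_count: "computable f \<Longrightarrow> computable (\<lambda>x. factor_count (f x))"
  unfolding factor_count_def by (intro computable_mult computable_power computable_const computable_add)

lemma computable_product_degree: "computable f \<Longrightarrow> computable g \<Longrightarrow> computable (\<lambda>x. product_degree D (f x) (g x))"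
  unfolding product_degree_def
  by (intro computable_mult computable_power computable_const computable_block_degree computable_factor_count)

lemma computable_stage_degree: "computable f \<Longrightarrow> computable (\<lambda>x. stage_degree D (f x))"
proof -
  assume f: "computable f"
  have "stage_degree D n = rec_nat 1 (\<lambda>j G. product_degree D j G * D ^ (G + product_degree D j G * (2 * product_degree D j G))) n" for n
    by (induction n) auto
  moreover have "computable (\<lambda>x. rec_nat 1 (\<lambda>j G. product_degree D j G * D ^ (G + product_degree D j G * (2 * product_degree D j G))) (f x))"
    by (intro computable_rec f computable_const computable_mult computable_power computable_add computable_product_degree
      computable_p1 computable_p2 computable_id)
  ultimately show ?thesis by simp
qed

lemma computable_rat_product_coeff:
  assumes D: "D > 0" and a: "computable_rat (\<lambda>q. a (p1 q) (p2 q))" and j: "computable j" and G: "computable G" and k: "computable k"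
  shows "computable_rat (\<lambda>x. product_coeff D (j x) (G x) (a x) \<sigma> (k x))"
  unfolding product_coeff_def block_coeff_def
  by (intro computable_rat_riesz_coeff[OF D] computable_rat_average_coeff computable_rat_add computable_rat_mult
      computable_rat_comp2[OF a] computable_rat_unit_coeff computable_rat_const computable_rat_divide_nat
      computable_block_length computable_block_degree computable_factor_count computable_power computable_add
      computable_const computable_p1 computable_p2 computable_id computable_comp[OF j] computable_comp[OF G] j G k)

lemma computable_rat_increment_coeff:
  assumes D: "D > 0" and a: "computable_rat (\<lambda>q. a (p1 q) (p2 q))" and j: "computable j" and G: "computable G" and k: "computable k"
  shows "computable_rat (\<lambda>x. increment_coeff D (j x) (G x) (a x) (k x))"
  unfolding increment_coeff_def
  by (intro computable_rat_divide_nat computable_rat_diff computable_rat_add computable_rat_mult computable_rat_const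
    computable_rat_unit_coeff computable_rat_product_coeff[OF D a] computable_power computable_add computable_const j G k)

context expanding begin

lemma computable_rat_base_coeff: "computable_rat (base_coeff D)"
proof -
  have D: "D > 0" using D2 by simp
  have "computable_rat (\<lambda>x. stage_coeff D x x)"
  proof (rule computable_rat_recursion[where f="\<lambda>x. x" and g="\<lambda>x. x" and h="\<lambda>x. x"
        and a="\<lambda>x. stage_coeff D" and G="\<lambda>x. stage_degree D" and init="\<lambda>x k. 0"
        and step="\<lambda>x j a k. a k - average_coeff D (Gd j) (Wd j) (2 * Wd j) (increment_coeff D j (Gd j) a) k"])
    show "stage_coeff D j k \<noteq> 0 \<Longrightarrow> k \<le> stage_degree D j" for j k
      using supp_le_stage[of j] unfolding supp_le_def by blast
    show "computable_rat (\<lambda>q. seq_of_code (p1 (p2 (p2 q))) (p2 (p2 (p2 q))) -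
        average_coeff D (Gd (p1 (p2 q))) (Wd (p1 (p2 q))) (2 * Wd (p1 (p2 q)))
          (increment_coeff D (p1 (p2 q)) (Gd (p1 (p2 q))) (seq_of_code (p1 (p2 (p2 q))))) (p2 (p2 (p2 q))))"
      by (intro computable_rat_diff computable_rat_average_coeff computable_rat_increment_coeff[OF D] computable_rat_seq_of_code
          computable_stage_degree computable_product_degree computable_mult computable_const computable_p1 computable_p2 computable_id)
  qed (auto intro!: computable_stage_degree computable_rat_const computable_p2 computable_id)
  then show ?thesis by (simp add: base_coeff_def[abs_def])
qed

lemma computable_rat_full_coeff: "computable_rat (full_coeff D)"
proof -
  have "computable_rat (\<lambda>n. full_coeff D n)"
    unfolding full_coeff_def
    by (intro computable_rat_sum computable_rat_divide_nat computable_rat_dilate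
        computable_rat_comp[OF computable_rat_base_coeff] computable_power computable_Suc computable_const
        computable_p1 computable_p2 computable_id)
  then show ?thesis by simp
qed

end

theorem theorem1:
  fixes d :: int
  assumes "\<bar>d\<bar> \<ge> 2"
  shows "\<exists>(c :: nat \<Rightarrow> rat) (F :: circle \<Rightarrow> real).
    continuous_on UNIV F \<and>
    (\<forall>x. (\<lambda>k. of_rat (c (Suc k)) * circle_cos (Suc k) x) sums F x) \<and>
    uniform_limit UNIV (\<lambda>K x. \<Sum>k=1..K. of_rat (c k) * circle_cos k x) F sequentially \<and>
    (\<forall>\<mu>. maximizing_measure (circle_times d) F \<mu> \<longleftrightarrow> \<mu> = lebesgue_circle) \<and>
    computable_rat_seq c"
proof -
  interpret expanding d "nat \<bar>d\<bar>" "circle_times d"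
    by unfold_locales (use assms in auto)
  define c where "c = full_coeff (nat \<bar>d\<bar>)"
  have eq: "(\<Sum>k=1..K. of_rat (c k) * circle_cos k x) = cos_sum K c x" for K x
    unfolding cos_sum_def
    by (rule sum.mono_neutral_left) (auto simp: c_def full_coeff_0 not_less_eq_eq)
  have ul: "uniform_limit UNIV (\<lambda>K x. \<Sum>k=1..K. of_rat (c k) * circle_cos k x) full_fun sequentially"
    unfolding eq using uniform_limit_full by (simp add: c_def)
  have "(\<lambda>k. of_rat (c (Suc k)) * circle_cos (Suc k) x) sums full_fun x" for x
    unfolding sums_def
    using tendsto_uniform_limitI[OF ul, of x] by (simp add: sum.atLeast1_atMost_eq)
  then show ?thesis
    using continuous_full_fun ul maximizing_iff computable_rat_seqI[OF computable_rat_full_coeff]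
    unfolding c_def by blast
qed

end
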